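(* Let $N\in\mathbb{N}$, $1<p\le N$, let $f:\mathbb{R}\to\mathbb{R}$ be continuous with $f(0)=0$, put $F(\xi)=\int_0^{\xi}f(t)\,dt$, and assume $\inf_{\xi\ge 0}F(\xi)\ge 0$. Let $q:[0,1]\to\mathbb{R}$ be continuous and let $q_0>0$ be a constant with $q(t)\ge q_0$ for all $t\in[0,1]$. Suppose that there exist two sequences $\{a_k\}_{k\in\mathbb{N}}$ and $\{b_k\}_{k\in\mathbb{N}}$ in $]0,+\infty[$, with $a_k<b_k$ for all $k$ and $\lim_{k\to+\infty}b_k=+\infty$, such that: (i) $\lim_{k\to+\infty}\frac{b_k}{a_k}=+\infty$; (ii) $\max_{[a_k,b_k]}f\le 0$ for all $k\in\mathbb{N}$; (iii) $$\frac{\sigma(p,q_0)}{p\left(\sup_{t\in(0,1)}\mathrm{dist}(t,\{0,1\})\right)^p}<\limsup_{\xi\to+\infty}\frac{F(\xi)}{\xi^p}<+\infty,\qquad\text{where}\quad \sigma(p,q_0)=\inf_{\mu\in]0,1[}\frac{1}{q_0\,\mu(1-\mu)^{p-1}}.$$ Then the problem $$(|v'(t)|^{p-2}v'(t))'+q(t)f(v(t))=0\ \text{ in }(0,1),\qquad v(0)=v(1)=0,$$ admits an unbounded sequence of non-negative weak solutions in $W^{1,p}_0(0,1)$. Respectively, let $0<a<b$ and $\Omega_{a,b}=\{x\in\mathbb{R}^N: a<|x|<b\}$. Let $1<p\le N$, let $f:\mathbb{R}\to\mathbb{R}$ be continuous with $f(0)=0$ and $\inf_{\xi\ge 0}F(\xi)\ge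 0$, where $F(\xi)=\int_0^{\xi}f(t)\,dt$, and let $q_0>0$ be a constant with $q_{a,b}\ge q_0$ on $[0,1]$, where $q_{a,b}$ is the specific function defined in the context. Suppose that there exist two sequences $\{a_k\}_{k\in\mathbb{N}}$ and $\{b_k\}_{k\in\mathbb{N}}$ in $]0,+\infty[$, with $a_k<b_k$ for all $k$ and $\lim_{k\to+\infty}b_k=+\infty$, such that $\lim_{k\to+\infty}\frac{b_k}{a_k}=+\infty$, $\max_{[a_k,b_k]}f\le 0$ for all $k\in\mathbb{N}$, and $$\frac{\sigma(p,q_0)}{p\left(\sup_{t\in(0,1)}\mathrm{dist}(t,\{0,1\})\right)^p}<\limsup_{\xi\to+\infty}\frac{F(\xi)}{\xi^p}<+\infty,\qquad\text{where}\quad \sigma(p,q_0)=\inf_{\mu\in]0,1[}\frac{1}{q_0\,\mu(1-\mu)^{p-1}}.$$ Then the problem $$-\Delta_p u=f(u)\ \text{ in }\Omega_{a,b},\qquad u=0\ \text{ on }\partial\Omega_{a,b},$$ admits an unbounded sequence of non-negative weak solutions in $W^{1,p}_0(\Omega_{a,b})$.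
   Context: Here $\Delta_p u=\mathrm{div}(|\nabla u|^{p-2}\nabla u)$. The space $W^{1,p}_0(0,1)$ is endowed with the norm $\|v\|=\left(\int_0^1|v'(t)|^p\,dt\right)^{1/p}$; "unbounded sequence" means unbounded in the norm of the Sobolev space. A weak solution of the ODE problem is any $v\in W^{1,p}_0(0,1)$ such that $\int_0^1|v'|^{p-2}v'w'\,dt-\int_0^1 q(t)f(v(t))w(t)\,dt=0$ for every $w\in W^{1,p}_0(0,1)$. Weak solutions of the problem in $\Omega_{a,b}$ are understood in the usual sense: $u\in W^{1,p}_0(\Omega_{a,b})$ with $\int_{\Omega_{a,b}}|\nabla u|^{p-2}\nabla u\cdot\nabla w\,dx=\int_{\Omega_{a,b}}f(u)w\,dx$ for test functions $w$. The function $q_{a,b}:[0,1]\to\mathbb{R}$ associated with the annulus $\Omega_{a,b}$ is defined as follows. If $1<p<N$, set $$A=\frac{(ab)^{\frac{N-p}{p-1}}}{b^{\frac{N-p}{p-1}}-a^{\frac{N-p}{p-1}}},\qquad B=\frac{b^{\frac{N-p}{p-1}}}{b^{\frac{N-p}{p-1}}-a^{\frac{N-p}{p-1}}},\qquad q_{a,b}(t)=\left(\frac{p-1}{N-p}\right)^{p}\frac{A^{\frac{(p-1)p}{N-p}}}{(B-t)^{\frac{p(N-1)}{N-p}}}.$$ If $p=N$, set $q_{a,b}(t)=\left[a\left(\frac{b}{a}\right)^t\ln\frac{b}{a}\right]^{p}$. In both cases $q_{a,b}$ is continuous and bounded between positive constants on $[0,1]$; radial functions $u(x)=v(t)$ correspond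 via $t=-A|x|^{-(N-p)/(p-1)}+B$ when $p<N$, and $|x|=a(b/a)^t$ when $p=N$. *)

theory Defs
  imports "HOL-Analysis.Analysis"
begin

section \<open>Sobolev spaces on open sets\<close>

text \<open>
  Elements of Lebesgue and Sobolev spaces are represented by functions on the whole space, of
  which only the values almost everywhere in \<open>\<Omega>\<close> matter.
\<close>

definition partial :: "'a::euclidean_space \<Rightarrow> ('a \<Rightarrow> real) \<Rightarrow> 'a \<Rightarrow> real" where
  "partial i f x = frechet_derivative f (at x) i"

primrec Ck :: "nat \<Rightarrow> ('a::euclidean_space \<Rightarrow> real) \<Rightarrow> bool" where
  "Ck 0 f \<longleftrightarrow> continuous_on UNIV f"
| "Ck (Suc k) f \<longleftrightarrow> (\<forall>x. f differentiable at x) \<and> (\<forall>i\<in>Basis. Ck k (partial i f))"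

definition test_fun :: "'a::euclidean_space set \<Rightarrow> ('a \<Rightarrow> real) set" where
  "test_fun \<Omega> =
     {\<phi>. (\<forall>k. Ck k \<phi>) \<and> compact (closure {x. \<phi> x \<noteq> 0}) \<and> closure {x. \<phi> x \<noteq> 0} \<subseteq> \<Omega>}"

definition Lp :: "real \<Rightarrow> 'a::euclidean_space set \<Rightarrow> ('a \<Rightarrow> 'b::euclidean_space) set" where
  "Lp p \<Omega> = {u. u \<in> borel_measurable (lebesgue_on \<Omega>) \<and>
                integrable (lebesgue_on \<Omega>) (\<lambda>x. norm (u x) powr p)}"

definition Lp_norm :: "real \<Rightarrow> 'a::euclidean_space set \<Rightarrow> ('a \<Rightarrow> 'b::euclidean_space) \<Rightarrow> real" where
  "Lp_norm p \<Omega> u = (LINT x|lebesgue_on \<Omega>. norm (u x) powr p) powr (1 / p)"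

definition loc_integrable ::
    "'a::euclidean_space set \<Rightarrow> ('a \<Rightarrow> 'b::euclidean_space) \<Rightarrow> bool" where
  "loc_integrable \<Omega> u \<longleftrightarrow> (\<forall>K. compact K \<and> K \<subseteq> \<Omega> \<longrightarrow> integrable (lebesgue_on K) u)"

definition is_weak_grad ::
    "'a::euclidean_space set \<Rightarrow> ('a \<Rightarrow> real) \<Rightarrow> ('a \<Rightarrow> 'a) \<Rightarrow> bool" where
  "is_weak_grad \<Omega> u G \<longleftrightarrow> loc_integrable \<Omega> u \<and> loc_integrable \<Omega> G \<and>
     (\<forall>\<phi>\<in>test_fun \<Omega>. \<forall>i\<in>Basis.
        (LINT x|lebesgue_on \<Omega>. u x * partial i \<phi> x)
          = - (LINT x|lebesgue_on \<Omega>. (G x \<bullet> i) * \<phi> x))"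

text \<open>
  On an open \<open>\<Omega>\<close> the weak gradient is unique up to a null set. For \<open>'a = real\<close>, where the only
  basis vector is \<open>1\<close>, it is the weak derivative.
\<close>

definition weak_grad :: "'a::euclidean_space set \<Rightarrow> ('a \<Rightarrow> real) \<Rightarrow> 'a \<Rightarrow> 'a" where
  "weak_grad \<Omega> u = (SOME G. is_weak_grad \<Omega> u G)"

definition W1p :: "real \<Rightarrow> 'a::euclidean_space set \<Rightarrow> ('a \<Rightarrow> real) set" where
  "W1p p \<Omega> = {u \<in> Lp p \<Omega>. \<exists>G \<in> Lp p \<Omega>. is_weak_grad \<Omega> u G}"

definition W1p_norm :: "real \<Rightarrow> 'a::euclidean_space set \<Rightarrow> ('a \<Rightarrow> real) \<Rightarrow> real" where
  "W1p_norm p \<Omega> u = (Lp_norm p \<Omega> u powr p + Lp_norm p \<Omega> (weak_grad \<Omega> u) powr p) powr (1 / p)"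

definition W01p :: "real \<Rightarrow> 'a::euclidean_space set \<Rightarrow> ('a \<Rightarrow> real) set" where
  "W01p p \<Omega> = {u \<in> W1p p \<Omega>. \<exists>\<phi>. (\<forall>n::nat. \<phi> n \<in> test_fun \<Omega>) \<and>
                  (\<lambda>n. W1p_norm p \<Omega> (\<lambda>x. \<phi> n x - u x)) \<longlonglongrightarrow> 0}"

definition W01p_norm :: "real \<Rightarrow> 'a::euclidean_space set \<Rightarrow> ('a \<Rightarrow> real) \<Rightarrow> real" where
  "W01p_norm p \<Omega> u = Lp_norm p \<Omega> (weak_grad \<Omega> u)"


section \<open>Weak solutions\<close>

text \<open>
  Where the gradient vanishes, \<open>|\<nabla>u|\<^sup>p\<^sup>-\<^sup>2 \<nabla>u\<close> is \<open>0\<close>, also when \<open>p < 2\<close> (\<open>0 powr s = 0\<close>).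
\<close>

definition ode_weak_solution ::
    "real \<Rightarrow> (real \<Rightarrow> real) \<Rightarrow> (real \<Rightarrow> real) \<Rightarrow> (real \<Rightarrow> real) \<Rightarrow> bool" where
  "ode_weak_solution p q f v \<longleftrightarrow>
     (let I = {0<..<1}; D = weak_grad I in
      v \<in> W01p p I \<and>
      (\<forall>w \<in> W01p p I.
         (LINT t|lebesgue_on I. \<bar>D v t\<bar> powr (p - 2) * D v t * D w t)
           - (LINT t|lebesgue_on I. q t * f (v t) * w t) = 0))"

text \<open>
  In dimension greater than one \<open>f \<circ> u\<close> need not be integrable against every \<open>w\<close>, so that
  integrability is made part of the notion: the Bochner integral of a non-integrable function
  is \<open>0\<close> by convention.
\<close>

definition plap_weak_solution ::
    "real \<Rightarrow> (real ^ 'n) set \<Rightarrow> (real \<Rightarrow> real) \<Rightarrow> (real ^ 'n \<Rightarrow> real) \<Rightarrow> bool" where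
  "plap_weak_solution p \<Omega> f u \<longleftrightarrow>
     (let D = weak_grad \<Omega> in
      u \<in> W01p p \<Omega> \<and>
      (\<forall>w \<in> W01p p \<Omega>.
         integrable (lebesgue_on \<Omega>) (\<lambda>x. f (u x) * w x) \<and>
         (LINT x|lebesgue_on \<Omega>. norm (D u x) powr (p - 2) * (D u x \<bullet> D w x))
           = (LINT x|lebesgue_on \<Omega>. f (u x) * w x)))"


section \<open>Data of the problems\<close>

definition primitive :: "(real \<Rightarrow> real) \<Rightarrow> real \<Rightarrow> real" where
  "primitive f \<xi> = (LBINT t=ereal 0..ereal \<xi>. f t)"

definition sigma :: "real \<Rightarrow> real \<Rightarrow> real" where
  "sigma p q0 = (INF \<mu>\<in>{0<..<1}. 1 / (q0 * \<mu> * (1 - \<mu>) powr (p - 1)))"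

definition annulus :: "real \<Rightarrow> real \<Rightarrow> (real ^ 'n) set" where
  "annulus a b = {x. a < norm x \<and> norm x < b}"

definition q_annulus :: "nat \<Rightarrow> real \<Rightarrow> real \<Rightarrow> real \<Rightarrow> real \<Rightarrow> real" where
  "q_annulus N p a b t =
     (if p < real N then
        (let s = (real N - p) / (p - 1);
             A = (a * b) powr s / (b powr s - a powr s);
             B = b powr s / (b powr s - a powr s)
         in ((p - 1) / (real N - p)) powr p
              * A powr ((p - 1) * p / (real N - p))
              / (B - t) powr (p * (real N - 1) / (real N - p)))
      else (a * (b / a) powr t * ln (b / a)) powr p)"

end

theory Submission
  imports Defs "HOL-Complex_Analysis.Great_Picard" "HOL-Real_Asymp.Real_Asymp"
begin

text \<open>Fix \<open>b\<close> with \<open>f b \<le> 0\<close> and freeze \<open>f\<close> outside \<open>[0, b]\<close>. A minimiser \<open>v\<close> of the energy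
  \<open>\<integral>|v'|\<^sup>p / p - q F(v)\<close> of the truncated problem solves the truncated equation; at an extremum
  outside \<open>[0, b]\<close> the sign of \<open>f\<close> gives a contradiction, so \<open>0 \<le> v \<le> b\<close> and \<open>v\<close> solves the original
  equation. Comparison with (smoothed) trapezoids of height \<open>\<xi>\<close> on which \<open>F(\<xi>) / \<xi>\<^sup>p\<close> exceeds the
  threshold shows that the minimal energies tend to \<open>-\<infinity>\<close> as \<open>b\<close> grows, hence the minimisers are
  unbounded. To obtain minimisers without weak compactness, the slopes \<open>v'\<close> are restricted to a
  convex compact set of continuous functions large enough to contain the slope of the solution of
  every linear problem \<open>-(|z'|\<^sup>p\<^sup>-\<^sup>2 z')' = q f(v)\<close>.
  In the annulus, \<open>u(x) = v(\<tau>(|x|))\<close> is a \<open>C\<^sup>1\<close> function for which \<open>|\<nabla>u|\<^sup>p\<^sup>-\<^sup>2 \<nabla>u\<close> is a \<open>C\<^sup>1\<close> field with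
  divergence \<open>-f(u)\<close>.\<close>

section \<open>Signed powers and convergence on the unit interval\<close>

text \<open>A minimiser over a constrained set satisfies a one-sided inequality only, and the linear
  problem used to test it depends on the minimiser itself. Truncation breaks the circle: frozen
  nonlinearities are bounded, so all these linear problems share one bound, and one bound and
  modulus of continuity for the slopes can be fixed in advance. The threshold is the energy balance
  of a trapezoid: two ramps of length l cost 2 l (xi / l)^p / p, the plateau of length mu = 1 - 2 l
  gains at least mu q0 F(xi). With F(xi) = c xi^p the total is negative as soon as c > 2^p / (p q0
  mu (1 - mu)^(p - 1)). The infimum over mu gives \<open>sigma\<close>, and 2 is the reciprocal of
  the largest distance 1/2 to the endpoints. Second derivatives of v never occur: the flux P =
  |v'|^(p-2) v' is carried along as a second unknown and is C^1 even where v' vanishes. Since test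
  functions in the annulus need not be radial, the equation there is checked against arbitrary ones,
  by the divergence identity. Large maxima force large norms through the inequality x <= 1 +
  x^p.\<close>

definition spow :: "real \<Rightarrow> real \<Rightarrow> real" where
  "spow r x = sgn x * \<bar>x\<bar> powr r"

text \<open>Splitting into positive and negative parts leaves powers of non-negative bases, so
  continuity, monotonicity and derivatives need no case analysis at the change of sign.\<close>

lemma spow_eq_max: "spow r x = max 0 x powr r - max 0 (- x) powr r"
  by (cases "x > 0"; cases "x = 0") (auto simp: spow_def sgn_if max_def)

lemma spow_zero [simp]: "spow r 0 = 0"
  by (simp add: spow_def)

lemma spow_minus: "spow r (- x) = - spow r x"
  by (simp add: spow_def sgn_minus)

lemma abs_spow: "\<bar>spow r x\<bar> = \<bar>x\<bar> powr r"
  by (simp add: spow_def abs_mult sgn_if)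

text \<open>With exponents \<open>p - 1\<close> and \<open>1 / (p - 1)\<close> the two signed powers
  are mutually inverse; this converts between slopes and fluxes throughout.\<close>

lemma spow_spow: "spow r (spow s x) = spow (r * s) x"
proof (cases "x = 0")
  case False
  then have "sgn (spow s x) = sgn x"
    by (simp add: spow_def sgn_mult)
  then show ?thesis
    by (simp add: spow_def[of r "spow s x"] abs_spow powr_powr mult.commute)
      (simp add: spow_def)
qed simp

lemma spow_one [simp]: "spow 1 x = x"
  by (simp add: spow_def mult_sgn_abs)

lemma abs_powr_mult_eq_spow: "\<bar>x\<bar> powr (p - 2) * x = spow (p - 1) x"
proof (cases "x = 0")
  case False
  then have "\<bar>x\<bar> powr (p - 1) = \<bar>x\<bar> powr (p - 2) * \<bar>x\<bar>"
    using powr_add[of "\<bar>x\<bar>" "p - 2" 1] by simp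
  then show ?thesis
    by (simp add: spow_def sgn_if)
qed simp

lemma spow_strict_mono:
  assumes "r > 0" "x < y"
  shows "spow r x < spow r y"
proof -
  have "max 0 x powr r \<le> max 0 y powr r" "max 0 (- y) powr r \<le> max 0 (- x) powr r"
    using assms by (auto intro!: powr_mono2)
  moreover have "max 0 x powr r < max 0 y powr r \<or> max 0 (- y) powr r < max 0 (- x) powr r"
  proof (cases "y > 0")
    case True
    then show ?thesis
      using assms by (intro disjI1 powr_less_mono2) auto
  next
    case False
    then show ?thesis
      using assms by (intro disjI2 powr_less_mono2) auto
  qed
  ultimately show ?thesis
    by (auto simp: spow_eq_max)
qed

lemma spow_mono:
  assumes "r > 0" "x \<le> y"
  shows "spow r x \<le> spow r y"
  using spow_strict_mono[of r x y] assms by (cases "x = y") auto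

lemma continuous_on_spow [continuous_intros]:
  assumes "r > 0" "continuous_on S g"
  shows "continuous_on S (\<lambda>x. spow r (g x))"
  unfolding spow_eq_max using assms
  by (intro continuous_intros continuous_on_powr') auto

text \<open>The delicate point is 0, where the difference quotient is dominated by |h|^(p-1), which
  tends to 0 because p > 1.\<close>

lemma has_real_derivative_max_powr:
  assumes "p > 1"
  shows "((\<lambda>x. max 0 x powr p) has_real_derivative p * max 0 x powr (p - 1)) (at x)"
proof -
  consider "x > 0" | "x < 0" | "x = 0" by linarith
  then show ?thesis
  proof cases
    case 1
    have "((\<lambda>x. x powr p) has_real_derivative p * x powr (p - 1)) (at x)"
      using 1 by (auto intro!: derivative_eq_intros)
    then have "((\<lambda>x. max 0 x powr p) has_real_derivative p * x powr (p - 1)) (at x)"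
      by (rule DERIV_cong_ev[OF refl _ refl, THEN iffD1, rotated])
        (use 1 in \<open>auto intro!: eventually_mono[OF eventually_nhds_in_open[of "{0<..}"]]\<close>)
    with 1 show ?thesis by simp
  next
    case 2
    have "((\<lambda>x. 0) has_real_derivative 0) (at x)"
      by simp
    then have "((\<lambda>x. max 0 x powr p) has_real_derivative 0) (at x)"
      by (rule DERIV_cong_ev[OF refl _ refl, THEN iffD1, rotated])
        (use 2 assms in \<open>auto intro!: eventually_mono[OF eventually_nhds_in_open[of "{..<0}"]]\<close>)
    with 2 assms show ?thesis by simp
  next
    case 3
    have "((\<lambda>h. \<bar>h\<bar> powr (p - 1)) \<longlongrightarrow> 0) (at (0::real))"
    proof -
      have "continuous_on UNIV (\<lambda>h::real. \<bar>h\<bar> powr (p - 1))"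
        using assms by (intro continuous_intros continuous_on_powr') auto
      then have "isCont (\<lambda>h::real. \<bar>h\<bar> powr (p - 1)) 0"
        by (simp add: continuous_on_eq_continuous_at)
      then show ?thesis
        using assms by (simp add: isCont_def)
    qed
    then have "((\<lambda>h. max 0 h powr p / h) \<longlongrightarrow> 0) (at (0::real))"
    proof (rule Lim_null_comparison[rotated])
      have "norm (max 0 h powr p / h) \<le> \<bar>h\<bar> powr (p - 1)" for h :: real
        using assms by (cases "h > 0") (auto simp: powr_diff max_def intro!: divide_nonneg_nonpos)
      then show "\<forall>\<^sub>F h in at 0. norm (max 0 h powr p / h) \<le> \<bar>h\<bar> powr (p - 1)"
        by simp
    qed
    then show ?thesis
      using 3 assms by (simp add: DERIV_def)
  qed
qed

lemma has_real_derivative_abs_powr: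
  assumes "p > 1"
  shows "((\<lambda>x. \<bar>x\<bar> powr p) has_real_derivative p * spow (p - 1) x) (at x)"
proof -
  have "((\<lambda>x. max 0 x powr p + max 0 (- x) powr p) has_real_derivative
         p * max 0 x powr (p - 1) + p * max 0 (- x) powr (p - 1) * (- 1)) (at x)"
    by (intro derivative_intros has_real_derivative_max_powr[OF assms]
         DERIV_chain2[OF has_real_derivative_max_powr[OF assms]])
  moreover have "(\<lambda>x. max 0 x powr p + max 0 (- x) powr p) = (\<lambda>x. \<bar>x\<bar> powr p)"
    by (auto simp: fun_eq_iff max_def)
  ultimately show ?thesis
    by (simp add: spow_eq_max algebra_simps)
qed

section \<open>Limits of integrals and of difference quotients\<close>

lemma bounded_convergence_01:
  fixes f :: "nat \<Rightarrow> real \<Rightarrow> real"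
  assumes "\<And>n. continuous_on {0..1} (f n)" "\<And>n t. t \<in> {0..1} \<Longrightarrow> \<bar>f n t\<bar> \<le> C"
    and "\<And>t. t \<in> {0..1} \<Longrightarrow> (\<lambda>n. f n t) \<longlonglongrightarrow> g t"
  shows "(\<lambda>n. integral {0..1} (f n)) \<longlonglongrightarrow> integral {0..1} g"
  by (rule dominated_convergence(2)[where h = "\<lambda>_. C"])
    (use assms in \<open>auto intro: integrable_continuous_real\<close>)

lemma convex_abs_ball: "convex {x::real. \<bar>x\<bar> \<le> R}"
  using convex_cball[of "0::real" R] by (simp add: cball_def)

text \<open>The mean value inequality provides a bound independent of the step \<open>e\<close>; it
  serves as the dominating constant when the energy is differentiated under the integral.\<close>

lemma difference_quotient_bounded:
  fixes k K :: "real \<Rightarrow> real"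
  assumes "\<And>x. (K has_real_derivative k x) (at x)"
    and "\<And>x. \<bar>x\<bar> \<le> R \<Longrightarrow> \<bar>k x\<bar> \<le> C" and "\<bar>y\<bar> \<le> R" "\<bar>y + e * d\<bar> \<le> R" "e > 0"
  shows "\<bar>(K (y + e * d) - K y) / e\<bar> \<le> C * \<bar>d\<bar>"
proof -
  have "\<bar>K (y + e * d) - K y\<bar> \<le> C * \<bar>(y + e * d) - y\<bar>"
    using field_differentiable_bound[of "{x. \<bar>x\<bar> \<le> R}" K k C "y + e * d" y] assms
    by (auto intro: has_field_derivative_at_within simp: convex_abs_ball)
  then show ?thesis
    using assms(5) by (simp add: abs_mult field_simps)
qed

lemma difference_quotient_tendsto:
  fixes k K :: "real \<Rightarrow> real"
  assumes "(K has_real_derivative k y) (at y)" and e: "e \<longlonglongrightarrow> 0" "\<And>n::nat. e n > 0"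
  shows "(\<lambda>n. (K (y + e n * d) - K y) / e n) \<longlonglongrightarrow> k y * d"
proof -
  have "((\<lambda>x. K (y + x * d)) has_real_derivative k y * d) (at 0)"
    by (rule DERIV_chain2[of K]) (use assms in \<open>auto intro!: derivative_eq_intros\<close>)
  then have "((\<lambda>h. (K (y + h * d) - K y) / h) \<longlongrightarrow> k y * d) (at 0)"
    by (simp add: DERIV_def)
  moreover have "filterlim e (at 0) sequentially"
    using e by (auto simp: filterlim_at less_imp_neq[symmetric])
  ultimately show ?thesis
    by (rule filterlim_compose)
qed

section \<open>Minimisation of the energy\<close>

lemma abs_integral_le_01:
  fixes g :: "real \<Rightarrow> real"
  assumes "continuous_on {0..1} g" "\<And>t. t \<in> {0..1} \<Longrightarrow> \<bar>g t\<bar> \<le> R" "t \<in> {0..1}"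
  shows "\<bar>integral {0..t} g\<bar> \<le> R"
proof -
  have "\<bar>integral {0..t} g\<bar> \<le> R * (t - 0)"
    using integral_bound[of 0 t g R] assms continuous_on_subset[OF assms(1), of "{0..t}"]
    by auto
  moreover have "0 \<le> R"
    using assms(2,3) abs_ge_zero order_trans by blast
  ultimately show ?thesis
    using assms(3) mult_left_le[of t R] by auto
qed

lemma has_real_derivative_integral_01:
  fixes g :: "real \<Rightarrow> real"
  assumes "continuous_on {0..1} g" "t \<in> {0..1}"
  shows "((\<lambda>t. integral {0..t} g) has_real_derivative g t) (at t within {0..1})"
  using integral_has_real_derivative[OF assms] .

text \<open>The variable is the slope \<open>g\<close>, and the function itself is recovered as its
  primitive. The condition at 0 is thereby built in, and the condition at 1 becomes the linear
  constraint that \<open>g\<close> has integral zero.\<close>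

definition energy :: "real \<Rightarrow> (real \<Rightarrow> real) \<Rightarrow> (real \<Rightarrow> real) \<Rightarrow> (real \<Rightarrow> real) \<Rightarrow> real" where
  "energy p q K g = integral {0..1} (\<lambda>t. \<bar>g t\<bar> powr p / p - q t * K (integral {0..t} g))"

lemma continuous_on_integral_01:
  fixes g :: "real \<Rightarrow> real"
  assumes "continuous_on {0..1} g"
  shows "continuous_on {0..1} (\<lambda>t. integral {0..t} g)"
  using assms by (intro indefinite_integral_continuous_1 integrable_continuous_real)

lemma continuous_on_energy_integrand:
  fixes g :: "real \<Rightarrow> real" and K :: "real \<Rightarrow> real"
  assumes "p > 0" "continuous_on {0..1} q" "continuous_on UNIV K" "continuous_on {0..1} g"
  shows "continuous_on {0..1} (\<lambda>t. \<bar>g t\<bar> powr p / p - q t * K (integral {0..t} g))"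
proof -
  have "continuous_on {0..1} (\<lambda>t. \<bar>g t\<bar> powr p)"
    by (rule continuous_on_powr') (use assms in \<open>auto intro!: continuous_intros\<close>)
  moreover have "continuous_on {0..1} (\<lambda>t. K (integral {0..t} g))"
    by (rule continuous_on_compose2[OF assms(3) continuous_on_integral_01[OF assms(4)]]) auto
  ultimately show ?thesis
    using assms by (intro continuous_on_diff continuous_on_divide continuous_on_mult continuous_on_const) auto
qed

lemma integral_tendsto_01:
  fixes G :: "nat \<Rightarrow> real \<Rightarrow> real"
  assumes "\<And>n. continuous_on {0..1} (G n)" "\<And>n t. t \<in> {0..1} \<Longrightarrow> \<bar>G n t\<bar> \<le> R"
    and "\<And>t. t \<in> {0..1} \<Longrightarrow> (\<lambda>n. G n t) \<longlonglongrightarrow> g t" "t \<in> {0..1}"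
  shows "(\<lambda>n. integral {0..t} (G n)) \<longlonglongrightarrow> integral {0..t} g"
  by (rule dominated_convergence(2)[where h = "\<lambda>_. R"])
    (use assms in \<open>auto intro!: integrable_continuous_real intro: continuous_on_subset[of "{0..1}"]\<close>)

lemma bounded_image_01:
  fixes q :: "real \<Rightarrow> real"
  assumes "continuous_on {0..1} q"
  obtains C where "C > 0" "\<And>t. t \<in> {0..1} \<Longrightarrow> \<bar>q t\<bar> \<le> C"
proof -
  have "bounded (q ` {0..1})"
    using assms by (intro compact_imp_bounded compact_continuous_image) auto
  then show ?thesis
    using that by (auto simp: bounded_pos)
qed

text \<open>For uniformly bounded slopes, pointwise convergence is inherited by the primitives, and
  the integrands of the energy stay bounded; dominated convergence then suffices.\<close>

lemma energy_tendsto: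
  assumes "p > 0" "continuous_on {0..1} q" "continuous_on UNIV K"
    and "\<And>n. continuous_on {0..1} (G n)" "\<And>n t. t \<in> {0..1} \<Longrightarrow> \<bar>G n t\<bar> \<le> R"
    and "\<And>t. t \<in> {0..1} \<Longrightarrow> (\<lambda>n. G n t) \<longlonglongrightarrow> g t"
  shows "(\<lambda>n. energy p q K (G n)) \<longlonglongrightarrow> energy p q K g"
proof -
  obtain Q where Q: "Q > 0" "\<And>t. t \<in> {0..1} \<Longrightarrow> \<bar>q t\<bar> \<le> Q"
    using bounded_image_01[OF assms(2)] by blast
  \<comment> \<open>On the unit interval the primitive of a slope bounded by \<open>R\<close> is
    again bounded by \<open>R\<close>, so values of \<open>K\<close> outside this range never
    occur.\<close>
  have "bounded (K ` {-R..R})"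
    using assms(3) by (intro compact_imp_bounded compact_continuous_image) (auto intro: continuous_on_subset)
  then obtain B where B: "\<And>x. \<bar>x\<bar> \<le> R \<Longrightarrow> \<bar>K x\<bar> \<le> B" "B > 0"
    by (force simp: bounded_pos abs_le_iff)
  show ?thesis
    unfolding energy_def
  proof (rule bounded_convergence_01)
    show "continuous_on {0..1} (\<lambda>t. \<bar>G n t\<bar> powr p / p - q t * K (integral {0..t} (G n)))" for n
      by (rule continuous_on_energy_integrand) (use assms in auto)
    show "\<bar>\<bar>G n t\<bar> powr p / p - q t * K (integral {0..t} (G n))\<bar> \<le> R powr p / p + Q * B"
      if t: "t \<in> {0..1}" for n t
    proof -
      have "\<bar>G n t\<bar> powr p \<le> R powr p"
        using assms(1) assms(5)[OF t] by (intro powr_mono2) auto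
      then have "\<bar>\<bar>G n t\<bar> powr p / p\<bar> \<le> R powr p / p"
        using assms(1) by (auto simp: divide_right_mono)
      moreover have "\<bar>q t * K (integral {0..t} (G n))\<bar> \<le> Q * B"
        unfolding abs_mult
        by (intro mult_mono Q B abs_integral_le_01 assms t) (use Q in auto)
      ultimately show ?thesis
        by linarith
    qed
    show "(\<lambda>n. \<bar>G n t\<bar> powr p / p - q t * K (integral {0..t} (G n)))
            \<longlonglongrightarrow> \<bar>g t\<bar> powr p / p - q t * K (integral {0..t} g)" if t: "t \<in> {0..1}" for t
    proof -
      have "isCont K (integral {0..t} g)"
        using assms(3) by (simp add: continuous_on_eq_continuous_at)
      moreover have "(\<lambda>n. integral {0..t} (G n)) \<longlonglongrightarrow> integral {0..t} g"
        by (rule integral_tendsto_01) (use assms t in auto)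
      ultimately have "(\<lambda>n. K (integral {0..t} (G n))) \<longlonglongrightarrow> K (integral {0..t} g)"
        by (rule isCont_tendsto_compose)
      moreover have "(\<lambda>n. \<bar>G n t\<bar> powr p) \<longlonglongrightarrow> \<bar>g t\<bar> powr p"
        using assms(1) assms(6)[OF t] by (intro tendsto_powr2 tendsto_intros) auto
      ultimately show ?thesis
        using assms(1) by (intro tendsto_diff tendsto_divide tendsto_mult tendsto_const) auto
    qed
  qed
qed

text \<open>A convex set, compact by the Arzela--Ascoli theorem.\<close>

definition slopes :: "real \<Rightarrow> (real \<Rightarrow> real) \<Rightarrow> (real \<Rightarrow> real) set" where
  "slopes R \<delta> = {g. continuous_on {0..1} g \<and> (\<forall>t\<in>{0..1}. \<bar>g t\<bar> \<le> R) \<and> integral {0..1} g = 0 \<and>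
     (\<forall>e>0. \<forall>s\<in>{0..1}. \<forall>t\<in>{0..1}. \<bar>s - t\<bar> < \<delta> e \<longrightarrow> \<bar>g s - g t\<bar> \<le> e)}"

lemma convex_slopes:
  assumes "g \<in> slopes R \<delta>" "h \<in> slopes R \<delta>" "0 \<le> e" "e \<le> 1"
  shows "(\<lambda>t. g t + e * (h t - g t)) \<in> slopes R \<delta>"
proof -
  have eq: "g t + e * (h t - g t) = (1 - e) * g t + e * h t" for t
    by (simp add: algebra_simps)
  have conv: "\<bar>(1 - e) * x + e * y\<bar> \<le> B" if "\<bar>x\<bar> \<le> B" "\<bar>y\<bar> \<le> B" for x y B :: real
  proof -
    have "\<bar>(1 - e) * x + e * y\<bar> \<le> (1 - e) * \<bar>x\<bar> + e * \<bar>y\<bar>"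
      using assms by (intro order_trans[OF abs_triangle_ineq]) (simp add: abs_mult)
    also have "\<dots> \<le> (1 - e) * B + e * B"
      using assms that by (intro add_mono mult_left_mono) auto
    finally show ?thesis by (simp add: algebra_simps)
  qed
  have "g integrable_on {0..1}" "h integrable_on {0..1}"
    using assms by (auto simp: slopes_def intro: integrable_continuous_real)
  then have "integral {0..1} (\<lambda>t. (1 - e) * g t + e * h t) = 0"
    using assms by (subst Henstock_Kurzweil_Integration.integral_add)
      (auto simp: slopes_def intro!: integrable_on_mult_right)
  moreover have "\<bar>((1 - e) * g s + e * h s) - ((1 - e) * g t + e * h t)\<bar> \<le> r"
    if "r > 0" "s \<in> {0..1}" "t \<in> {0..1}" "\<bar>s - t\<bar> < \<delta> r" for r s t
  proof -
    have "((1 - e) * g s + e * h s) - ((1 - e) * g t + e * h t) =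
        (1 - e) * (g s - g t) + e * (h s - h t)"
      by (simp add: algebra_simps)
    then show ?thesis
      using conv[of "g s - g t" r "h s - h t"] that assms by (auto simp: slopes_def)
  qed
  ultimately show ?thesis
    unfolding eq slopes_def using assms
    by (auto simp: slopes_def intro!: continuous_intros conv)
qed

text \<open>Boundedness and the common modulus give a uniformly convergent subsequence. Every
  condition defining \<open>slopes\<close> is a non-strict inequality or an integral identity and
  therefore passes to the limit.\<close>

lemma slopes_sequentially_compact:
  assumes "\<And>e. e > 0 \<Longrightarrow> \<delta> e > 0" "\<And>n. G n \<in> slopes R \<delta>"
  obtains g k where "g \<in> slopes R \<delta>" "strict_mono (k :: nat \<Rightarrow> nat)"
    "\<And>t. t \<in> {0..1} \<Longrightarrow> (\<lambda>n. G (k n) t) \<longlonglongrightarrow> g t"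
proof -
  have G: "continuous_on {0..1} (G n)" "t \<in> {0..1} \<Longrightarrow> \<bar>G n t\<bar> \<le> R" "integral {0..1} (G n) = 0"
    "\<lbrakk>e > 0; s \<in> {0..1}; t \<in> {0..1}; \<bar>s - t\<bar> < \<delta> e\<rbrakk> \<Longrightarrow> \<bar>G n s - G n t\<bar> \<le> e" for n s t e
    using assms(2)[of n] by (auto simp: slopes_def)
  obtain g k where g: "continuous_on {0..1} g" "strict_mono (k :: nat \<Rightarrow> nat)"
    "\<And>e. 0 < e \<Longrightarrow> \<exists>N. \<forall>n x. n \<ge> N \<and> x \<in> {0..1} \<longrightarrow> norm (G (k n) x - g x) < e"
  proof (rule Arzela_Ascoli[of "{0..1::real}" G R])
    fix x e :: real assume xe: "x \<in> {0..1}" "0 < e"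
    show "\<exists>d>0. \<forall>n y. y \<in> {0..1} \<and> norm (x - y) < d \<longrightarrow> norm (G n x - G n y) < e"
    proof (intro exI conjI allI impI)
      \<comment> \<open>The modulus yields a non-strict bound while equicontinuity asks for a strict
        one, hence half of \<open>e\<close>.\<close>
      show "\<delta> (e / 2) > 0" using assms(1) xe by simp
      fix n y assume "y \<in> {0..1} \<and> norm (x - y) < \<delta> (e / 2)"
      then have "\<bar>G n x - G n y\<bar> \<le> e / 2"
        using xe by (intro G(4)) auto
      then show "norm (G n x - G n y) < e"
        using xe by simp
    qed
  qed (use G(2) in auto)
  have lim: "(\<lambda>n. G (k n) t) \<longlonglongrightarrow> g t" if "t \<in> {0..1}" for t
    unfolding LIMSEQ_def dist_norm using g(3) that by meson
  have "g \<in> slopes R \<delta>"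
    unfolding slopes_def
  proof (intro CollectI conjI ballI allI impI)
    show "\<bar>g t\<bar> \<le> R" if "t \<in> {0..1}" for t
      by (rule LIMSEQ_le_const2[OF tendsto_rabs[OF lim[OF that]]]) (use G(2) that in auto)
    show "\<bar>g s - g t\<bar> \<le> e" if "e > 0" "s \<in> {0..1}" "t \<in> {0..1}" "\<bar>s - t\<bar> < \<delta> e" for e s t
      by (rule LIMSEQ_le_const2[OF tendsto_rabs[OF tendsto_diff[OF lim lim]]])
        (use G(4) that in auto)
    have "(\<lambda>n. integral {0..1} (G (k n))) \<longlonglongrightarrow> integral {0..1} g"
      by (rule integral_tendsto_01[where R = R]) (use G lim in auto)
    then show "integral {0..1} g = 0"
      by (simp add: G LIMSEQ_const_iff)
  qed (fact g(1))
  with g(2) lim show ?thesis by (rule that[rotated 1])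
qed

text \<open>The set of energy values is shown to be a compact set of reals, which avoids putting a
  topology on the slopes.\<close>

lemma energy_attains_min:
  assumes "p > 0" "continuous_on {0..1} q" "continuous_on UNIV K"
    and "\<And>e. e > 0 \<Longrightarrow> \<delta> e > 0" "slopes R \<delta> \<noteq> {}"
  shows "\<exists>g\<in>slopes R \<delta>. \<forall>h\<in>slopes R \<delta>. energy p q K g \<le> energy p q K h"
proof -
  have "compact (energy p q K ` slopes R \<delta>)"
    unfolding compact_def
  proof (intro allI impI)
    fix f :: "nat \<Rightarrow> real" assume "\<forall>n. f n \<in> energy p q K ` slopes R \<delta>"
    then have "\<forall>n. \<exists>g. g \<in> slopes R \<delta> \<and> f n = energy p q K g"
      by blast
    from choice[OF this] obtain G where G: "\<And>n. G n \<in> slopes R \<delta>"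
      "\<And>n. f n = energy p q K (G n)"
      by blast
    obtain g k where g: "g \<in> slopes R \<delta>" "strict_mono (k :: nat \<Rightarrow> nat)"
      "\<And>t. t \<in> {0..1} \<Longrightarrow> (\<lambda>n. G (k n) t) \<longlonglongrightarrow> g t"
      using slopes_sequentially_compact[of \<delta> G R, OF assms(4) G(1)] by blast
    have "(\<lambda>n. energy p q K (G (k n))) \<longlonglongrightarrow> energy p q K g"
      by (rule energy_tendsto[where R = R]) (use assms G g in \<open>auto simp: slopes_def\<close>)
    then show "\<exists>l\<in>energy p q K ` slopes R \<delta>. \<exists>r. strict_mono r \<and> (f \<circ> r) \<longlonglongrightarrow> l"
      using g G(2) by (auto simp: o_def)
  qed
  then obtain y where "y \<in> energy p q K ` slopes R \<delta>" "\<forall>z\<in>energy p q K ` slopes R \<delta>. y \<le> z"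
    using compact_attains_inf[of "energy p q K ` slopes R \<delta>"] assms(5) by blast
  then show ?thesis
    by auto
qed

text \<open>First variation at a minimiser over a convex set. Admissible moves go from
  \<open>g\<close> towards another member \<open>h\<close>, so the derivative in the direction
  \<open>h - g\<close> is non-negative rather than zero.\<close>

lemma energy_directional_derivative_nonneg:
  assumes "p > 1" "continuous_on {0..1} q"
    and K: "\<And>x. (K has_real_derivative k x) (at x)" "continuous_on UNIV k" "\<And>x. \<bar>k x\<bar> \<le> B"
    and g: "continuous_on {0..1} g" "continuous_on {0..1} h"
      "\<And>t. t \<in> {0..1} \<Longrightarrow> \<bar>g t\<bar> \<le> R" "\<And>t. t \<in> {0..1} \<Longrightarrow> \<bar>h t\<bar> \<le> R"
    and min: "\<And>e. 0 < e \<Longrightarrow> e \<le> 1 \<Longrightarrow>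
      energy p q K g \<le> energy p q K (\<lambda>t. g t + e * (h t - g t))"
  shows "0 \<le> integral {0..1} (\<lambda>t. spow (p - 1) (g t) * (h t - g t)
           - q t * (k (integral {0..t} g) * integral {0..t} (\<lambda>t. h t - g t)))"
proof -
  define d where "d t = h t - g t" for t
  define v where "v t = integral {0..t} g" for t
  define D where "D t = integral {0..t} d" for t
  define e where "e n = 1 / real (Suc n)" for n
  have e: "e n > 0" "e n \<le> 1" "e \<longlonglongrightarrow> 0" for n
    using LIMSEQ_inverse_real_of_nat by (auto simp: e_def[abs_def] inverse_eq_divide)
  have d: "continuous_on {0..1} d" "\<And>t. t \<in> {0..1} \<Longrightarrow> \<bar>d t\<bar> \<le> 2 * R"
    using g unfolding d_def by (auto intro!: continuous_intros simp: abs_le_iff) (smt (verit))+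
  obtain Q where Q: "Q > 0" "\<And>t. t \<in> {0..1} \<Longrightarrow> \<bar>q t\<bar> \<le> Q"
    using bounded_image_01[OF assms(2)] by blast
  have contK: "continuous_on UNIV K"
    using K(1) by (meson DERIV_continuous continuous_at_imp_continuous_on)
  define L where "L x = \<bar>x\<bar> powr p / p" for x :: real
  have L: "(L has_real_derivative spow (p - 1) x) (at x)" for x
    unfolding L_def using DERIV_cdivide[OF has_real_derivative_abs_powr[OF assms(1), of x], of p] assms(1) by simp
  have Lb: "\<bar>spow (p - 1) x\<bar> \<le> R powr (p - 1)" if "\<bar>x\<bar> \<le> R" for x
    using that assms(1) by (auto simp: abs_spow intro!: powr_mono2)
  have R: "0 \<le> R"
    using g(3)[of 0] by simp
  define I where "I n t = (L (g t + e n * d t) - L (g t)) / e n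
       - q t * ((K (v t + e n * D t) - K (v t)) / e n)" for n t
  have vD: "integral {0..t} (\<lambda>t. g t + e n * d t) = v t + e n * D t" if "t \<in> {0..1}" for n t
  proof -
    have "g integrable_on {0..t}" "d integrable_on {0..t}"
      using that by (auto intro!: integrable_continuous_real
          intro: continuous_on_subset[OF g(1)] continuous_on_subset[OF d(1)])
    then show ?thesis
      unfolding v_def D_def
      by (subst Henstock_Kurzweil_Integration.integral_add) (auto intro!: integrable_on_mult_right)
  qed
  have contgd: "continuous_on {0..1} (\<lambda>t. g t + e n * d t)" for n
    by (intro continuous_intros g d)
  have cont1: "continuous_on {0..1} (\<lambda>t. L (g t + e n * d t) - q t * K (v t + e n * D t))" for n
  proof -
    have "continuous_on {0..1} (\<lambda>t. \<bar>g t + e n * d t\<bar> powr p / p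
        - q t * K (integral {0..t} (\<lambda>t. g t + e n * d t)))"
      by (rule continuous_on_energy_integrand) (use assms contK contgd in auto)
    then show ?thesis
      by (rule continuous_on_eq) (simp add: L_def vD)
  qed
  have cont0: "continuous_on {0..1} (\<lambda>t. L (g t) - q t * K (v t))"
    unfolding L_def v_def
    by (rule continuous_on_energy_integrand) (use assms contK in auto)
  have I_eq: "I n t = ((L (g t + e n * d t) - q t * K (v t + e n * D t)) - (L (g t) - q t * K (v t))) / e n"
    for n t
    using e(1)[of n] by (simp add: I_def field_simps)
  have "integral {0..1} (I n) \<ge> 0" for n
  proof -
    have "energy p q K g = integral {0..1} (\<lambda>t. L (g t) - q t * K (v t))"
      by (simp add: energy_def L_def v_def)
    moreover have "energy p q K (\<lambda>t. g t + e n * d t) =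
        integral {0..1} (\<lambda>t. L (g t + e n * d t) - q t * K (v t + e n * D t))"
      unfolding energy_def by (rule integral_cong) (simp add: L_def vD)
    ultimately have "0 \<le> integral {0..1} (\<lambda>t. (L (g t + e n * d t) - q t * K (v t + e n * D t)) - (L (g t) - q t * K (v t)))"
      using min[OF e(1,2), of n] cont0 cont1[of n]
      by (subst Henstock_Kurzweil_Integration.integral_diff)
        (auto intro: integrable_continuous_real simp: d_def)
    then show ?thesis
      unfolding I_eq using e(1)[of n] by (simp add: divide_inverse)
  qed
  moreover have "(\<lambda>n. integral {0..1} (I n)) \<longlonglongrightarrow>
      integral {0..1} (\<lambda>t. spow (p - 1) (g t) * d t - q t * (k (v t) * D t))"
  proof (rule bounded_convergence_01)
    show "continuous_on {0..1} (I n)" for n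
      unfolding I_eq using e(1)[of n] by (intro continuous_intros cont0 cont1) auto
    show "\<bar>I n t\<bar> \<le> R powr (p - 1) * (2 * R) + Q * (B * (2 * R))" if t: "t \<in> {0..1}" for n t
    proof -
      have B: "0 \<le> B"
        using K(3)[of 0] by simp
      \<comment> \<open>The displaced slope is a convex combination of \<open>g\<close> and
        \<open>h\<close>; on the ball of radius \<open>R\<close> the derivative of \<open>L\<close>
        has a bound that does not depend on \<open>n\<close>.\<close>
      have le: "\<bar>g t + e n * d t\<bar> \<le> R"
      proof -
        have "g t + e n * d t = (1 - e n) * g t + e n * h t"
          by (simp add: d_def algebra_simps)
        also have "\<bar>\<dots>\<bar> \<le> (1 - e n) * \<bar>g t\<bar> + e n * \<bar>h t\<bar>"
          using e(1,2)[of n] by (intro order_trans[OF abs_triangle_ineq]) (simp add: abs_mult)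
        also have "\<dots> \<le> (1 - e n) * R + e n * R"
          using e(1,2)[of n] g(3,4)[OF t] by (intro add_mono mult_left_mono) auto
        finally show ?thesis by (simp add: algebra_simps)
      qed
      have "\<bar>(L (g t + e n * d t) - L (g t)) / e n\<bar> \<le> R powr (p - 1) * \<bar>d t\<bar>"
        by (rule difference_quotient_bounded[where k = "spow (p - 1)" and R = R])
          (use L Lb g(3)[OF t] le e in auto)
      also have "\<dots> \<le> R powr (p - 1) * (2 * R)"
        by (intro mult_left_mono d t) auto
      finally have 1: "\<bar>(L (g t + e n * d t) - L (g t)) / e n\<bar> \<le> R powr (p - 1) * (2 * R)" .
      have "\<bar>(K (v t + e n * D t) - K (v t)) / e n\<bar> \<le> B * \<bar>D t\<bar>"
        by (rule difference_quotient_bounded[where k = k and R = "max \<bar>v t\<bar> \<bar>v t + e n * D t\<bar>"])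
          (use K e in auto)
      also have "\<dots> \<le> B * (2 * R)"
        unfolding D_def by (intro mult_left_mono abs_integral_le_01 d t B) auto
      finally have "\<bar>q t * ((K (v t + e n * D t) - K (v t)) / e n)\<bar> \<le> Q * (B * (2 * R))"
        unfolding abs_mult[of "q t"] by (intro mult_mono Q t) (use Q in auto)
      with 1 show ?thesis
        unfolding I_def by linarith
    qed
    show "(\<lambda>n. I n t) \<longlonglongrightarrow> spow (p - 1) (g t) * d t - q t * (k (v t) * D t)" if "t \<in> {0..1}" for t
      unfolding I_def
      by (intro tendsto_diff tendsto_mult tendsto_const difference_quotient_tendsto L K e)
  qed
  ultimately have "0 \<le> integral {0..1} (\<lambda>t. spow (p - 1) (g t) * d t - q t * (k (v t) * D t))"
    by (intro LIMSEQ_le_const) auto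
  then show ?thesis
    by (simp add: d_def[abs_def] v_def D_def)
qed

text \<open>Integrating the equation once gives the flux c minus the primitive of \<open>h\<close>,
  with a free constant c. The mean of the corresponding slope is continuous in c, non-positive at -M
  and non-negative at M, so some c in between meets the second boundary condition. This also
  explains the bound \<open>2 * M\<close>.\<close>

lemma linear_problem:
  assumes "p > 1" "continuous_on {0..1} h" "\<And>t. t \<in> {0..1} \<Longrightarrow> \<bar>h t\<bar> \<le> M"
  obtains P where "\<And>t. t \<in> {0..1} \<Longrightarrow> (P has_real_derivative - h t) (at t within {0..1})"
    "integral {0..1} (\<lambda>t. spow (1 / (p - 1)) (P t)) = 0"
    "\<And>t. t \<in> {0..1} \<Longrightarrow> \<bar>P t\<bar> \<le> 2 * M"
proof -
  define H where "H t = integral {0..t} h" for t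
  define \<Psi> where "\<Psi> c = integral {0..1} (\<lambda>t. spow (1 / (p - 1)) (c - H t))" for c
  have contH: "continuous_on {0..1} H"
    unfolding H_def using assms(2) by (rule continuous_on_integral_01)
  have H: "\<bar>H t\<bar> \<le> M" if "t \<in> {0..1}" for t
    unfolding H_def using assms(2,3) that by (rule abs_integral_le_01)
  have M: "0 \<le> M"
    using H[of 0] by simp
  have r: "1 / (p - 1) > 0"
    using assms(1) by simp
  have cont: "continuous_on {0..1} (\<lambda>t. spow (1 / (p - 1)) (c - H t))" for c
    by (intro continuous_intros contH r)
  have "continuous_on UNIV \<Psi>"
    unfolding \<Psi>_def box_real[symmetric]
    by (rule integral_continuous_on_param, unfold case_prod_beta)
      (intro continuous_intros r continuous_on_compose2[OF contH], auto)
  then have "isCont \<Psi> c" for c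
    by (simp add: continuous_on_eq_continuous_at)
  moreover have "\<Psi> (- M) \<le> 0"
  proof -
    have "\<Psi> (- M) \<le> integral {0..1} (\<lambda>t::real. 0)"
      unfolding \<Psi>_def
    proof (rule integral_le)
    show "spow (1 / (p - 1)) (- M - H t) \<le> 0" if "t \<in> {0..1}" for t
      using spow_mono[OF r, of "- M - H t" 0] H[OF that] by auto
    qed (use cont in \<open>auto intro: integrable_continuous_real\<close>)
    then show ?thesis by simp
  qed
  moreover have "\<Psi> M \<ge> 0"
    unfolding \<Psi>_def
  proof (rule integral_nonneg)
    show "spow (1 / (p - 1)) (M - H t) \<ge> 0" if "t \<in> {0..1}" for t
      using spow_mono[OF r, of 0 "M - H t"] H[OF that] by auto
  qed (use cont in \<open>auto intro: integrable_continuous_real\<close>)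
  ultimately obtain c where c: "- M \<le> c" "c \<le> M" "\<Psi> c = 0"
    using IVT[of \<Psi> "- M" 0 M] M by auto
  show ?thesis
  proof (rule that[of "\<lambda>t. c - H t"])
    show "((\<lambda>t. c - H t) has_real_derivative - h t) (at t within {0..1})" if "t \<in> {0..1}" for t
      unfolding H_def using has_real_derivative_integral_01[OF assms(2) that]
      by (auto intro!: derivative_eq_intros)
    show "\<bar>c - H t\<bar> \<le> 2 * M" if "t \<in> {0..1}" for t
      using H[OF that] c by auto
  qed (use c in \<open>simp add: \<Psi>_def\<close>)
qed

text \<open>The radius \<open>2 * M\<close> and the distance \<open>M * d\<close> are those of the
  fluxes of linear problems, which are bounded by \<open>2 * M\<close> and
  \<open>M\<close>-Lipschitz.\<close>

lemma uniform_modulus_spow: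
  assumes "r > 0" "M > 0" "e > 0"
  shows "\<exists>d>0. \<forall>x y. \<bar>x\<bar> \<le> 2 * M \<longrightarrow> \<bar>y\<bar> \<le> 2 * M \<longrightarrow> \<bar>x - y\<bar> < M * d \<longrightarrow> \<bar>spow r x - spow r y\<bar> < e"
proof -
  have "uniformly_continuous_on {-(2*M)..2*M} (spow r)"
    by (intro compact_uniformly_continuous continuous_on_spow[OF assms(1)] continuous_on_id) auto
  then obtain d where d: "d > 0"
    "\<And>x y. \<bar>x\<bar> \<le> 2*M \<Longrightarrow> \<bar>y\<bar> \<le> 2*M \<Longrightarrow> \<bar>x - y\<bar> < d \<Longrightarrow> \<bar>spow r x - spow r y\<bar> < e"
    unfolding uniformly_continuous_on_def dist_real_def using assms(3)
    by (metis abs_le_iff abs_minus_commute atLeastAtMost_iff minus_le_iff)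
  show ?thesis
    by (rule exI[of _ "d / M"]) (use d assms in auto)
qed

text \<open>The minimiser \<open>g\<close> is compared with the slope of the solution \<open>z\<close> of the linear problem
  \<open>- (|z'|\<^sup>p\<^sup>-\<^sup>2 z')' = q k(v)\<close>, where \<open>v\<close> is the primitive of \<open>g\<close>; the modulus of continuity is
  chosen such that this slope is admissible. Monotonicity of \<open>spow\<close> then forces \<open>v = z\<close>.\<close>

lemma minimiser_solves_ode:
  assumes "p > 1" "continuous_on {0..1} q"
    and K: "\<And>x. (K has_real_derivative k x) (at x)" "continuous_on UNIV k" "\<And>x. \<bar>k x\<bar> \<le> B"
    and g0: "continuous_on {0..1} g0" "integral {0..1} g0 = 0"
  obtains v P where "v 0 = 0" "v 1 = 0"
    "\<And>t. t \<in> {0..1} \<Longrightarrow> (v has_real_derivative spow (1 / (p - 1)) (P t)) (at t within {0..1})"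
    "\<And>t. t \<in> {0..1} \<Longrightarrow> (P has_real_derivative - (q t * k (v t))) (at t within {0..1})"
    "integral {0..1} (\<lambda>t. \<bar>spow (1 / (p - 1)) (P t)\<bar> powr p / p - q t * K (v t)) \<le> energy p q K g0"
proof -
  define r where "r = 1 / (p - 1)"
  have r: "r > 0" "(p - 1) * r = 1" "p - 1 > 0"
    using assms(1) by (auto simp: r_def)
  obtain Q where Q: "Q > 0" "\<And>t. t \<in> {0..1} \<Longrightarrow> \<bar>q t\<bar> \<le> Q"
    using bounded_image_01[OF assms(2)] by blast
  have contK: "continuous_on UNIV K"
    using K(1) by (meson DERIV_continuous continuous_at_imp_continuous_on)
  have B: "0 \<le> B"
    using K(3)[of 0] by simp
  \<comment> \<open>A bound for every right-hand side \<open>q t * k x\<close>, whatever the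
    function plugged into \<open>k\<close>; the summand 1 makes it positive.\<close>
  define M where "M = Q * B + 1"
  have M: "M > 0"
    using Q(1) B by (simp add: M_def add_nonneg_pos)
  have qk: "\<bar>q t * k x\<bar> \<le> M" if "t \<in> {0..1}" for t x
  proof -
    have "\<bar>q t * k x\<bar> \<le> Q * B"
      unfolding abs_mult using Q(1) Q(2)[OF that] K(3)[of x] by (intro mult_mono) auto
    then show ?thesis by (simp add: M_def)
  qed
  obtain G where G: "G > 0" "\<And>t. t \<in> {0..1} \<Longrightarrow> \<bar>g0 t\<bar> \<le> G"
    using bounded_image_01[OF g0(1)] by blast
  \<comment> \<open>Large enough for the competitor \<open>g0\<close> and for every slope obtained
    from a flux bounded by \<open>2 * M\<close>.\<close>
  define R where "R = max G ((2 * M) powr r)"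
  \<comment> \<open>\<open>\<Phi> e d\<close> says that \<open>d\<close> is admissible as modulus at
    \<open>e\<close>, for \<open>g0\<close> and for all signed powers of fluxes with the bounds
    above. It must be fixed before the minimiser exists, so it refers to the flux bounds and not to
    a particular linear problem.\<close>
  define \<Phi> where "\<Phi> e d \<longleftrightarrow> d > 0 \<and>
    (\<forall>x y. \<bar>x\<bar> \<le> 2 * M \<longrightarrow> \<bar>y\<bar> \<le> 2 * M \<longrightarrow> \<bar>x - y\<bar> < M * d \<longrightarrow> \<bar>spow r x - spow r y\<bar> < e) \<and>
    (\<forall>s\<in>{0..1}. \<forall>t\<in>{0..1}. \<bar>s - t\<bar> < d \<longrightarrow> \<bar>g0 s - g0 t\<bar> < e)" for e d
  have "\<exists>d. \<Phi> e d" if e: "e > 0" for e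
  proof -
    obtain d1 where d1: "d1 > 0" "\<And>x y. \<bar>x\<bar> \<le> 2 * M \<Longrightarrow> \<bar>y\<bar> \<le> 2 * M \<Longrightarrow> \<bar>x - y\<bar> < M * d1 \<Longrightarrow> \<bar>spow r x - spow r y\<bar> < e"
      using uniform_modulus_spow[OF r(1) M e] by blast
    have "uniformly_continuous_on {0..1} g0"
      by (intro compact_uniformly_continuous g0) auto
    then obtain d2 where d2: "d2 > 0" "\<And>s t. s \<in> {0..1} \<Longrightarrow> t \<in> {0..1} \<Longrightarrow> \<bar>s - t\<bar> < d2 \<Longrightarrow> \<bar>g0 s - g0 t\<bar> < e"
      unfolding uniformly_continuous_on_def dist_real_def using e
      by (metis abs_minus_commute)
    have "M * min d1 d2 \<le> M * d1"
      using M by (intro mult_left_mono) auto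
    then show ?thesis
      unfolding \<Phi>_def using d1 d2 by (intro exI[of _ "min d1 d2"]) (auto intro: less_le_trans)
  qed
  then have "\<exists>\<delta>. \<forall>e. e > 0 \<longrightarrow> \<Phi> e (\<delta> e)"
    by metis
  then obtain \<delta> where \<Phi>: "\<Phi> e (\<delta> e)" if "e > 0" for e
    by blast
  have \<delta>: "\<And>e. e > 0 \<Longrightarrow> \<delta> e > 0"
    "\<And>e x y. e > 0 \<Longrightarrow> \<bar>x\<bar> \<le> 2 * M \<Longrightarrow> \<bar>y\<bar> \<le> 2 * M \<Longrightarrow> \<bar>x - y\<bar> < M * \<delta> e \<Longrightarrow> \<bar>spow r x - spow r y\<bar> < e"
    "\<And>e s t. e > 0 \<Longrightarrow> s \<in> {0..1} \<Longrightarrow> t \<in> {0..1} \<Longrightarrow> \<bar>s - t\<bar> < \<delta> e \<Longrightarrow> \<bar>g0 s - g0 t\<bar> < e"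
    using \<Phi> by (simp_all add: \<Phi>_def)
  have "g0 \<in> slopes R \<delta>"
    unfolding slopes_def using g0 G \<delta>(3) by (fastforce simp: R_def max_def less_imp_le)
  then have "\<exists>g\<in>slopes R \<delta>. \<forall>h\<in>slopes R \<delta>. energy p q K g \<le> energy p q K h"
    using assms(1) by (intro energy_attains_min assms(2) contK \<delta>(1)) auto
  then obtain g where g: "g \<in> slopes R \<delta>" "\<And>h. h \<in> slopes R \<delta> \<Longrightarrow> energy p q K g \<le> energy p q K h"
    by blast
  have g': "continuous_on {0..1} g" "\<And>t. t \<in> {0..1} \<Longrightarrow> \<bar>g t\<bar> \<le> R" "integral {0..1} g = 0"
    using g(1) by (auto simp: slopes_def)
  define v where "v t = integral {0..t} g" for t
  have v: "(v has_real_derivative g t) (at t within {0..1})" if "t \<in> {0..1}" for t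
    unfolding v_def using has_real_derivative_integral_01[OF g'(1) that] .
  have contv: "continuous_on {0..1} v"
    unfolding v_def by (rule continuous_on_integral_01[OF g'(1)])
  obtain P where P: "\<And>t. t \<in> {0..1} \<Longrightarrow> (P has_real_derivative - (q t * k (v t))) (at t within {0..1})"
    "integral {0..1} (\<lambda>t. spow (1 / (p - 1)) (P t)) = 0"
    "\<And>t. t \<in> {0..1} \<Longrightarrow> \<bar>P t\<bar> \<le> 2 * M"
    by (rule linear_problem[OF assms(1), of "\<lambda>t. q t * k (v t)" M])
      (use qk in \<open>auto intro!: continuous_intros assms continuous_on_compose2[OF K(2)] contv\<close>)
  have contP: "continuous_on {0..1} P"
    unfolding continuous_on_eq_continuous_within using P(1) by (blast intro: DERIV_continuous)
  define h where "h t = spow r (P t)" for t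
  have conth: "continuous_on {0..1} h"
    unfolding h_def by (intro continuous_intros contP r)
  have Ph: "spow (p - 1) (h t) = P t" for t
    by (simp add: h_def spow_spow r)
  have hR: "\<bar>h t\<bar> \<le> R" if "t \<in> {0..1}" for t
    using P(3)[OF that] r by (auto simp: h_def abs_spow R_def max_def intro: order_trans[OF powr_mono2])
  have "h \<in> slopes R \<delta>"
    unfolding slopes_def
  proof (intro CollectI conjI ballI allI impI)
    show "integral {0..1} h = 0"
      using P(2) by (simp add: h_def[abs_def] r_def)
    fix e s t :: real assume est: "e > 0" "s \<in> {0..1}" "t \<in> {0..1}" "\<bar>s - t\<bar> < \<delta> e"
    have "\<bar>P s - P t\<bar> \<le> M * \<bar>s - t\<bar>"
      using field_differentiable_bound[of "{0..1}" P "\<lambda>t. - (q t * k (v t))" M s t] P(1) qk est by auto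
    also have "\<dots> < M * \<delta> e"
      using est M by simp
    finally show "\<bar>h s - h t\<bar> \<le> e"
      unfolding h_def using \<delta>(2)[of e "P s" "P t"] P(3) est by force
  qed (use conth hR in auto)
  then have var: "energy p q K g \<le> energy p q K (\<lambda>t. g t + e * (h t - g t))" if "0 < e" "e \<le> 1" for e
    using that by (intro g convex_slopes) auto
  define d where "d t = h t - g t" for t
  define D where "D t = integral {0..t} d" for t
  have contd: "continuous_on {0..1} d"
    unfolding d_def by (intro continuous_intros conth g')
  have D: "(D has_real_derivative d t) (at t within {0..1})" if "t \<in> {0..1}" for t
    unfolding D_def using has_real_derivative_integral_01[OF contd that] .
  have contD: "continuous_on {0..1} D"
    unfolding D_def by (rule continuous_on_integral_01[OF contd])
  have "integral {0..1} d = 0"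
    using g'(3) P(2) conth g'(1) unfolding d_def[abs_def]
    by (subst Henstock_Kurzweil_Integration.integral_diff)
      (auto intro: integrable_continuous_real simp: h_def[abs_def] r_def)
  then have D01: "D 0 = 0" "D 1 = 0"
    by (auto simp: D_def)
  \<comment> \<open>The weak form of the linear problem, tested with the difference
    \<open>D\<close>: the boundary terms drop out because \<open>D\<close> vanishes at both
    ends.\<close>
  have "((\<lambda>t. P t * D t) has_real_derivative P t * d t + - (q t * k (v t)) * D t) (at t within {0..1})"
    if "t \<in> {0..1}" for t
    using P(1)[OF that] D[OF that] by (auto intro!: derivative_eq_intros)
  then have "((\<lambda>t. P t * d t + - (q t * k (v t)) * D t) has_integral P 1 * D 1 - P 0 * D 0) {0..1}"
    by (intro fundamental_theorem_of_calculus) (auto simp: has_real_derivative_iff_has_vector_derivative)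
  then have parts: "integral {0..1} (\<lambda>t. P t * d t - q t * (k (v t) * D t)) = 0"
    by (simp add: D01 integral_unique mult_ac)
  have nonneg: "0 \<le> integral {0..1} (\<lambda>t. spow (p - 1) (g t) * d t - q t * (k (v t) * D t))"
    using energy_directional_derivative_nonneg[OF assms(1,2) K g'(1) conth g'(2) hR var]
    by (simp add: d_def[abs_def] D_def v_def)
  have contqkD: "continuous_on {0..1} (\<lambda>t. q t * (k (v t) * D t))"
    by (intro continuous_intros assms contD continuous_on_compose2[OF K(2) contv]) auto
  have contPd: "continuous_on {0..1} (\<lambda>t. P t * d t)"
    by (intro continuous_intros contP contd)
  have contgd: "continuous_on {0..1} (\<lambda>t. spow (p - 1) (g t) * d t)"
    by (intro continuous_intros contd g' r)
  define w where "w t = (spow (p - 1) (h t) - spow (p - 1) (g t)) * (h t - g t)" for t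
  have contw: "continuous_on {0..1} w"
    unfolding w_def by (intro continuous_intros conth g' r)
  have wnn: "w t \<ge> 0" for t
    unfolding w_def using spow_mono[OF r(3), of "g t" "h t"] spow_mono[OF r(3), of "h t" "g t"]
    by (cases "g t \<le> h t") (auto simp: mult_nonpos_nonpos)
  \<comment> \<open>Both identities contain the same zero-order term, since the right-hand side of
    the linear problem is frozen at \<open>v\<close>. Subtracting leaves the monotonicity integrand,
    which is non-negative with integral at most 0.\<close>
  have "integral {0..1} w = integral {0..1} (\<lambda>t. (P t * d t - q t * (k (v t) * D t))
      - (spow (p - 1) (g t) * d t - q t * (k (v t) * D t)))"
    by (rule integral_cong) (simp add: w_def Ph d_def algebra_simps)
  also have "\<dots> = integral {0..1} (\<lambda>t. P t * d t - q t * (k (v t) * D t))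
      - integral {0..1} (\<lambda>t. spow (p - 1) (g t) * d t - q t * (k (v t) * D t))"
    by (intro Henstock_Kurzweil_Integration.integral_diff integrable_continuous_real
        continuous_on_diff contPd contgd contqkD)
  also have "\<dots> \<le> 0"
    using parts nonneg by simp
  finally have "integral {0..1} w = 0"
    using integral_nonneg[OF integrable_continuous_real[OF contw] wnn] by linarith
  then have w0: "w t = 0" if "t \<in> {0..1}" for t
    using integral_eq_0_iff[OF contw zero_less_one wnn] that by blast
  have gh: "g t = h t" if "t \<in> {0..1}" for t
  proof (rule ccontr)
    assume "g t \<noteq> h t"
    then have "spow (p - 1) (g t) \<noteq> spow (p - 1) (h t)"
      using spow_strict_mono[OF r(3), of "g t" "h t"] spow_strict_mono[OF r(3), of "h t" "g t"]
      by (cases "g t < h t") auto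
    with w0[OF that] \<open>g t \<noteq> h t\<close> show False
      by (simp add: w_def)
  qed
  show ?thesis
  proof (rule that[of v P])
    show "v 0 = 0" "v 1 = 0"
      using g'(3) by (auto simp: v_def)
    show "(v has_real_derivative spow (1 / (p - 1)) (P t)) (at t within {0..1})" if "t \<in> {0..1}" for t
      using v[OF that] gh[OF that] by (simp add: h_def r_def)
    have "integral {0..1} (\<lambda>t. \<bar>spow (1 / (p - 1)) (P t)\<bar> powr p / p - q t * K (v t)) = energy p q K g"
      unfolding energy_def by (rule integral_cong) (simp add: gh h_def r_def v_def)
    then show "integral {0..1} (\<lambda>t. \<bar>spow (1 / (p - 1)) (P t)\<bar> powr p / p - q t * K (v t)) \<le> energy p q K g0"
      using g(2)[OF \<open>g0 \<in> slopes R \<delta>\<close>] by simp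
  qed (use P(1) in auto)
qed

section \<open>Solutions of the boundary value problem\<close>

text \<open>A maximum above \<open>c\<close> is interior, so the flux vanishes there. Up to the next
  return to the level \<open>c\<close> the sign of \<open>h\<close> makes the flux non-decreasing,
  hence non-negative, so \<open>v\<close> cannot come down from its maximum to
  \<open>c\<close>.\<close>

lemma no_upper_excursion:
  assumes "r > 0" "v 0 \<le> c" "v 1 \<le> c"
    and v: "\<And>t. t \<in> {0..1} \<Longrightarrow> (v has_real_derivative spow r (P t)) (at t within {0..1})"
    and P: "\<And>t. t \<in> {0..1} \<Longrightarrow> (P has_real_derivative - h t) (at t within {0..1})"
    and h: "\<And>t. t \<in> {0..1} \<Longrightarrow> v t > c \<Longrightarrow> h t \<le> 0"
    and "t \<in> {0..1}"
  shows "v t \<le> c"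
proof (rule ccontr)
  assume "\<not> v t \<le> c"
  have cont: "continuous_on {0..1} v" "continuous_on {0..1} P"
    unfolding continuous_on_eq_continuous_within using v P by (blast intro: DERIV_continuous)+
  have at: "at t within {0..1} = at t" if "0 < t" "t < 1" for t :: real
    using that by (rule at_within_Icc_at)
  obtain t0 where t0: "t0 \<in> {0..1}" "\<And>s. s \<in> {0..1} \<Longrightarrow> v s \<le> v t0"
    using continuous_attains_sup[of "{0..1}" v] cont by auto
  have "v t0 > c"
    using t0(2)[OF assms(7)] \<open>\<not> v t \<le> c\<close> by simp
  then have t0': "0 < t0" "t0 < 1"
    using t0(1) assms(2,3) by (cases "t0 = 0"; cases "t0 = 1"; force)+
  have "spow r (P t0) = 0"
  proof (rule DERIV_local_max[where d = "min t0 (1 - t0)"])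
    show "DERIV v t0 :> spow r (P t0)"
      using v[OF t0(1)] at[OF t0'] by simp
    show "0 < min t0 (1 - t0)" using t0' by simp
    show "\<forall>y. \<bar>t0 - y\<bar> < min t0 (1 - t0) \<longrightarrow> v y \<le> v t0"
      using t0 by (auto intro!: t0(2))
  qed
  then have Pt0: "P t0 = 0"
    using abs_spow[of r "P t0"] by simp
  define S where "S = {t0..1} \<inter> v -` {..c}"
  have "closed S"
    unfolding S_def using t0' continuous_on_subset[OF cont(1), of "{t0..1}"]
    by (intro continuous_closed_preimage) auto
  moreover have "1 \<in> S"
    using assms(3) t0' by (simp add: S_def)
  moreover have bdd: "bdd_below S"
    by (auto simp: S_def intro: bdd_belowI[of _ t0])
  ultimately have "Inf S \<in> S"
    by (intro closed_contains_Inf) auto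
  define t1 where "t1 = Inf S"
  have t1: "t1 \<in> {t0..1}" "v t1 \<le> c"
    using \<open>Inf S \<in> S\<close> by (auto simp: S_def t1_def)
  have above: "v s > c" if "t0 \<le> s" "s < t1" for s
    using cInf_lower[OF _ bdd, of s] that t1(1) by (force simp: S_def t1_def not_less)
  have sub: "{t0..s} \<subseteq> {0..1}" if "s \<le> t1" for s
    using t0' t1 that by auto
  have Pnn: "P s \<ge> 0" if "t0 \<le> s" "s \<le> t1" for s
  proof -
    have "P t0 \<le> P s"
    proof (rule DERIV_nonneg_imp_increasing_open[OF that(1)])
      show "\<exists>y. DERIV P x :> y \<and> 0 \<le> y" if x: "t0 < x" "x < s" for x
        using P[of x] at[of x] h[of x] above[of x] x t0' t1 \<open>s \<le> t1\<close> by (intro exI[of _ "- h x"]) auto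
      show "continuous_on {t0..s} P"
        using continuous_on_subset[OF cont(2) sub[OF that(2)]] .
    qed
    then show ?thesis by (simp add: Pt0)
  qed
  have "v t0 \<le> v t1"
  proof (rule DERIV_nonneg_imp_increasing_open[where f = v])
    show "\<exists>y. DERIV v x :> y \<and> 0 \<le> y" if x: "t0 < x" "x < t1" for x
      using v[of x] at[of x] spow_mono[OF assms(1) Pnn[of x]] x t0' t1
      by (intro exI[of _ "spow r (P x)"]) auto
    show "continuous_on {t0..t1} v"
      using continuous_on_subset[OF cont(1) sub] by simp
  qed (use t1 in auto)
  with t1 \<open>v t0 > c\<close> show False by simp
qed

text \<open>A smoothed trapezoid of height \<open>\<xi>\<close>, whose slope is at most \<open>m / l\<close> times that of the
  trapezoid; \<open>m\<close> tends to 1 in the application.\<close>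

lemma competitor:
  assumes "p > 1" "continuous_on {0..1} q" "\<And>t. t \<in> {0..1} \<Longrightarrow> q0 \<le> q t" "q0 > 0"
    and K: "continuous_on UNIV K" "\<And>x. 0 \<le> x \<Longrightarrow> x \<le> \<xi> \<Longrightarrow> 0 \<le> K x"
    and "0 < l" "l < 1 / 2" "m > 1" "\<xi> > 0"
  obtains g where "continuous_on {0..1} g" "integral {0..1} g = 0"
    "energy p q K g \<le> 2 * l * (\<xi> powr p * (m / l) powr p / p) - (1 - 2 * l) * (q0 * K \<xi>)"
proof -
  define A where "A t = max 0 (1 - t / l)" for t
  define Z where "Z t = max 0 (1 - (1 - t) / l)" for t
  \<comment> \<open>For \<open>m = 1\<close> this is the trapezoid with ramps of length
    \<open>l\<close>. An exponent above 1 makes the slope tend to 0 at the corners \<open>l\<close>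
    and \<open>1 - l\<close>, so that it is continuous.\<close>
  define W where "W t = \<xi> * (1 - A t powr m - Z t powr m)" for t
  define g where "g t = \<xi> * (m / l) * (A t powr (m - 1) - Z t powr (m - 1))" for t
  have W': "(W has_real_derivative g t) (at t)" for t
  proof -
    have "((\<lambda>t. 1 - t / l) has_real_derivative - (1 / l)) (at t)"
      "((\<lambda>t. 1 - (1 - t) / l) has_real_derivative 1 / l) (at t)"
      using assms(7) by (auto intro!: derivative_eq_intros)
    from this[THEN DERIV_chain2[OF has_real_derivative_max_powr[OF assms(9)]]]
    have "((\<lambda>t. \<xi> * (1 - A t powr m - Z t powr m)) has_real_derivative
        \<xi> * (0 - m * A t powr (m - 1) * - (1 / l) - m * Z t powr (m - 1) * (1 / l))) (at t)"
      unfolding A_def Z_def by (intro DERIV_cmult DERIV_diff DERIV_const)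
    moreover have "\<xi> * (0 - m * A t powr (m - 1) * - (1 / l) - m * Z t powr (m - 1) * (1 / l)) = g t"
      by (simp add: g_def right_diff_distrib)
    ultimately show ?thesis
      unfolding W_def by (rule DERIV_cong)
  qed
  have contg: "continuous_on S g" for S
    unfolding g_def A_def Z_def using assms
    by (intro continuous_on_mult continuous_on_const continuous_on_diff continuous_on_powr')
      (auto intro!: continuous_intros)
  have A: "0 \<le> A t" "t \<ge> 0 \<Longrightarrow> A t \<le> 1" "t \<ge> l \<Longrightarrow> A t = 0" for t
    using assms(7) by (auto simp: A_def max_def field_simps)
  have Z: "0 \<le> Z t" "t \<le> 1 \<Longrightarrow> Z t \<le> 1" "t \<le> 1 - l \<Longrightarrow> Z t = 0" for t
    using assms(7) by (auto simp: Z_def max_def field_simps)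
  have W0: "W 0 = 0" "W 1 = 0"
    using assms(7,8,9) Z(3)[of 0] A(3)[of 1] by (auto simp: W_def) (auto simp: A_def Z_def)
  have intg: "integral {0..t} g = W t" if "t \<ge> 0" for t
  proof -
    have "(g has_integral (W t - W 0)) {0..t}"
      using that W' by (intro fundamental_theorem_of_calculus)
        (auto simp: has_real_derivative_iff_has_vector_derivative[symmetric] intro: has_field_derivative_at_within)
    then show ?thesis
      using W0 by (simp add: integral_unique)
  qed
  have or: "A t = 0 \<or> Z t = 0" for t
    using A(3)[of t] Z(3)[of t] assms(8) by linarith
  have p1: "0 \<le> x powr s" "x \<le> 1 \<Longrightarrow> x powr s \<le> 1" if "0 \<le> x" "s > 0" for x s :: real
    using that powr_mono2[of s x 1] by auto
  have W: "0 \<le> W t" "W t \<le> \<xi>" if "t \<in> {0..1}" for t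
    using or[of t] p1[OF A(1), of m t] p1[OF Z(1), of m t] A(2)[of t] Z(2)[of t] that assms(9,10)
    by (auto simp: W_def intro!: mult_left_le)
  have g: "\<bar>g t\<bar> \<le> \<xi> * (m / l)" if "t \<in> {0..1}" for t
  proof -
    have "\<bar>A t powr (m - 1) - Z t powr (m - 1)\<bar> \<le> 1"
      using or[of t] p1[OF A(1), of "m - 1" t] p1[OF Z(1), of "m - 1" t] A(2)[of t] Z(2)[of t] that assms(9)
      by auto
    then show ?thesis
      unfolding g_def abs_mult using assms(7,9,10) by (simp add: mult_left_le divide_right_mono)
  qed
  define E where "E t = \<bar>g t\<bar> powr p / p - q t * K (integral {0..t} g)" for t
  have contE: "continuous_on {0..1} E"
    unfolding E_def by (rule continuous_on_energy_integrand) (use assms K contg in auto)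
  have intE: "E integrable_on {a..b}" if "0 \<le> a" "b \<le> 1" for a b
    using that by (intro integrable_continuous_real continuous_on_subset[OF contE]) auto
  define C where "C = \<xi> powr p * (m / l) powr p / p"
  \<comment> \<open>On the ramps the potential term is dropped by its sign; this is where the
    non-negativity of the primitive enters.\<close>
  have E1: "E t \<le> C" if t: "t \<in> {0..1}" for t
  proof -
    have "\<bar>g t\<bar> powr p \<le> (\<xi> * (m / l)) powr p"
      using g[OF t] assms(1) by (intro powr_mono2) auto
    also have "\<dots> = \<xi> powr p * (m / l) powr p"
      using assms by (subst powr_mult) auto
    finally have "\<bar>g t\<bar> powr p / p \<le> C"
      using assms(1) by (simp add: C_def divide_right_mono)
    moreover have "0 \<le> q t * K (integral {0..t} g)"
      using t assms(3)[OF t] assms(4) W[OF t] K(2)[of "W t"] intg[of t] by auto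
    ultimately show ?thesis by (simp add: E_def)
  qed
  have E2: "E t \<le> - (q0 * K \<xi>)" if t: "t \<in> {l..1-l}" for t
  proof -
    have t': "t \<in> {0..1}" "integral {0..t} g = \<xi>" "g t = 0"
      using t assms intg[of t] A(3)[of t] Z(3)[of t] by (auto simp: W_def g_def)
    have "q0 * K \<xi> \<le> q t * K \<xi>"
      using assms(3)[OF t'(1)] K(2)[of \<xi>] assms(10) by (intro mult_right_mono) auto
    then show ?thesis
      using t' assms(1) by (simp add: E_def)
  qed
  have bnd: "integral {a..b} E \<le> c * (b - a)" if "0 \<le> a" "a \<le> b" "b \<le> 1" "\<And>t. t \<in> {a..b} \<Longrightarrow> E t \<le> c" for a b c
  proof -
    have "integral {a..b} E \<le> integral {a..b} (\<lambda>t. c)"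
      by (rule integral_le) (use that intE in auto)
    then show ?thesis using that by (simp add: mult.commute)
  qed
  have "energy p q K g = integral {0..1} E"
    by (simp add: energy_def E_def[abs_def])
  also have "\<dots> = integral {0..l} E + integral {l..1-l} E + integral {1-l..1} E"
    using assms(7,8) Henstock_Kurzweil_Integration.integral_combine[of 0 l 1 E]
      Henstock_Kurzweil_Integration.integral_combine[of l "1 - l" 1 E] intE[of 0 1] intE[of l 1] by auto
  also have "\<dots> \<le> C * (l - 0) + (- (q0 * K \<xi>)) * ((1 - l) - l) + C * (1 - (1 - l))"
    using assms(7,8) by (intro add_mono bnd E1 E2) auto
  also have "\<dots> = 2 * l * C - (1 - 2 * l) * (q0 * K \<xi>)"
    by (simp add: algebra_simps)
  finally show ?thesis
    using that[OF contg] intg[of 1] W0 by (auto simp: C_def)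
qed

text \<open>The second-order equation as a first-order system for \<open>v\<close> and its flux
  \<open>P\<close>. The right-hand sides are continuous when \<open>f\<close> and \<open>q\<close>
  are, so both components are C^1 up to the boundary.\<close>

definition bvp_solution ::
    "real \<Rightarrow> (real \<Rightarrow> real) \<Rightarrow> (real \<Rightarrow> real) \<Rightarrow> (real \<Rightarrow> real) \<Rightarrow> (real \<Rightarrow> real) \<Rightarrow> bool" where
  "bvp_solution p q f v P \<longleftrightarrow> v 0 = 0 \<and> v 1 = 0 \<and> (\<forall>t\<in>{0..1}. 0 \<le> v t \<and>
     (v has_real_derivative spow (1 / (p - 1)) (P t)) (at t within {0..1}) \<and>
     (P has_real_derivative - (q t * f (v t))) (at t within {0..1}))"

section \<open>Primitives of the nonlinearity\<close>

lemma has_real_derivative_primitive: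
  assumes "continuous_on UNIV f"
  shows "(primitive f has_real_derivative f x) (at x)"
proof -
  define a b where "a = min 0 x - 1" and "b = max 0 x + 1"
  have ab: "a \<le> 0" "0 \<le> b" "a < x" "x < b"
    by (auto simp: a_def b_def)
  have "((\<lambda>u. LBINT y=ereal 0..ereal u. f y) has_vector_derivative f x) (at x within {a..b})"
    using ab by (intro interval_integral_FTC2 continuous_on_subset[OF assms]) auto
  then show ?thesis
    using at_within_Icc_at[OF ab(3,4)]
    by (simp add: primitive_def[abs_def] has_real_derivative_iff_has_vector_derivative)
qed

lemma primitive_zero [simp]: "primitive f 0 = 0"
  by (simp add: primitive_def)

lemma primitive_cong:
  assumes "continuous_on UNIV f" "continuous_on UNIV k" "\<And>x. x \<in> {0..b} \<Longrightarrow> f x = k x" "x \<in> {0..b}"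
  shows "primitive f x = primitive k x"
proof -
  have "((\<lambda>x. primitive f x - primitive k x) has_real_derivative 0) (at y within {0..b})"
    if "y \<in> {0..b}" for y
    using DERIV_diff[OF has_real_derivative_primitive[OF assms(1), of y]
        has_real_derivative_primitive[OF assms(2), of y]] assms(3)[OF that]
    by (simp add: has_field_derivative_at_within)
  then obtain c where c: "\<And>y. y \<in> {0..b} \<Longrightarrow> primitive f y - primitive k y = c"
    using has_field_derivative_zero_constant[of "{0..b}" "\<lambda>x. primitive f x - primitive k x"] by blast
  show ?thesis
    using c[of 0] c[of x] assms(4) by simp
qed

lemma truncated_bounds:
  assumes "p > 1" "f 0 = 0" "b > 0" "f b \<le> 0" "\<And>t. t \<in> {0..1} \<Longrightarrow> 0 \<le> q t" "v 0 = 0" "v 1 = 0"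
    and v: "\<And>t. t \<in> {0..1} \<Longrightarrow> (v has_real_derivative spow (1 / (p - 1)) (P t)) (at t within {0..1})"
    and P: "\<And>t. t \<in> {0..1} \<Longrightarrow>
      (P has_real_derivative - (q t * f (max 0 (min b (v t))))) (at t within {0..1})"
    and t: "t \<in> {0..1}"
  shows "0 \<le> v t" "v t \<le> b"
proof -
  have r: "1 / (p - 1) > 0"
    using assms(1) by simp
  show "v t \<le> b"
    by (rule no_upper_excursion[OF r _ _ v P _ t])
      (use assms in \<open>auto simp: mult_nonneg_nonpos\<close>)
  have "- v t \<le> 0"
  proof (rule no_upper_excursion[OF r _ _ _ _ _ t])
    show "((\<lambda>t. - v t) has_real_derivative spow (1 / (p - 1)) (- P t)) (at t within {0..1})"
      if "t \<in> {0..1}" for t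
      using DERIV_minus[OF v[OF that]] by (simp add: spow_minus)
    show "((\<lambda>t. - P t) has_real_derivative - (- (q t * f (max 0 (min b (v t)))))) (at t within {0..1})"
      if "t \<in> {0..1}" for t
      using DERIV_minus[OF P[OF that]] by simp
  qed (use assms in \<open>auto simp: min_def max_def\<close>)
  then show "0 \<le> v t" by simp
qed

text \<open>If the minimiser stayed below \<open>R\<close>, its energy would be at least
  \<open>- (Q * C)\<close>, where \<open>C\<close> bounds the primitive on [0, R]. The competitor of
  height \<open>\<xi>\<close> has energy at most \<open>- (\<eta> * \<xi> powr p)\<close>, which is
  smaller once \<open>\<xi>\<close> is large.\<close>

lemma large_solutions:
  fixes f q :: "real \<Rightarrow> real"
  assumes "p > 1" and f: "continuous_on UNIV f" "f 0 = 0" "\<And>\<xi>. \<xi> \<ge> 0 \<Longrightarrow> primitive f \<xi> \<ge> 0"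
    "\<And>y. \<exists>b\<ge>y. f b \<le> 0"
    and q: "continuous_on {0..1} q" "\<And>t. t \<in> {0..1} \<Longrightarrow> q0 \<le> q t" "q0 > 0"
    and l: "0 < l" "l < 1 / 2"
    and c: "\<And>y. \<exists>\<xi>\<ge>y. primitive f \<xi> > c * \<xi> powr p"
      "2 * l * ((1 / l) powr p / p) < (1 - 2 * l) * (q0 * c)"
  obtains v P t where "bvp_solution p q f v P" "t \<in> {0..1}" "v t > R"
proof -
  \<comment> \<open>The strict inequality for the sharp trapezoid survives a slight rounding of its
    corners, by continuity in \<open>m\<close> at 1.\<close>
  obtain m where m: "m > 1" "2 * l * ((m / l) powr p / p) < (1 - 2 * l) * (q0 * c)"
  proof -
    have "((\<lambda>m. 2 * l * ((m / l) powr p / p)) \<longlongrightarrow> 2 * l * ((1 / l) powr p / p)) (at_right 1)"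
      using l assms(1) by (intro tendsto_intros) auto
    then have "\<forall>\<^sub>F m in at_right 1. 2 * l * ((m / l) powr p / p) < (1 - 2 * l) * (q0 * c)"
      using c(2) by (rule order_tendstoD)
    then have "\<forall>\<^sub>F m in at_right 1. m > 1 \<and> 2 * l * ((m / l) powr p / p) < (1 - 2 * l) * (q0 * c)"
      using eventually_at_right_less by (rule eventually_conj[rotated])
    then have "\<exists>m. m > 1 \<and> 2 * l * ((m / l) powr p / p) < (1 - 2 * l) * (q0 * c)"
      by (intro eventually_happens'[of "at_right (1::real)"]) auto
    then show ?thesis using that by blast
  qed
  define \<eta> where "\<eta> = (1 - 2 * l) * (q0 * c) - 2 * l * ((m / l) powr p / p)"
  have \<eta>: "\<eta> > 0"
    using m by (simp add: \<eta>_def)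
  obtain Q where Q: "Q > 0" "\<And>t. t \<in> {0..1} \<Longrightarrow> \<bar>q t\<bar> \<le> Q"
    using bounded_image_01[OF q(1)] by blast
  note F' = has_real_derivative_primitive[OF f(1)]
  have contF: "continuous_on UNIV (primitive f)"
    using F' by (meson DERIV_continuous continuous_at_imp_continuous_on)
  have "bounded (primitive f ` {0..R})"
    by (intro compact_imp_bounded compact_continuous_image continuous_on_subset[OF contF]) auto
  then obtain C where C: "C > 0" "\<And>x. x \<in> {0..R} \<Longrightarrow> \<bar>primitive f x\<bar> \<le> C"
    by (auto simp: bounded_pos)
  \<comment> \<open>The lower bound 1 gives \<xi> <= \<xi>^p, and the other bound then makes
    \<open>\<eta> * \<xi> powr p\<close> exceed \<open>Q * C\<close>.\<close>
  obtain \<xi> where \<xi>: "\<xi> \<ge> max 1 (Q * C / \<eta> + 1)" "primitive f \<xi> > c * \<xi> powr p"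
    using c(1) by blast
  then have \<xi>1: "\<xi> \<ge> 1" "\<xi> > Q * C / \<eta>"
    by auto
  have "\<xi> powr 1 \<le> \<xi> powr p"
    using \<xi>1(1) assms(1) by (intro powr_mono) auto
  then have \<xi>2: "Q * C < \<eta> * \<xi> powr p"
    using \<xi>1 \<eta> by (simp add: field_simps) (smt (verit) mult_left_mono)
  \<comment> \<open>The truncation level lies above the height of the competitor, so that truncation
    leaves the competitor's potential unchanged.\<close>
  obtain b where b: "b \<ge> \<xi>" "f b \<le> 0"
    using f(4) by blast
  define k where "k x = f (max 0 (min b x))" for x
  have contk: "continuous_on UNIV k"
    unfolding k_def by (rule continuous_on_compose2[OF f(1)]) (auto intro!: continuous_intros)
  have "bounded (f ` {0..b})"
    by (intro compact_imp_bounded compact_continuous_image continuous_on_subset[OF f(1)]) auto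
  then obtain B where "\<forall>x\<in>{0..b}. \<bar>f x\<bar> \<le> B"
    unfolding bounded_iff by auto
  then have B: "\<bar>k x\<bar> \<le> B" for x
    using b \<xi>1 by (auto simp: k_def)
  note K' = has_real_derivative_primitive[OF contk]
  have contK: "continuous_on UNIV (primitive k)"
    using K' by (meson DERIV_continuous continuous_at_imp_continuous_on)
  have KF: "primitive k x = primitive f x" if "x \<in> {0..b}" for x
    by (rule primitive_cong[OF contk f(1) _ that]) (auto simp: k_def)
  obtain g where g: "continuous_on {0..1} g" "integral {0..1} g = 0"
    "energy p q (primitive k) g \<le> 2 * l * (\<xi> powr p * (m / l) powr p / p) - (1 - 2 * l) * (q0 * primitive k \<xi>)"
    by (rule competitor[OF assms(1) q contK _ l m(1), of \<xi>]) (use \<xi>1 b KF f(3) in auto)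
  obtain v P where vP: "v 0 = 0" "v 1 = 0"
    "\<And>t. t \<in> {0..1} \<Longrightarrow> (v has_real_derivative spow (1 / (p - 1)) (P t)) (at t within {0..1})"
    "\<And>t. t \<in> {0..1} \<Longrightarrow> (P has_real_derivative - (q t * k (v t))) (at t within {0..1})"
    "integral {0..1} (\<lambda>t. \<bar>spow (1 / (p - 1)) (P t)\<bar> powr p / p - q t * primitive k (v t))
       \<le> energy p q (primitive k) g"
    by (rule minimiser_solves_ode[OF assms(1) q(1) K' contk B g(1,2)], rule that)
  have qnn: "0 \<le> q t" if "t \<in> {0..1}" for t
    using q(2)[OF that] q(3) by simp
  have vb: "0 \<le> v t" "v t \<le> b" if "t \<in> {0..1}" for t
    using truncated_bounds[OF assms(1) f(2) _ b(2) qnn vP(1-3) vP(4)[unfolded k_def] that] b \<xi>1 by auto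
  have "bvp_solution p q f v P"
    unfolding bvp_solution_def using vP vb by (auto simp: k_def)
  moreover have "\<exists>t\<in>{0..1}. v t > R"
  proof (rule ccontr)
    assume "\<not> ?thesis"
    then have vR: "v t \<le> R" if "t \<in> {0..1}" for t
      using that by force
    have contv: "continuous_on {0..1} v" and contP: "continuous_on {0..1} P"
      unfolding continuous_on_eq_continuous_within using vP(3,4) by (blast intro: DERIV_continuous)+
    have "continuous_on {0..1} (\<lambda>t. \<bar>spow (1 / (p - 1)) (P t)\<bar> powr p)"
      by (rule continuous_on_powr') (use assms(1) contP in \<open>auto intro!: continuous_intros\<close>)
    then have cont: "continuous_on {0..1} (\<lambda>t. \<bar>spow (1 / (p - 1)) (P t)\<bar> powr p / p - q t * primitive k (v t))"
      using assms(1)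
      by (intro continuous_on_diff continuous_on_divide continuous_on_mult continuous_on_const q(1)
          continuous_on_compose2[OF contK contv]) auto
    have "integral {0..1} (\<lambda>t::real. - (Q * C)) \<le>
      integral {0..1} (\<lambda>t. \<bar>spow (1 / (p - 1)) (P t)\<bar> powr p / p - q t * primitive k (v t))"
    proof (rule integral_le)
      fix t :: real assume t: "t \<in> {0..1}"
      have "\<bar>q t * primitive k (v t)\<bar> \<le> Q * C"
        unfolding abs_mult using Q(1) Q(2)[OF t] C(2)[of "v t"] vb[OF t] vR[OF t] KF[of "v t"]
        by (intro mult_mono) auto
      moreover have "0 \<le> \<bar>spow (1 / (p - 1)) (P t)\<bar> powr p / p"
        using assms(1) by simp
      ultimately show "- (Q * C) \<le> \<bar>spow (1 / (p - 1)) (P t)\<bar> powr p / p - q t * primitive k (v t)"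
        by linarith
    qed (use cont in \<open>auto intro: integrable_continuous_real\<close>)
    then have "- (Q * C) \<le> 2 * l * (\<xi> powr p * (m / l) powr p / p) - (1 - 2 * l) * (q0 * primitive f \<xi>)"
      using vP(5) g(3) KF[of \<xi>] b \<xi>1 by simp
    moreover have "(1 - 2 * l) * (q0 * (c * \<xi> powr p)) \<le> (1 - 2 * l) * (q0 * primitive f \<xi>)"
      using \<xi>(2) q(3) l by (intro mult_left_mono) auto
    ultimately have "- (Q * C) \<le> - (\<eta> * \<xi> powr p)"
      by (simp add: \<eta>_def algebra_simps)
    with \<xi>2 show False by simp
  qed
  ultimately show ?thesis using that by blast
qed

section \<open>Smooth functions\<close>

lemma partial_eqI: "(f has_derivative D) (at x) \<Longrightarrow> partial i f x = D i"
  by (simp add: partial_def frechet_derivative_at[symmetric])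

lemma differentiable_has_derivative_partial:
  fixes f :: "'a::euclidean_space \<Rightarrow> real"
  assumes "f differentiable at x"
  shows "(f has_derivative (\<lambda>h. \<Sum>i\<in>Basis. (h \<bullet> i) * partial i f x)) (at x)"
proof -
  obtain D where D: "(f has_derivative D) (at x)"
    using assms by (auto simp: differentiable_def)
  then interpret D: bounded_linear D by (rule has_derivative_bounded_linear)
  have "D h = (\<Sum>i\<in>Basis. (h \<bullet> i) * partial i f x)" for h
    using D.sum[of "\<lambda>i. (h \<bullet> i) *\<^sub>R i" Basis]
    by (simp add: euclidean_representation D.scale partial_eqI[OF D])
  then have "D = (\<lambda>h. \<Sum>i\<in>Basis. (h \<bullet> i) * partial i f x)"
    by (rule ext)
  with D show ?thesis by simp
qed

text \<open>Differentiability is not assumed: \<open>frechet_derivative\<close> is a choice among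
  all derivatives at the point, and the two functions have the same ones.\<close>

lemma partial_cong_open:
  assumes "open S" "x \<in> S" "\<And>y. y \<in> S \<Longrightarrow> f y = g y"
  shows "partial i f x = partial i g x"
proof -
  have "(f has_derivative D) (at x) \<longleftrightarrow> (g has_derivative D) (at x)" for D
    using has_derivative_transform_within_open[of f D x UNIV S g]
      has_derivative_transform_within_open[of g D x UNIV S f] assms by auto
  then show ?thesis
    by (simp add: partial_def frechet_derivative_def)
qed

lemma Ck_SucD: "Ck (Suc k) f \<Longrightarrow> Ck k f"
proof (induction k arbitrary: f)
  case 0
  then show ?case
    by (auto intro!: differentiable_imp_continuous_on simp: differentiable_on_def differentiable_at_withinI)
next
  case (Suc k)
  then show ?case by (metis Ck.simps(2))
qed

lemma Ck_const [simp]: "Ck k (\<lambda>x. c)"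
proof (induction k arbitrary: c)
  case (Suc k)
  have "partial i (\<lambda>x::'a. c) = (\<lambda>x. 0)" for i
    by (rule ext, rule partial_eqI[where D = "\<lambda>h. 0", simplified]) simp
  with Suc show ?case by simp
qed simp

lemma Ck_inner [simp]: "Ck k (\<lambda>x. x \<bullet> a)"
proof (cases k)
  case (Suc n)
  have "partial i (\<lambda>x. x \<bullet> a) = (\<lambda>x. i \<bullet> a)" for i
    by (rule ext, rule partial_eqI) (auto intro!: derivative_eq_intros)
  then show ?thesis
    unfolding Suc using bounded_linear_imp_differentiable[OF bounded_linear_inner_left] by auto
qed (auto intro!: continuous_intros)

lemma partial_add:
  "f differentiable at x \<Longrightarrow> g differentiable at x \<Longrightarrow> partial i (\<lambda>x. f x + g x) x = partial i f x + partial i g x"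
  by (rule partial_eqI) (auto simp: partial_def intro!: derivative_eq_intros
      intro: frechet_derivative_works[THEN iffD1])

lemma partial_mult:
  "f differentiable at x \<Longrightarrow> g differentiable at x \<Longrightarrow>
   partial i (\<lambda>x. f x * g x) x = f x * partial i g x + partial i f x * g x"
  by (rule partial_eqI) (auto simp: partial_def intro!: derivative_eq_intros
      intro: frechet_derivative_works[THEN iffD1])

lemma Ck_add: "Ck k f \<Longrightarrow> Ck k g \<Longrightarrow> Ck k (\<lambda>x. f x + g x)"
proof (induction k arbitrary: f g)
  case (Suc k)
  then have "partial i (\<lambda>x. f x + g x) = (\<lambda>x. partial i f x + partial i g x)" for i
    by (intro ext partial_add) auto
  with Suc show ?case by auto
qed (auto intro: continuous_intros)

lemma Ck_mult: "Ck k f \<Longrightarrow> Ck k g \<Longrightarrow> Ck k (\<lambda>x. f x * g x)"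
proof (induction k arbitrary: f g)
  case (Suc k)
  then have "partial i (\<lambda>x. f x * g x) = (\<lambda>x. f x * partial i g x + partial i f x * g x)" for i
    by (intro ext partial_mult) auto
  moreover have "Ck k f" "Ck k g"
    using Ck_SucD[OF Suc.prems(1)] Ck_SucD[OF Suc.prems(2)] by blast+
  ultimately show ?case
    using Suc by (auto intro!: Ck_add)
qed (auto intro: continuous_intros)

lemma Ck_sum: "finite A \<Longrightarrow> (\<And>j. j \<in> A \<Longrightarrow> Ck k (f j)) \<Longrightarrow> Ck k (\<lambda>x. \<Sum>j\<in>A. f j x)"
  by (induction A rule: finite_induct) (auto intro: Ck_add)

lemma Ck_prod: "finite A \<Longrightarrow> (\<And>j. j \<in> A \<Longrightarrow> Ck k (f j)) \<Longrightarrow> Ck k (\<lambda>x. \<Prod>j\<in>A. f j x)"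
  by (induction A rule: finite_induct) (auto intro: Ck_mult)

lemma Ck_diff: "Ck k f \<Longrightarrow> Ck k g \<Longrightarrow> Ck k (\<lambda>x. f x - g x)"
  using Ck_add[of k f "\<lambda>x. - 1 * g x"] Ck_mult[of k "\<lambda>x. - 1" g] by simp

lemma Ck_linear: "Ck k (\<lambda>x::real. a * x + b)"
  using Ck_add[OF Ck_inner[of k a] Ck_const[of k b]] by (simp add: mult.commute)

lemma partial_compose:
  fixes \<psi> :: "real \<Rightarrow> real"
  assumes "\<psi> differentiable at (g x)" "g differentiable at x"
  shows "partial i (\<lambda>x. \<psi> (g x)) x = partial 1 \<psi> (g x) * partial i g x"
proof -
  have "(\<psi> has_derivative (\<lambda>h. h * partial 1 \<psi> (g x))) (at (g x))"
    using differentiable_has_derivative_partial[OF assms(1)] by simp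
  moreover have "(g has_derivative frechet_derivative g (at x)) (at x)"
    using assms(2) frechet_derivative_works by blast
  ultimately have "((\<lambda>x. \<psi> (g x)) has_derivative
      (\<lambda>h. frechet_derivative g (at x) h * partial 1 \<psi> (g x))) (at x)"
    by (rule has_derivative_compose[rotated])
  from partial_eqI[OF this, of i] show ?thesis
    by (simp add: partial_def[of i g] mult.commute)
qed

lemma Ck_compose:
  fixes \<psi> :: "real \<Rightarrow> real"
  shows "Ck k \<psi> \<Longrightarrow> Ck k g \<Longrightarrow> Ck k (\<lambda>x. \<psi> (g x))"
proof (induction k arbitrary: \<psi> g)
  case 0
  then show ?case
    by (auto intro: continuous_on_compose2)
next
  case (Suc k)
  then have "partial i (\<lambda>x. \<psi> (g x)) = (\<lambda>x. partial 1 \<psi> (g x) * partial i g x)" for i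
    by (intro ext partial_compose) auto
  moreover have "(\<lambda>x. \<psi> (g x)) differentiable at x" for x
    using Suc.prems differentiable_chain_at[of g x \<psi>] by (auto simp: o_def)
  moreover have "Ck k g"
    using Ck_SucD[OF Suc.prems(1)] Ck_SucD[OF Suc.prems(2)] by blast+
  moreover have "Ck k (\<lambda>x. partial 1 \<psi> (g x))"
    by (rule Suc.IH) (use Suc.prems \<open>Ck k g\<close> in auto)
  ultimately show ?case
    using Suc.prems by (auto intro: Ck_mult)
qed

lemma partial_1_eq_DERIV:
  fixes \<psi> :: "real \<Rightarrow> real"
  assumes "(\<psi> has_real_derivative d) (at x)"
  shows "partial 1 \<psi> x = d"
  using partial_eqI[OF assms[unfolded has_field_derivative_def], of 1] by simp

lemma Ck_Suc_realI:
  fixes \<psi> :: "real \<Rightarrow> real"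
  assumes "\<And>x. (\<psi> has_real_derivative \<psi>' x) (at x)" "Ck k \<psi>'"
  shows "Ck (Suc k) \<psi>"
proof -
  have "partial 1 \<psi> = \<psi>'"
    using partial_1_eq_DERIV[OF assms(1)] by (intro ext)
  then show ?thesis
    using assms by (auto simp: real_differentiable_def intro: real_differentiable_def[THEN iffD2])
qed

text \<open>\<open>flat 0\<close> is the classical smooth function exp(-1/x) that vanishes on a
  half-line. The powers of 1/x close the family under differentiation, so smoothness follows by
  induction on the order for all \<open>m\<close> at once.\<close>

definition flat :: "nat \<Rightarrow> real \<Rightarrow> real" where
  "flat m x = (if x > 0 then (1 / x) ^ m * exp (- (1 / x)) else 0)"

lemma has_real_derivative_flat:
  "(flat m has_real_derivative flat (m + 2) x - real m * flat (m + 1) x) (at x)"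
proof -
  consider "x > 0" | "x < 0" | "x = 0" by linarith
  then show ?thesis
  proof cases
    case 1
    have inv: "((\<lambda>x. 1 / x) has_real_derivative (- ((1 / x) ^ 2))) (at x)"
      using 1 by (auto intro!: derivative_eq_intros simp: power2_eq_square)
    have "((\<lambda>x. (1 / x) ^ m * exp (- (1 / x))) has_real_derivative
        flat (m + 2) x - real m * flat (m + 1) x) (at x)"
      by (rule DERIV_cong[OF DERIV_mult[OF DERIV_power[OF inv]
              DERIV_chain2[OF DERIV_exp DERIV_minus[OF inv]]]])
        (use 1 in \<open>cases m; simp add: flat_def power2_eq_square algebra_simps\<close>)
    then show ?thesis
      by (rule has_field_derivative_transform_within_open[of _ _ _ "{0<..}"])
        (use 1 in \<open>auto simp: flat_def\<close>)
  next
    case 2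
    have "((\<lambda>x. 0) has_real_derivative 0) (at x)"
      by simp
    then have "(flat m has_real_derivative 0) (at x)"
      by (rule has_field_derivative_transform_within_open[of _ _ _ "{..<0}"])
        (use 2 in \<open>auto simp: flat_def\<close>)
    with 2 show ?thesis by (simp add: flat_def)
  next
    case 3
    \<comment> \<open>The difference quotient at 0 is again of the form power times exponential,
      with one more factor \<open>1 / h\<close>; the exponential wins.\<close>
    have "((\<lambda>h. (1 / h) ^ Suc m * exp (- (1 / h))) \<longlongrightarrow> 0) (at_right (0::real))"
      by real_asymp
    then have "((\<lambda>h. flat m h / h) \<longlongrightarrow> 0) (at_right (0::real))"
      by (rule Lim_transform_eventually)
        (auto simp: flat_def eventually_at_right_field field_simps intro!: exI[of _ 1])
    moreover have "((\<lambda>h. flat m h / h) \<longlongrightarrow> 0) (at_left (0::real))"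
      by (rule Lim_transform_eventually[OF tendsto_const])
        (auto simp: flat_def eventually_at_left_field intro!: exI[of _ "-1"])
    ultimately have "((\<lambda>h. flat m h / h) \<longlongrightarrow> 0) (at (0::real))"
      by (simp add: filterlim_at_split)
    with 3 show ?thesis by (simp add: DERIV_def flat_def)
  qed
qed

lemma Ck_flat: "Ck k (flat m)"
proof (induction k arbitrary: m)
  case 0
  show ?case
    using has_real_derivative_flat[of m] by (auto intro: DERIV_isCont continuous_at_imp_continuous_on)
next
  case (Suc k)
  show ?case
    by (rule Ck_Suc_realI[OF has_real_derivative_flat])
      (intro Ck_diff Ck_mult Ck_const Suc.IH)
qed

lemma flat_0: "flat 0 x = (if x > 0 then exp (- (1 / x)) else 0)"
  by (simp add: flat_def)

lemma flat_0_bounds: "0 \<le> flat 0 x" "flat 0 x \<le> 1"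
  by (auto simp: flat_0)

text \<open>The shift \<open>c\<close> is 0 for bumps that fill a whole box and 1 for cut-offs that
  must vanish near the endpoints of an interval.\<close>

lemma flat_0_scaled_tendsto:
  assumes "x > 0"
  shows "(\<lambda>n. flat 0 (real n * x - c)) \<longlonglongrightarrow> 1"
proof -
  have "(\<lambda>n. exp (- (1 / (real n * x - c)))) \<longlonglongrightarrow> 1"
    using assms by real_asymp
  moreover have "\<forall>\<^sub>F n in sequentially. real n * x - c > 0"
    using assms by real_asymp
  then have "\<forall>\<^sub>F n in sequentially. exp (- (1 / (real n * x - c))) = flat 0 (real n * x - c)"
    by eventually_elim (simp add: flat_0)
  ultimately show ?thesis
    by (rule Lim_transform_eventually)
qed

section \<open>Integration by parts\<close>

lemma integrable_cont_compact_support: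
  fixes g :: "'a::euclidean_space \<Rightarrow> 'b::euclidean_space"
  assumes "compact S" "S \<subseteq> \<Omega>" "\<Omega> \<in> sets lebesgue" "continuous_on S g" "\<And>x. x \<in> \<Omega> \<Longrightarrow> x \<notin> S \<Longrightarrow> g x = 0"
  shows "integrable (lebesgue_on \<Omega>) g"
proof -
  have int: "integrable lborel (\<lambda>x. indicator S x *\<^sub>R g x)"
    using assms by (intro borel_integrable_compact)
  have "integrable lebesgue (\<lambda>x. indicator S x *\<^sub>R g x)"
    using int integrable_completion[OF borel_measurable_integrable[OF int]] by blast
  moreover have "(\<lambda>x. indicator S x *\<^sub>R g x) = (\<lambda>x. if x \<in> \<Omega> then g x else 0)"
    using assms by (auto simp: indicator_def fun_eq_iff)
  ultimately show ?thesis
    using Lebesgue_Measure.integrable_restrict_UNIV[OF assms(3), of g] by simp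
qed

lemma partial_eq_0_outside:
  assumes "closed S" "x \<notin> S" "\<And>y. y \<notin> S \<Longrightarrow> f y = 0"
  shows "partial i f x = 0"
proof -
  have "partial i f x = partial i (\<lambda>_. 0) x"
    by (rule partial_cong_open[of "- S"]) (use assms in auto)
  also have "\<dots> = 0"
    by (rule partial_eqI[where D = "\<lambda>h. 0", simplified]) simp
  finally show ?thesis .
qed

lemma DERIV_along_line:
  fixes f :: "'a::euclidean_space \<Rightarrow> real"
  assumes "f differentiable at (x + s *\<^sub>R i)"
  shows "((\<lambda>s. f (x + s *\<^sub>R i)) has_real_derivative partial i f (x + s *\<^sub>R i)) (at s)"
proof -
  obtain D where D: "(f has_derivative D) (at (x + s *\<^sub>R i))"
    using assms by (auto simp: differentiable_def)
  have "((\<lambda>s. x + s *\<^sub>R i) has_derivative (\<lambda>h. h *\<^sub>R i)) (at s)"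
    by (auto intro!: derivative_eq_intros)
  from has_derivative_compose[OF this D]
  have "((\<lambda>s. f (x + s *\<^sub>R i)) has_derivative (\<lambda>h. D (h *\<^sub>R i))) (at s)" .
  moreover have "D (h *\<^sub>R i) = partial i f (x + s *\<^sub>R i) * h" for h
    using linear_scale[OF has_derivative_linear[OF D], of h i] by (simp add: partial_eqI[OF D])
  ultimately show ?thesis
    by (simp add: has_field_derivative_def)
qed

lemma integral_lborel_translation:
  fixes f :: "'a::euclidean_space \<Rightarrow> real"
  assumes "f \<in> borel_measurable borel"
  shows "integral\<^sup>L lborel (\<lambda>x. f (c + x)) = integral\<^sup>L lborel f"
proof -
  have "integral\<^sup>L (distr lborel borel ((+) c)) f = integral\<^sup>L lborel (\<lambda>x. f (c + x))"
    using assms by (intro integral_distr) auto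
  then show ?thesis
    by (simp add: lborel_distr_plus)
qed

text \<open>By translation invariance all difference quotients have integral zero.\<close>

lemma integral_partial_eq_0:
  fixes \<psi> :: "'a::euclidean_space \<Rightarrow> real"
  assumes diff: "\<And>x. \<psi> differentiable at x" and i: "i \<in> Basis"
    and cont: "continuous_on UNIV (partial i \<psi>)"
    and K: "compact K" "\<And>x. x \<notin> K \<Longrightarrow> \<psi> x = 0"
  shows "integral\<^sup>L lebesgue (partial i \<psi>) = 0"
proof -
  have cont\<psi>: "continuous_on UNIV \<psi>"
    using diff by (intro differentiable_imp_continuous_on) (auto simp: differentiable_on_def intro: differentiable_at_withinI)
  have [measurable]: "\<psi> \<in> borel_measurable borel" "partial i \<psi> \<in> borel_measurable borel"
    using cont\<psi> cont by (auto intro: borel_measurable_continuous_onI)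
  have 0: "partial i \<psi> x = 0" if "x \<notin> K" for x
    using partial_eq_0_outside[OF compact_imp_closed[OF K(1)] that K(2)] .
  have "bounded (partial i \<psi> ` K)"
    by (intro compact_imp_bounded compact_continuous_image K continuous_on_subset[OF cont]) auto
  then obtain B where "B > 0" "\<forall>x\<in>K. \<bar>partial i \<psi> x\<bar> \<le> B"
    by (auto simp: bounded_pos)
  then have "\<bar>partial i \<psi> x\<bar> \<le> B" for x
    using 0[of x] by (cases "x \<in> K") auto
  note B = \<open>B > 0\<close> this
  obtain r where r: "\<And>x. x \<in> K \<Longrightarrow> norm x \<le> r"
    using compact_imp_bounded[OF K(1)] by (auto simp: bounded_iff)
  define e where "e n = 1 / real (Suc n)" for n
  have e: "e n > 0" "e n \<le> 1" "e \<longlonglongrightarrow> 0" for n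
    using LIMSEQ_inverse_real_of_nat by (auto simp: e_def[abs_def] inverse_eq_divide)
  define D where "D n x = (\<psi> (e n *\<^sub>R i + x) - \<psi> x) / e n" for n x
  have int\<psi>: "integrable lborel \<psi>"
  proof -
    have "integrable lborel (\<lambda>x. indicator K x *\<^sub>R \<psi> x)"
      using K cont\<psi> by (intro borel_integrable_compact) (auto intro: continuous_on_subset)
    also have "(\<lambda>x. indicator K x *\<^sub>R \<psi> x) = \<psi>"
      using K by (auto simp: indicator_def fun_eq_iff)
    finally show ?thesis .
  qed
  have "integral\<^sup>L lborel (D n) = 0" for n
  proof -
    have "integrable lborel (\<lambda>x. \<psi> (e n *\<^sub>R i + x))"
      using integrable_distr[of "(+) (e n *\<^sub>R i)" lborel borel \<psi>] int\<psi> by (simp add: lborel_distr_plus)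
    then show ?thesis
      unfolding D_def using int\<psi> by (simp add: integral_lborel_translation)
  qed
  moreover have "(\<lambda>n. integral\<^sup>L lborel (D n)) \<longlonglongrightarrow> integral\<^sup>L lborel (partial i \<psi>)"
  proof (rule integral_dominated_convergence)
    \<comment> \<open>The steps \<open>e n\<close> are at most 1, so all difference quotients vanish
      outside the ball of radius \<open>r + 1\<close>, where \<open>r\<close> bounds the norms of
      points of \<open>K\<close>.\<close>
    show "integrable lborel (\<lambda>x. indicator (cball 0 (r + 1)) x *\<^sub>R B)"
      by (intro borel_integrable_compact continuous_on_const compact_cball)
    show "AE x in lborel. (\<lambda>n. D n x) \<longlonglongrightarrow> partial i \<psi> x"
    proof (rule AE_I2)
      fix x
      have "((\<lambda>s. \<psi> (x + s *\<^sub>R i)) has_real_derivative partial i \<psi> x) (at 0)"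
        using DERIV_along_line[of \<psi> x 0 i] diff by simp
      then have "((\<lambda>h. (\<psi> (x + h *\<^sub>R i) - \<psi> x) / h) \<longlongrightarrow> partial i \<psi> x) (at 0)"
        by (simp add: DERIV_def)
      moreover have "filterlim e (at 0) sequentially"
        using e by (auto simp: filterlim_at less_imp_neq[symmetric])
      ultimately have "(\<lambda>n. (\<psi> (x + e n *\<^sub>R i) - \<psi> x) / e n) \<longlonglongrightarrow> partial i \<psi> x"
        by (rule filterlim_compose)
      then show "(\<lambda>n. D n x) \<longlonglongrightarrow> partial i \<psi> x"
        by (simp add: D_def add.commute)
    qed
    show "AE x in lborel. norm (D n x) \<le> indicator (cball 0 (r + 1)) x *\<^sub>R B" for n
    proof (rule AE_I2)
      fix x
      have "\<bar>\<psi> (x + e n *\<^sub>R i) - \<psi> (x + 0 *\<^sub>R i)\<bar> \<le> B * \<bar>e n - 0\<bar>"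
        using field_differentiable_bound[of UNIV "\<lambda>s. \<psi> (x + s *\<^sub>R i)" "\<lambda>s. partial i \<psi> (x + s *\<^sub>R i)" B "e n" 0]
          DERIV_along_line[of \<psi> x] diff B by simp
      then have le: "norm (D n x) \<le> B"
        using e(1)[of n] by (simp add: D_def add.commute abs_mult field_simps)
      show "norm (D n x) \<le> indicator (cball 0 (r + 1)) x *\<^sub>R B"
      proof (cases "x \<in> cball 0 (r + 1)")
        case False
        then have "norm x > r + 1" by simp
        moreover have "norm (e n *\<^sub>R i) \<le> 1"
          using e(1,2)[of n] i by simp
        ultimately have "norm (e n *\<^sub>R i + x) > r" "norm x > r"
          using norm_triangle_ineq2[of x "- (e n *\<^sub>R i)"] by (simp_all add: add.commute)
        then have "\<psi> (e n *\<^sub>R i + x) = 0" "\<psi> x = 0"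
          using r K(2) by (meson not_less)+
        then show ?thesis using B(1) by (simp add: D_def)
      qed (use le in simp)
    qed
  qed (auto simp: D_def[abs_def])
  ultimately have "integral\<^sup>L lborel (partial i \<psi>) = 0"
    by (simp add: LIMSEQ_const_iff)
  then show ?thesis
    by (simp add: integral_completion)
qed

lemma test_funD:
  assumes "\<phi> \<in> test_fun \<Omega>"
  shows "Ck k \<phi>" "\<phi> differentiable at x" "continuous_on S \<phi>" "i \<in> Basis \<Longrightarrow> continuous_on S (partial i \<phi>)"
proof -
  show "Ck k \<phi>" using assms by (simp add: test_fun_def)
  have "Ck (Suc (Suc 0)) \<phi>" "Ck 0 \<phi>" using assms unfolding test_fun_def by blast+
  then show "\<phi> differentiable at x" "continuous_on S \<phi>"
    by (auto intro: continuous_on_subset)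
  assume "i \<in> Basis"
  then have "Ck 0 (partial i \<phi>)"
    using \<open>Ck (Suc (Suc 0)) \<phi>\<close> Ck_SucD[of 0 "partial i \<phi>"] by (metis Ck.simps(2))
  then show "continuous_on S (partial i \<phi>)"
    by (auto intro: continuous_on_subset)
qed

lemma test_fun_support:
  assumes "\<phi> \<in> test_fun \<Omega>"
  obtains S where "compact S" "S \<subseteq> \<Omega>" "\<And>x. x \<notin> S \<Longrightarrow> \<phi> x = 0" "\<And>x i. x \<notin> S \<Longrightarrow> partial i \<phi> x = 0"
proof
  let ?S = "closure {x. \<phi> x \<noteq> 0}"
  show "compact ?S" "?S \<subseteq> \<Omega>"
    using assms by (auto simp: test_fun_def)
  show *: "x \<notin> ?S \<Longrightarrow> \<phi> x = 0" for x
    using closure_subset[of "{x. \<phi> x \<noteq> 0}"] by auto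
  show "x \<notin> ?S \<Longrightarrow> partial i \<phi> x = 0" for x i
    by (rule partial_eq_0_outside[OF closed_closure _ *])
qed

lemma test_funI:
  assumes "\<And>k. Ck k \<phi>" "compact S" "S \<subseteq> \<Omega>" "\<And>x. x \<notin> S \<Longrightarrow> \<phi> x = 0"
  shows "\<phi> \<in> test_fun \<Omega>"
proof -
  have "closure {x. \<phi> x \<noteq> 0} \<subseteq> S"
    using assms by (intro closure_minimal compact_imp_closed) auto
  then show ?thesis
    using assms bounded_subset[of S "closure {x. \<phi> x \<noteq> 0}"]
    by (auto simp: test_fun_def compact_eq_bounded_closed)
qed

text \<open>The product of \<open>X\<close> with the test function, extended by 0, is differentiable
  on the whole space because its support is a compact subset of the open set. Its partial derivative
  therefore has integral zero, and the product rule gives the claim.\<close>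

lemma integration_by_parts:
  fixes X :: "'a::euclidean_space \<Rightarrow> real"
  assumes "open \<Omega>" "\<phi> \<in> test_fun \<Omega>" "i \<in> Basis"
    and X: "\<And>x. x \<in> \<Omega> \<Longrightarrow> X differentiable at x" "continuous_on \<Omega> (partial i X)"
  shows "(LINT x|lebesgue_on \<Omega>. X x * partial i \<phi> x) = - (LINT x|lebesgue_on \<Omega>. partial i X x * \<phi> x)"
proof -
  note \<phi> = test_funD[OF assms(2)]
  obtain S where S: "compact S" "S \<subseteq> \<Omega>" "\<And>x. x \<notin> S \<Longrightarrow> \<phi> x = 0" "\<And>x i. x \<notin> S \<Longrightarrow> partial i \<phi> x = 0"
    using test_fun_support[OF assms(2)] by metis
  have meas: "\<Omega> \<in> sets lebesgue"
    using assms(1) by auto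
  have contX: "continuous_on \<Omega> X"
    using X(1) by (auto intro!: differentiable_imp_continuous_on simp: differentiable_on_def differentiable_at_withinI)
  define \<psi> where "\<psi> x = (if x \<in> \<Omega> then X x * \<phi> x else 0)" for x
  have \<psi>0: "\<psi> x = 0" if "x \<notin> S" for x
    using S(3)[OF that] by (simp add: \<psi>_def)
  have \<psi>\<Omega>: "partial i \<psi> x = X x * partial i \<phi> x + partial i X x * \<phi> x" if "x \<in> \<Omega>" for x
  proof -
    have "partial i \<psi> x = partial i (\<lambda>x. X x * \<phi> x) x"
      by (rule partial_cong_open[OF assms(1) that]) (simp add: \<psi>_def)
    then show ?thesis
      by (simp add: partial_mult X(1)[OF that] \<phi>)
  qed
  have nS: "partial i \<psi> x = 0" if "x \<notin> S" for x
    using partial_eq_0_outside[OF compact_imp_closed[OF S(1)] that \<psi>0] .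
  have cov: "\<Omega> \<union> - S = UNIV" using S(2) by auto
  have "\<psi> differentiable at x" for x
  proof (cases "x \<in> \<Omega>")
    case True
    have "(\<lambda>x. X x * \<phi> x) differentiable at x"
      using X(1)[OF True] \<phi>(2) by (intro differentiable_mult)
    then show ?thesis
      unfolding differentiable_def
      using has_derivative_transform_within_open[of "\<lambda>x. X x * \<phi> x" _ x UNIV \<Omega> \<psi>] assms(1) True
      by (auto simp: \<psi>_def)
  next
    case False
    have "((\<lambda>x. 0) has_derivative (\<lambda>h. 0)) (at x)"
      by simp
    then have "(\<psi> has_derivative (\<lambda>h. 0)) (at x)"
      by (rule has_derivative_transform_within_open[of _ _ _ _ "- S"])
        (use False S \<psi>0 compact_imp_closed[OF S(1)] in auto)
    then show ?thesis by (auto simp: differentiable_def)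
  qed
  moreover have "continuous_on UNIV (partial i \<psi>)"
    unfolding cov[symmetric]
  proof (rule continuous_on_open_Un)
    have "continuous_on \<Omega> (\<lambda>x. X x * partial i \<phi> x + partial i X x * \<phi> x)"
      by (intro continuous_intros contX X \<phi> assms(3))
    then show "continuous_on \<Omega> (partial i \<psi>)"
      by (rule continuous_on_eq) (simp add: \<psi>\<Omega>)
    show "continuous_on (- S) (partial i \<psi>)"
      by (rule continuous_on_eq[OF continuous_on_const[of _ 0]]) (simp add: nS)
  qed (use assms(1) compact_imp_closed[OF S(1)] in auto)
  ultimately have "integral\<^sup>L lebesgue (partial i \<psi>) = 0"
    using integral_partial_eq_0[of \<psi> i S] assms(3) S(1) \<psi>0 by blast
  also have "partial i \<psi> = (\<lambda>x. if x \<in> \<Omega> then X x * partial i \<phi> x + partial i X x * \<phi> x else 0)"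
    using \<psi>\<Omega> nS S(2) by fastforce
  also have "integral\<^sup>L lebesgue \<dots> = (LINT x|lebesgue_on \<Omega>. X x * partial i \<phi> x + partial i X x * \<phi> x)"
    by (rule Lebesgue_Measure.integral_restrict_UNIV[OF meas])
  also have "\<dots> = (LINT x|lebesgue_on \<Omega>. X x * partial i \<phi> x) + (LINT x|lebesgue_on \<Omega>. partial i X x * \<phi> x)"
    by (intro Bochner_Integration.integral_add integrable_cont_compact_support[OF S(1,2) meas])
      (auto intro!: continuous_intros \<phi> assms(3) simp: S intro: continuous_on_subset[OF contX S(2)] continuous_on_subset[OF X(2) S(2)])
  finally show ?thesis by simp
qed

section \<open>Uniqueness of the weak gradient\<close>

lemma loc_integrable_mult_test_fun:
  fixes g :: "'a::euclidean_space \<Rightarrow> 'b::euclidean_space"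
  assumes "open \<Omega>" "loc_integrable \<Omega> g" "continuous_on UNIV \<phi>"
    and S: "compact S" "S \<subseteq> \<Omega>" "\<And>x. x \<notin> S \<Longrightarrow> \<phi> x = (0::real)"
  shows "integrable (lebesgue_on \<Omega>) (\<lambda>x. \<phi> x *\<^sub>R g x)"
proof -
  have "S \<in> sets lebesgue" "\<Omega> \<in> sets lebesgue"
    using assms(1) S(1) by (auto intro: lmeasurable_compact fmeasurableD)
  have "integrable (lebesgue_on S) g"
    using assms(2) S by (auto simp: loc_integrable_def)
  then have g: "integrable lebesgue (\<lambda>x. if x \<in> S then g x else 0)"
    using Lebesgue_Measure.integrable_restrict_UNIV[OF \<open>S \<in> sets lebesgue\<close>] by blast
  have "bounded (\<phi> ` S)"
    by (intro compact_imp_bounded compact_continuous_image S continuous_on_subset[OF assms(3)]) auto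
  then obtain B where B: "B > 0" "\<forall>x\<in>S. \<bar>\<phi> x\<bar> \<le> B"
    by (auto simp: bounded_pos)
  have "integrable lebesgue (\<lambda>x. \<phi> x *\<^sub>R (if x \<in> S then g x else 0))"
  proof (rule Bochner_Integration.integrable_bound)
    show "integrable lebesgue (\<lambda>x. B *\<^sub>R (if x \<in> S then g x else 0))"
      using g by (intro integrable_scaleR_right)
    have "\<phi> \<in> borel_measurable lborel"
      using assms(3) by (simp add: borel_measurable_continuous_onI)
    then have "\<phi> \<in> borel_measurable lebesgue"
      by (rule measurable_completion)
    then show "(\<lambda>x. \<phi> x *\<^sub>R (if x \<in> S then g x else 0)) \<in> borel_measurable lebesgue"
      using borel_measurable_integrable[OF g] by (rule borel_measurable_scaleR)
    show "AE x in lebesgue. norm (\<phi> x *\<^sub>R (if x \<in> S then g x else 0)) \<le> norm (B *\<^sub>R (if x \<in> S then g x else 0))"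
      using B by (auto intro!: mult_right_mono)
  qed
  moreover have "(\<lambda>x. \<phi> x *\<^sub>R (if x \<in> S then g x else 0)) = (\<lambda>x. if x \<in> \<Omega> then \<phi> x *\<^sub>R g x else 0)"
    using S by (auto simp: fun_eq_iff)
  ultimately show ?thesis
    using Lebesgue_Measure.integrable_restrict_UNIV[OF \<open>\<Omega> \<in> sets lebesgue\<close>, of "\<lambda>x. \<phi> x *\<^sub>R g x"] by simp
qed

lemma integrable_test_fun:
  assumes "open \<Omega>" "\<phi> \<in> test_fun \<Omega>" "loc_integrable \<Omega> g"
  shows "integrable (lebesgue_on \<Omega>) (\<lambda>x. g x * \<phi> x)"
    and "i \<in> Basis \<Longrightarrow> integrable (lebesgue_on \<Omega>) (\<lambda>x. g x * partial i \<phi> x)"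
proof -
  obtain S where S: "compact S" "S \<subseteq> \<Omega>" "\<And>x. x \<notin> S \<Longrightarrow> \<phi> x = 0" "\<And>x i. x \<notin> S \<Longrightarrow> partial i \<phi> x = 0"
    using test_fun_support[OF assms(2)] by metis
  show "integrable (lebesgue_on \<Omega>) (\<lambda>x. g x * \<phi> x)"
    using loc_integrable_mult_test_fun[OF assms(1,3) test_funD(3)[OF assms(2)] S(1,2,3)] by (simp add: mult.commute)
  show "integrable (lebesgue_on \<Omega>) (\<lambda>x. g x * partial i \<phi> x)" if "i \<in> Basis"
    using loc_integrable_mult_test_fun[OF assms(1,3) test_funD(4)[OF assms(2) that] S(1,2,4)] by (simp add: mult.commute)
qed

text \<open>Smooth functions with values in [0, 1] converging pointwise to the indicator of the open
  box. They vanish outside the box for every \<open>n\<close>, so the closed box carries all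
  supports.\<close>

definition box_bump :: "nat \<Rightarrow> 'a::euclidean_space \<Rightarrow> 'a \<Rightarrow> 'a \<Rightarrow> real" where
  "box_bump n a b x = (\<Prod>i\<in>Basis. flat 0 (real n * (x \<bullet> i - a \<bullet> i)) * flat 0 (real n * (b \<bullet> i - x \<bullet> i)))"

lemma box_bump_bounds: "0 \<le> box_bump n a b x" "box_bump n a b x \<le> 1"
  unfolding box_bump_def
  by (auto intro!: prod_nonneg prod_le_1 mult_nonneg_nonneg mult_le_one flat_0_bounds)

lemma box_bump_outside: "x \<notin> box a b \<Longrightarrow> box_bump n a b x = 0"
proof -
  assume "x \<notin> box a b"
  then obtain i where i: "i \<in> Basis" "x \<bullet> i \<le> a \<bullet> i \<or> b \<bullet> i \<le> x \<bullet> i"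
    by (auto simp: mem_box not_less)
  then have "flat 0 (real n * (x \<bullet> i - a \<bullet> i)) * flat 0 (real n * (b \<bullet> i - x \<bullet> i)) = 0"
    by (auto simp: flat_0 zero_less_mult_iff)
  with i(1) show ?thesis
    unfolding box_bump_def by (intro prod_zero) auto
qed

lemma box_bump_tendsto: "(\<lambda>n. box_bump n a b x) \<longlonglongrightarrow> indicator (box a b) x"
proof (cases "x \<in> box a b")
  case True
  have "(\<lambda>n. box_bump n a b x) \<longlonglongrightarrow> (\<Prod>i\<in>(Basis::'a set). 1 * 1)"
    unfolding box_bump_def using True flat_0_scaled_tendsto[of _ 0]
    by (intro tendsto_prod tendsto_mult) (auto simp: mem_box)
  then show ?thesis using True by simp
qed (simp add: box_bump_outside)

lemma box_bump_test_fun: "cbox a b \<subseteq> \<Omega> \<Longrightarrow> box_bump n a b \<in> test_fun \<Omega>"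
proof (rule test_funI)
  show "Ck k (box_bump n a b)" for k
    unfolding box_bump_def[abs_def]
    by (intro Ck_prod Ck_mult Ck_compose[OF Ck_flat] Ck_diff Ck_const Ck_inner finite_Basis)
  show "x \<notin> cbox a b \<Longrightarrow> box_bump n a b x = 0" for x
    using box_bump_outside[of x a b] box_subset_cbox[of a b] by blast
qed auto

text \<open>A Dynkin argument: boxes are stable under intersection and generate the Borel sets, and
  the vanishing total integral handles complements. Lebesgue sets differ from Borel sets by null
  sets, and a function with vanishing integral over all of them is the density of the zero
  measure.\<close>

lemma AE_eq_0_if_box_integrals_0:
  fixes h :: "'a::euclidean_space \<Rightarrow> real"
  assumes h: "integrable lebesgue h" and tot: "integral\<^sup>L lebesgue h = 0"
    and box: "\<And>a b. (LINT x:box a b|lebesgue. h x) = 0"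
  shows "AE x in lebesgue. h x = 0"
proof -
  have borel: "(LINT x:A|lebesgue. h x) = 0" if "A \<in> sets borel" for A
  proof -
    have seth: "set_integrable lebesgue A h" if "A \<in> sets borel" for A
      unfolding set_integrable_def using that by (intro integrable_mult_indicator h) auto
    let ?G = "range (\<lambda>(a, b). box a b :: 'a set)"
    have sets: "sets borel = sigma_sets UNIV ?G"
      by (simp add: borel_eq_box)
    have "Int_stable ?G" "?G \<subseteq> Pow UNIV"
      by (auto simp: Int_stable_def box_Int_box)
    then show ?thesis
      using that[unfolded sets]
    proof (induction rule: sigma_sets_induct_disjoint)
      case (basic A)
      then show ?case using box by auto
    next
      case empty
      show ?case by (simp add: set_lebesgue_integral_def)
    next
      case (compl A)
      have A: "A \<in> sets borel"
        using compl(1) sets by simp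
      have "(LINT x:UNIV - A|lebesgue. h x) = (LINT x|lebesgue. h x - indicator A x *\<^sub>R h x)"
        unfolding set_lebesgue_integral_def
        by (intro Bochner_Integration.integral_cong) (auto simp: indicator_def)
      also have "\<dots> = integral\<^sup>L lebesgue h - (LINT x:A|lebesgue. h x)"
        unfolding set_lebesgue_integral_def
        by (intro Bochner_Integration.integral_diff h seth[OF A, unfolded set_integrable_def])
      finally show ?case using tot compl(2) by simp
    next
      case (union A)
      have A: "A i \<in> sets borel" for i
        using union(2) sets by auto
      have "(LINT x:(\<Union>i. A i)|lebesgue. h x) = (\<Sum>i. (LINT x:(A i)|lebesgue. h x))"
        by (rule lebesgue_integral_countable_add)
          (use A union(1) in \<open>auto simp: disjoint_family_on_def intro!: seth\<close>)
      then show ?case using union(3) by simp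
    qed
  qed
  have leb: "(LINT x:A|lebesgue. h x) = 0" if A: "A \<in> sets lebesgue" for A
  proof -
    obtain S N N' where S: "A = S \<union> N" "N \<subseteq> N'" "N' \<in> null_sets lborel" "S \<in> sets lborel"
      using sets_completionE[OF A] by metis
    have "(LINT x:A|lebesgue. h x) = (LINT x:S|lebesgue. h x)"
      unfolding set_lebesgue_integral_def
    proof (rule Bochner_Integration.integral_cong_AE)
      have "AE x in lebesgue. x \<notin> N'"
        using S(3) by (intro AE_not_in null_sets_completionI)
      then show "AE x in lebesgue. indicator A x *\<^sub>R h x = indicator S x *\<^sub>R h x"
        by eventually_elim (use S(1,2) in \<open>auto simp: indicator_def\<close>)
      have "S \<in> sets lebesgue"
        using S(4) by (rule sets_completionI_sets)
      then show "(\<lambda>x. indicator A x *\<^sub>R h x) \<in> borel_measurable lebesgue"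
        "(\<lambda>x. indicator S x *\<^sub>R h x) \<in> borel_measurable lebesgue"
        using borel_measurable_integrable[OF h] A
        by (auto intro!: borel_measurable_times borel_measurable_indicator)
    qed
    with borel[of S] S show ?thesis by simp
  qed
  show ?thesis
    by (rule density_unique_real[of lebesgue h "\<lambda>_. 0"]) (use h leb in \<open>auto simp: set_lebesgue_integral_def\<close>)
qed

text \<open>Testing with box bumps and passing to the limit gives vanishing integrals over all boxes
  whose closure lies in the open set. This settles every closed box, and countably many of them
  cover the set.\<close>

lemma fundamental_lemma:
  fixes G :: "'a::euclidean_space \<Rightarrow> real"
  assumes "open \<Omega>" "loc_integrable \<Omega> G"
    and 0: "\<And>\<phi>. \<phi> \<in> test_fun \<Omega> \<Longrightarrow> (LINT x|lebesgue_on \<Omega>. G x * \<phi> x) = 0"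
  shows "AE x in lebesgue_on \<Omega>. G x = 0"
proof -
  have meas: "\<Omega> \<in> sets lebesgue"
    using assms(1) by auto
  have int: "integrable lebesgue (\<lambda>x. if x \<in> cbox a b then G x else 0)" if "cbox a b \<subseteq> \<Omega>" for a b
  proof -
    have "integrable (lebesgue_on (cbox a b)) G"
      using assms(2) that by (auto simp: loc_integrable_def)
    then show ?thesis
      by (rule Lebesgue_Measure.integrable_restrict_UNIV[THEN iffD2, rotated]) auto
  qed
  have box0: "(LINT x|lebesgue. indicator (box a b) x * G x) = 0" if ab: "cbox a b \<subseteq> \<Omega>" for a b
  proof -
    have "(\<lambda>n. (LINT x|lebesgue. (if x \<in> \<Omega> then G x * box_bump n a b x else 0))) \<longlonglongrightarrow>
        (LINT x|lebesgue. (if x \<in> cbox a b then G x else 0) * indicator (box a b) x)"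
    proof (rule integral_dominated_convergence)
      show "integrable lebesgue (\<lambda>x. norm (if x \<in> cbox a b then G x else 0))"
        using int[OF ab] by (rule integrable_norm)
      have eq: "(if x \<in> \<Omega> then G x * box_bump n a b x else 0) = (if x \<in> cbox a b then G x else 0) * box_bump n a b x" for x n
        using ab box_bump_outside[of x a b n] box_subset_cbox[of a b] by auto
      have "box_bump n a b \<in> borel_measurable lebesgue" for n
        using test_funD(3)[OF box_bump_test_fun[OF ab], of UNIV]
        by (intro measurable_completion) (simp add: borel_measurable_continuous_onI)
      then show "(\<lambda>x. if x \<in> \<Omega> then G x * box_bump n a b x else 0) \<in> borel_measurable lebesgue" for n
        unfolding eq using borel_measurable_integrable[OF int[OF ab]] by (intro borel_measurable_times)
      show "(\<lambda>x. (if x \<in> cbox a b then G x else 0) * indicator (box a b) x) \<in> borel_measurable lebesgue"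
        using borel_measurable_integrable[OF int[OF ab]]
        by (intro borel_measurable_times borel_measurable_indicator) auto
      show "AE x in lebesgue. norm (if x \<in> \<Omega> then G x * box_bump n a b x else 0) \<le> norm (if x \<in> cbox a b then G x else 0)" for n
        unfolding eq abs_mult using box_bump_bounds[of n a b] by (auto simp: abs_mult intro!: mult_left_le)
      show "AE x in lebesgue. (\<lambda>n. if x \<in> \<Omega> then G x * box_bump n a b x else 0) \<longlonglongrightarrow>
          (if x \<in> cbox a b then G x else 0) * indicator (box a b) x"
        unfolding eq by (intro AE_I2 tendsto_mult tendsto_const box_bump_tendsto)
    qed
    moreover have "(LINT x|lebesgue. (if x \<in> \<Omega> then G x * box_bump n a b x else 0)) = 0" for n
      using 0[OF box_bump_test_fun[OF ab]] Lebesgue_Measure.integral_restrict_UNIV[OF meas, of "\<lambda>x. G x * box_bump n a b x"] by simp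
    ultimately have "(LINT x|lebesgue. (if x \<in> cbox a b then G x else 0) * indicator (box a b) x) = 0"
      by (simp add: LIMSEQ_const_iff)
    moreover have "(\<lambda>x. (if x \<in> cbox a b then G x else 0) * indicator (box a b) x) = (\<lambda>x. indicator (box a b) x * G x)"
      using box_subset_cbox[of a b] by (auto simp: indicator_def fun_eq_iff)
    ultimately show ?thesis by simp
  qed
  have cbox: "AE x in lebesgue. x \<in> cbox c d \<longrightarrow> G x = 0" if cd: "cbox c d \<subseteq> \<Omega>" for c d
  proof -
    define h where "h x = indicator (box c d) x * G x" for x
    have "integrable lebesgue (\<lambda>x. indicator (box c d) x *\<^sub>R (if x \<in> cbox c d then G x else 0))"
      by (intro integrable_mult_indicator int cd) auto
    also have "(\<lambda>x. indicator (box c d) x *\<^sub>R (if x \<in> cbox c d then G x else 0)) = h"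
      using box_subset_cbox[of c d] by (auto simp: indicator_def fun_eq_iff h_def)
    finally have inth: "integrable lebesgue h" .
    have "AE x in lebesgue. h x = 0"
    proof (rule AE_eq_0_if_box_integrals_0[OF inth])
      show "integral\<^sup>L lebesgue h = 0"
        using box0[OF cd] by (simp add: h_def[abs_def])
      show "(LINT x:box a b|lebesgue. h x) = 0" for a b
      proof -
        obtain a' b' where ab': "box a b \<inter> box c d = box a' b'"
          using box_Int_box by blast
        have "(LINT x:box a b|lebesgue. h x) = (LINT x|lebesgue. indicator (box a' b') x * G x)"
          unfolding set_lebesgue_integral_def h_def ab'[symmetric]
          by (intro Bochner_Integration.integral_cong) (auto simp: indicator_def)
        also have "\<dots> = 0"
        \<comment> \<open>The closed box is the closure of the open one only when the latter is
          non-empty; an empty open box may have a degenerate closed box outside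
          \<open>cbox c d\<close>.\<close>
        proof (cases "box a' b' = {}")
          case False
          then have "cbox a' b' = closure (box a' b')"
            by (simp add: closure_box)
          also have "\<dots> \<subseteq> cbox c d"
            using ab' box_subset_cbox[of c d] by (intro closure_minimal) auto
          finally show ?thesis using box0 cd by blast
        qed simp
        finally show ?thesis .
      qed
    qed
    moreover have "AE x in lebesgue. x \<notin> cbox c d - box c d"
      using negligible_frontier_interval[of c d] by (intro AE_not_in) (simp add: negligible_iff_null_sets)
    ultimately show ?thesis
      by eventually_elim (auto simp: h_def indicator_def split: if_splits)
  qed
  obtain \<D> where \<D>: "countable \<D>" "\<D> \<subseteq> Pow \<Omega>" "\<And>X. X \<in> \<D> \<Longrightarrow> \<exists>a b. X = cbox a b" "\<Union>\<D> = \<Omega>"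
    using open_countable_Union_open_cbox[OF assms(1)] by metis
  have "AE x in lebesgue. \<forall>X\<in>\<D>. x \<in> X \<longrightarrow> G x = 0"
    unfolding AE_ball_countable[OF \<D>(1)] using cbox \<D>(2,3) by (metis PowD subsetD)
  then have "AE x in lebesgue. x \<in> \<Omega> \<longrightarrow> G x = 0"
    by eventually_elim (use \<D>(4) in blast)
  then show ?thesis
    using meas by (subst AE_restrict_space_iff) auto
qed

lemma weak_grad_unique:
  assumes "open \<Omega>" "is_weak_grad \<Omega> u G" "is_weak_grad \<Omega> u H"
  shows "AE x in lebesgue_on \<Omega>. G x = H x"
proof -
  have loc: "loc_integrable \<Omega> (\<lambda>x. G x \<bullet> i)" "loc_integrable \<Omega> (\<lambda>x. H x \<bullet> i)" for i
    using assms(2,3) by (auto simp: is_weak_grad_def loc_integrable_def)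
  have "AE x in lebesgue_on \<Omega>. G x \<bullet> i - H x \<bullet> i = 0" if i: "i \<in> Basis" for i
  proof (rule fundamental_lemma[OF assms(1)])
    show "loc_integrable \<Omega> (\<lambda>x. G x \<bullet> i - H x \<bullet> i)"
      using loc[of i] by (auto simp: loc_integrable_def)
    show "(LINT x|lebesgue_on \<Omega>. (G x \<bullet> i - H x \<bullet> i) * \<phi> x) = 0" if "\<phi> \<in> test_fun \<Omega>" for \<phi>
      using assms(2,3) that i integrable_test_fun(1)[OF assms(1) that loc(1)[of i]]
        integrable_test_fun(1)[OF assms(1) that loc(2)[of i]]
      by (simp add: left_diff_distrib is_weak_grad_def)
  qed
  then have "AE x in lebesgue_on \<Omega>. \<forall>i\<in>Basis. G x \<bullet> i - H x \<bullet> i = 0"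
    by (subst AE_ball_countable) (auto intro: countable_finite)
  then show ?thesis
    by eventually_elim (auto intro: euclidean_eqI)
qed

text \<open>This makes the choice operator in \<open>weak_grad\<close> harmless: any explicitly
  known weak gradient may replace it under integrals.\<close>

lemma weak_grad_AE_eq:
  assumes "open \<Omega>" "is_weak_grad \<Omega> u G"
  shows "AE x in lebesgue_on \<Omega>. weak_grad \<Omega> u x = G x"
  by (rule weak_grad_unique[OF assms(1) _ assms(2)])
    (use assms(2) in \<open>simp add: weak_grad_def someI[of "is_weak_grad \<Omega> u"]\<close>)

lemma is_weak_grad_diff:
  assumes "open \<Omega>" "is_weak_grad \<Omega> u G" "is_weak_grad \<Omega> v H"
  shows "is_weak_grad \<Omega> (\<lambda>x. u x - v x) (\<lambda>x. G x - H x)"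
proof -
  have loc: "loc_integrable \<Omega> u" "loc_integrable \<Omega> v" "loc_integrable \<Omega> G" "loc_integrable \<Omega> H"
    using assms by (auto simp: is_weak_grad_def)
  then have loc': "loc_integrable \<Omega> (\<lambda>x. G x \<bullet> i)" "loc_integrable \<Omega> (\<lambda>x. H x \<bullet> i)" for i
    by (auto simp: loc_integrable_def)
  have "(LINT x|lebesgue_on \<Omega>. (u x - v x) * partial i \<phi> x) = - (LINT x|lebesgue_on \<Omega>. ((G x - H x) \<bullet> i) * \<phi> x)"
    if "\<phi> \<in> test_fun \<Omega>" "i \<in> Basis" for \<phi> i
    using assms(2,3) that integrable_test_fun(2)[OF assms(1) that(1) loc(1) that(2)]
      integrable_test_fun(2)[OF assms(1) that(1) loc(2) that(2)]
      integrable_test_fun(1)[OF assms(1) that(1) loc'(1)[of i]]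
      integrable_test_fun(1)[OF assms(1) that(1) loc'(2)[of i]]
    by (simp add: left_diff_distrib inner_diff_left is_weak_grad_def)
  then show ?thesis
    using loc by (auto simp: is_weak_grad_def loc_integrable_def)
qed

section \<open>The space \<open>W01p\<close>\<close>

text \<open>Completeness of Lebesgue measure. It transfers measurability from an explicit weak
  gradient to the one picked by \<open>weak_grad\<close>.\<close>

lemma measurable_lebesgue_on_AE_cong:
  fixes f g :: "'a::euclidean_space \<Rightarrow> 'b::euclidean_space"
  assumes "\<Omega> \<in> sets lebesgue" "f \<in> borel_measurable (lebesgue_on \<Omega>)" "AE x in lebesgue_on \<Omega>. f x = g x"
  shows "g \<in> borel_measurable (lebesgue_on \<Omega>)"
proof -
  let ?f = "\<lambda>x. if x \<in> \<Omega> then f x else 0" and ?g = "\<lambda>x. if x \<in> \<Omega> then g x else 0"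
  have f: "?f \<in> borel_measurable lebesgue"
    using assms(1,2) borel_measurable_if by blast
  have AE: "AE x in lebesgue. ?f x = ?g x"
    using assms(1,3) by (subst (asm) AE_restrict_space_iff) auto
  have "?g \<in> borel_measurable lebesgue"
  proof (rule measurableI)
    fix A :: "'b set" assume A: "A \<in> sets borel"
    show "?g -` A \<inter> space lebesgue \<in> sets lebesgue"
    proof (rule completion.in_sets_AE)
      show "AE x in lebesgue. x \<in> ?f -` A \<inter> space lebesgue \<longleftrightarrow> x \<in> ?g -` A \<inter> space lebesgue"
        using AE by eventually_elim auto
      show "?f -` A \<inter> space lebesgue \<in> sets lebesgue"
        using f A by (rule measurable_sets)
    qed auto
  qed auto
  then show ?thesis
    using assms(1) borel_measurable_if by blast
qed

lemma Lp_norm_powr: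
  assumes "p > 0"
  shows "Lp_norm p \<Omega> u powr p = (LINT x|lebesgue_on \<Omega>. norm (u x) powr p)"
proof -
  have "0 \<le> (LINT x|lebesgue_on \<Omega>. norm (u x) powr p)"
    by (rule Bochner_Integration.integral_nonneg) simp
  then show ?thesis
    using assms by (simp add: Lp_norm_def powr_powr)
qed

text \<open>Above \<open>e\<close> the factor x^(1-p) is at most e^(1-p). The parameter
  \<open>e\<close> lets this elementary inequality play the role of Hoelder's inequality in
  comparing L^p with L^1 on a set of finite measure.\<close>

lemma young_linear:
  assumes "(0::real) \<le> x" "0 < e" "1 \<le> p"
  shows "x \<le> e + e powr (1 - p) * x powr p"
proof (cases "x \<le> e")
  case True
  then show ?thesis using assms by (simp add: add_increasing2)
next
  case False
  then have x: "x > e" "x > 0" using assms by auto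
  have "x = x powr (1 - p) * x powr p"
    using x by (simp add: powr_add[symmetric])
  also have "\<dots> \<le> e powr (1 - p) * x powr p"
    using x assms by (intro mult_right_mono powr_mono2') auto
  finally show ?thesis using assms by linarith
qed

section \<open>From p-th powers to L^1 on finite measure spaces\<close>

context finite_measure
begin

lemma integrable_if_powr_integrable:
  fixes g :: "'a \<Rightarrow> 'b::euclidean_space"
  assumes "p \<ge> 1" "g \<in> borel_measurable M" "integrable M (\<lambda>x. norm (g x) powr p)"
  shows "integrable M g"
proof (rule Bochner_Integration.integrable_bound)
  show "integrable M (\<lambda>x. 1 + norm (g x) powr p)"
    using assms by auto
  show "AE x in M. norm (g x) \<le> norm (1 + norm (g x) powr p)"
    using young_linear[of "norm (g _)" 1 p] assms by (auto intro!: AE_I2)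
qed fact

lemma integral_norm_le_powr:
  fixes g :: "'a \<Rightarrow> 'b::euclidean_space"
  assumes "p \<ge> 1" "g \<in> borel_measurable M" "integrable M (\<lambda>x. norm (g x) powr p)" "e > 0"
  shows "(LINT x|M. norm (g x)) \<le> e * measure M (space M) + e powr (1 - p) * (LINT x|M. norm (g x) powr p)"
proof -
  have "(LINT x|M. norm (g x)) \<le> (LINT x|M. e + e powr (1 - p) * norm (g x) powr p)"
  proof (rule integral_mono)
    show "integrable M (\<lambda>x. norm (g x))"
      by (rule integrable_norm[OF integrable_if_powr_integrable[OF assms(1-3)]])
  qed (use assms in \<open>auto intro: young_linear\<close>)
  also have "\<dots> = e * measure M (space M) + e powr (1 - p) * (LINT x|M. norm (g x) powr p)"
    using assms by (subst Bochner_Integration.integral_add) auto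
  finally show ?thesis .
qed

lemma integral_norm_tendsto_0:
  fixes g :: "nat \<Rightarrow> 'a \<Rightarrow> 'b::euclidean_space"
  assumes "p \<ge> 1" "\<And>n. g n \<in> borel_measurable M" "\<And>n. integrable M (\<lambda>x. norm (g n x) powr p)"
    and lim: "(\<lambda>n. LINT x|M. norm (g n x) powr p) \<longlonglongrightarrow> 0"
  shows "(\<lambda>n. LINT x|M. norm (g n x)) \<longlonglongrightarrow> 0"
proof (rule LIMSEQ_I)
  fix r :: real assume r: "r > 0"
  define m where "m = measure M (space M)"
  \<comment> \<open>The summand 1 keeps the denominator positive when the space has measure
    zero.\<close>
  define e where "e = r / (2 * (m + 1))"
  have m: "m \<ge> 0" by (simp add: m_def)
  have e: "e > 0" using r m by (simp add: e_def)
  have em: "e * m < r / 2"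
    using r m by (simp add: e_def field_simps)
  have "(\<lambda>n. e * m + e powr (1 - p) * (LINT x|M. norm (g n x) powr p)) \<longlonglongrightarrow> e * m + e powr (1 - p) * 0"
    by (intro tendsto_intros lim)
  then have "\<forall>\<^sub>F n in sequentially. e * m + e powr (1 - p) * (LINT x|M. norm (g n x) powr p) < r"
    by (rule order_tendstoD(2)) (use em r in simp)
  then have "\<forall>\<^sub>F n in sequentially. norm ((LINT x|M. norm (g n x)) - 0) < r"
  proof eventually_elim
    case (elim n)
    have "0 \<le> (LINT x|M. norm (g n x))"
      by (rule Bochner_Integration.integral_nonneg) simp
    then show ?case
      using elim integral_norm_le_powr[OF assms(1-3) e, of n] by (simp add: m_def)
  qed
  then show "\<exists>N. \<forall>n\<ge>N. norm ((LINT x|M. norm (g n x)) - 0) < r"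
    by (simp add: eventually_sequentially)
qed

end

lemma Lp_diff:
  fixes u v :: "'a::euclidean_space \<Rightarrow> 'b::euclidean_space"
  assumes "p > 0" "u \<in> Lp p \<Omega>" "v \<in> Lp p \<Omega>"
  shows "(\<lambda>x. u x - v x) \<in> Lp p \<Omega>"
proof -
  have m: "u \<in> borel_measurable (lebesgue_on \<Omega>)" "v \<in> borel_measurable (lebesgue_on \<Omega>)"
    using assms by (auto simp: Lp_def)
  have "norm (u x - v x) powr p \<le> 2 powr p * (norm (u x) powr p + norm (v x) powr p)" for x
  proof -
    define M where "M = max (norm (u x)) (norm (v x))"
    have "norm (u x - v x) \<le> 2 * M"
      using norm_triangle_ineq4[of "u x" "v x"] by (simp add: M_def)
    then have "norm (u x - v x) powr p \<le> (2 * M) powr p"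
      using assms(1) by (intro powr_mono2) auto
    also have "\<dots> = 2 powr p * M powr p"
      by (subst powr_mult) (auto simp: M_def max_def)
    also have "M powr p \<le> norm (u x) powr p + norm (v x) powr p"
      by (auto simp: M_def max_def)
    finally show ?thesis by simp
  qed
  note bound = this
  have "integrable (lebesgue_on \<Omega>) (\<lambda>x. norm (u x - v x) powr p)"
  proof (rule Bochner_Integration.integrable_bound)
    show "integrable (lebesgue_on \<Omega>) (\<lambda>x. 2 powr p * (norm (u x) powr p + norm (v x) powr p))"
      using assms by (simp add: Lp_def)
    show "(\<lambda>x. norm (u x - v x) powr p) \<in> borel_measurable (lebesgue_on \<Omega>)"
      using m by measurable
    show "AE x in lebesgue_on \<Omega>. norm (norm (u x - v x) powr p)
        \<le> norm (2 powr p * (norm (u x) powr p + norm (v x) powr p))"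
      using bound by (intro AE_I2) simp
  qed
  then show ?thesis
    using m by (auto simp: Lp_def)
qed

lemma Lp_imp_integrable:
  fixes u :: "'a::euclidean_space \<Rightarrow> 'b::euclidean_space"
  assumes "\<Omega> \<in> lmeasurable" "1 \<le> p" "u \<in> Lp p \<Omega>"
  shows "integrable (lebesgue_on \<Omega>) u"
proof -
  interpret finite_measure "lebesgue_on \<Omega>"
    using assms(1) by (rule finite_measure_lebesgue_on)
  show ?thesis
    using assms by (auto simp: Lp_def intro: integrable_if_powr_integrable)
qed

lemma bounded_imp_Lp:
  fixes u :: "'a::euclidean_space \<Rightarrow> 'b::euclidean_space"
  assumes "\<Omega> \<in> lmeasurable" "u \<in> borel_measurable (lebesgue_on \<Omega>)" "\<And>x. x \<in> \<Omega> \<Longrightarrow> norm (u x) \<le> C" "p > 0"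
  shows "u \<in> Lp p \<Omega>"
proof -
  interpret finite_measure "lebesgue_on \<Omega>"
    using assms(1) by (rule finite_measure_lebesgue_on)
  have "integrable (lebesgue_on \<Omega>) (\<lambda>x. norm (u x) powr p)"
    by (rule integrable_const_bound[where B = "C powr p"])
      (use assms in \<open>auto intro!: AE_I2 powr_mono2\<close>)
  then show ?thesis
    using assms by (simp add: Lp_def)
qed

section \<open>Classical gradients of test functions and convergence in Sobolev spaces\<close>

definition grad :: "('a::euclidean_space \<Rightarrow> real) \<Rightarrow> 'a \<Rightarrow> 'a" where
  "grad \<phi> x = (\<Sum>i\<in>Basis. partial i \<phi> x *\<^sub>R i)"

lemma grad_inner [simp]: "i \<in> Basis \<Longrightarrow> grad \<phi> x \<bullet> i = partial i \<phi> x"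
  by (simp add: grad_def)

lemma continuous_on_grad: "\<phi> \<in> test_fun \<Omega> \<Longrightarrow> continuous_on S (grad \<phi>)"
  unfolding grad_def by (intro continuous_intros test_funD)

lemma measurable_cont:
  fixes g :: "'a::euclidean_space \<Rightarrow> 'b::euclidean_space"
  assumes "open \<Omega>" "continuous_on \<Omega> g"
  shows "g \<in> borel_measurable (lebesgue_on \<Omega>)"
  using assms by (intro continuous_imp_measurable_on_sets_lebesgue) auto

lemma loc_integrable_cont:
  fixes g :: "'a::euclidean_space \<Rightarrow> 'b::euclidean_space"
  assumes "continuous_on \<Omega> g"
  shows "loc_integrable \<Omega> g"
  unfolding loc_integrable_def
  by (auto intro!: integrable_cont_compact_support[OF _ subset_refl] continuous_on_subset[OF assms] fmeasurableD lmeasurable_compact)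

lemma integrable_imp_loc_integrable:
  fixes u :: "'a::euclidean_space \<Rightarrow> 'b::euclidean_space"
  assumes "\<Omega> \<in> sets lebesgue" "integrable (lebesgue_on \<Omega>) u"
  shows "loc_integrable \<Omega> u"
  unfolding loc_integrable_def
proof (intro allI impI)
  fix K assume K: "compact K \<and> K \<subseteq> \<Omega>"
  then have meas: "K \<in> sets lebesgue"
    by (auto intro: lmeasurable_compact fmeasurableD)
  have "integrable lebesgue (\<lambda>x. indicator K x *\<^sub>R (if x \<in> \<Omega> then u x else 0))"
    using assms Lebesgue_Measure.integrable_restrict_UNIV[OF assms(1), of u]
    by (intro integrable_mult_indicator meas) simp
  moreover have "(\<lambda>x. indicator K x *\<^sub>R (if x \<in> \<Omega> then u x else 0)) = (\<lambda>x. if x \<in> K then u x else 0)"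
    using K by (auto simp: indicator_def fun_eq_iff)
  ultimately show "integrable (lebesgue_on K) u"
    using Lebesgue_Measure.integrable_restrict_UNIV[OF meas, of u] by simp
qed

lemma test_fun_bounded:
  assumes "\<phi> \<in> test_fun \<Omega>"
  obtains B where "\<And>x. \<bar>\<phi> x\<bar> \<le> B" "\<And>x. norm (grad \<phi> x) \<le> B"
proof -
  obtain S where S: "compact S" "S \<subseteq> \<Omega>" "\<And>x. x \<notin> S \<Longrightarrow> \<phi> x = 0" "\<And>x i. x \<notin> S \<Longrightarrow> partial i \<phi> x = 0"
    using test_fun_support[OF assms] by metis
  have "bounded (\<phi> ` S)" "bounded (grad \<phi> ` S)"
    by (intro compact_imp_bounded compact_continuous_image S test_funD(3)[OF assms] continuous_on_grad[OF assms])+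
  then obtain B1 B2 where B: "B1 > 0" "B2 > 0" "\<forall>x\<in>S. \<bar>\<phi> x\<bar> \<le> B1" "\<forall>x\<in>S. norm (grad \<phi> x) \<le> B2"
    by (auto simp: bounded_pos)
  show ?thesis
  proof (rule that[of "max B1 B2"])
    show "\<bar>\<phi> x\<bar> \<le> max B1 B2" for x
      using B S(3)[of x] by (cases "x \<in> S") (auto simp: le_max_iff_disj)
    show "norm (grad \<phi> x) \<le> max B1 B2" for x
      using B S(4)[of x] by (cases "x \<in> S") (auto simp: le_max_iff_disj grad_def)
  qed
qed

lemma is_weak_grad_test_fun:
  assumes "open \<Omega>" "\<phi> \<in> test_fun \<Omega>"
  shows "is_weak_grad \<Omega> \<phi> (grad \<phi>)"
  unfolding is_weak_grad_def
  using test_funD[OF assms(2)] assms continuous_on_grad[OF assms(2)]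
  by (auto intro!: loc_integrable_cont integration_by_parts)

lemma test_fun_Lp:
  assumes "open \<Omega>" "\<Omega> \<in> lmeasurable" "\<phi> \<in> test_fun \<Omega>" "p > 0"
  shows "\<phi> \<in> Lp p \<Omega>" "grad \<phi> \<in> Lp p \<Omega>"
proof -
  obtain B where B: "\<And>x. \<bar>\<phi> x\<bar> \<le> B" "\<And>x. norm (grad \<phi> x) \<le> B"
    using test_fun_bounded[OF assms(3)] by blast
  show "\<phi> \<in> Lp p \<Omega>" "grad \<phi> \<in> Lp p \<Omega>"
    using assms B test_funD(3)[OF assms(3)] continuous_on_grad[OF assms(3)]
    by (auto intro!: bounded_imp_Lp[of _ _ B] measurable_cont)
qed

lemma weak_grad_norm_integral:
  fixes u :: "'a::euclidean_space \<Rightarrow> real"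
  assumes "open \<Omega>" "is_weak_grad \<Omega> u G" "G \<in> borel_measurable (lebesgue_on \<Omega>)"
  shows "(LINT x|lebesgue_on \<Omega>. norm (weak_grad \<Omega> u x) powr p) = (LINT x|lebesgue_on \<Omega>. norm (G x) powr p)"
proof -
  have AE: "AE x in lebesgue_on \<Omega>. weak_grad \<Omega> u x = G x"
    using weak_grad_AE_eq[OF assms(1,2)] .
  have "weak_grad \<Omega> u \<in> borel_measurable (lebesgue_on \<Omega>)"
    by (rule measurable_lebesgue_on_AE_cong[OF _ assms(3)])
      (use AE assms(1) in \<open>auto simp: eq_commute\<close>)
  then show ?thesis
    using assms(3) AE by (intro Bochner_Integration.integral_cong_AE) auto
qed

lemma W1p_norm_eq:
  assumes "p > 0" "open \<Omega>" "is_weak_grad \<Omega> u G" "G \<in> borel_measurable (lebesgue_on \<Omega>)"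
  shows "W1p_norm p \<Omega> u = ((LINT x|lebesgue_on \<Omega>. norm (u x) powr p) +
    (LINT x|lebesgue_on \<Omega>. norm (G x) powr p)) powr (1 / p)"
  by (simp add: W1p_norm_def Lp_norm_powr[OF assms(1)] weak_grad_norm_integral[OF assms(2-4)])

text \<open>The L^p convergence of functions and gradients is weakened to L^1 convergence, which is
  enough for pairing with bounded coefficients.\<close>

lemma W01p_approx:
  assumes p: "p > 1" and \<Omega>: "open \<Omega>" "\<Omega> \<in> lmeasurable" and w: "w \<in> W01p p \<Omega>"
  obtains H \<phi> where "w \<in> Lp p \<Omega>" "H \<in> Lp p \<Omega>" "is_weak_grad \<Omega> w H" "\<And>n::nat. \<phi> n \<in> test_fun \<Omega>"
    "(\<lambda>n. LINT x|lebesgue_on \<Omega>. norm (\<phi> n x - w x)) \<longlonglongrightarrow> 0"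
    "(\<lambda>n. LINT x|lebesgue_on \<Omega>. norm (grad (\<phi> n) x - H x)) \<longlonglongrightarrow> 0"
proof -
  interpret finite_measure "lebesgue_on \<Omega>"
    using \<Omega>(2) by (rule finite_measure_lebesgue_on)
  obtain H \<phi> where H: "w \<in> Lp p \<Omega>" "H \<in> Lp p \<Omega>" "is_weak_grad \<Omega> w H" "\<And>n::nat. \<phi> n \<in> test_fun \<Omega>"
    and lim: "(\<lambda>n. W1p_norm p \<Omega> (\<lambda>x. \<phi> n x - w x)) \<longlonglongrightarrow> 0"
    using w by (auto simp: W01p_def W1p_def)
  define I where "I n = (LINT x|lebesgue_on \<Omega>. norm (\<phi> n x - w x) powr p)" for n
  define J where "J n = (LINT x|lebesgue_on \<Omega>. norm (grad (\<phi> n) x - H x) powr p)" for n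
  have Lp: "(\<lambda>x. \<phi> n x - w x) \<in> Lp p \<Omega>" "(\<lambda>x. grad (\<phi> n) x - H x) \<in> Lp p \<Omega>" for n
    using test_fun_Lp[OF \<Omega> H(4), of p] H(1,2) p by (auto intro!: Lp_diff)
  then have meas: "(\<lambda>x. \<phi> n x - w x) \<in> borel_measurable (lebesgue_on \<Omega>)"
     "(\<lambda>x. grad (\<phi> n) x - H x) \<in> borel_measurable (lebesgue_on \<Omega>)"
     "integrable (lebesgue_on \<Omega>) (\<lambda>x. norm (\<phi> n x - w x) powr p)"
     "integrable (lebesgue_on \<Omega>) (\<lambda>x. norm (grad (\<phi> n) x - H x) powr p)" for n
    by (auto simp: Lp_def)
  have nn: "0 \<le> I n" "0 \<le> J n" for n
    by (simp_all add: I_def J_def)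
  have "W1p_norm p \<Omega> (\<lambda>x. \<phi> n x - w x) = (I n + J n) powr (1 / p)" for n
    unfolding I_def J_def using p \<Omega>(1) H meas(2)[of n]
    by (intro W1p_norm_eq is_weak_grad_diff is_weak_grad_test_fun) auto
  with lim have "(\<lambda>n. ((I n + J n) powr (1 / p)) powr p) \<longlonglongrightarrow> 0 powr p"
    using p by (intro tendsto_powr2) auto
  then have sum0: "(\<lambda>n. I n + J n) \<longlonglongrightarrow> 0"
    using p nn by (simp add: powr_powr)
  have "I \<longlonglongrightarrow> 0" "J \<longlonglongrightarrow> 0"
    by (rule tendsto_sandwich[OF _ _ tendsto_const sum0]; use nn in \<open>simp add: always_eventually\<close>)+
  then have "(\<lambda>n. LINT x|lebesgue_on \<Omega>. norm (\<phi> n x - w x)) \<longlonglongrightarrow> 0"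
    "(\<lambda>n. LINT x|lebesgue_on \<Omega>. norm (grad (\<phi> n) x - H x)) \<longlonglongrightarrow> 0"
    using integral_norm_tendsto_0[OF _ meas(1,3)] integral_norm_tendsto_0[OF _ meas(2,4)] p
    unfolding I_def[abs_def] J_def[abs_def] by simp_all
  with H show ?thesis by (rule that)
qed

lemma integral_mult_tendsto:
  fixes g :: "nat \<Rightarrow> 'a \<Rightarrow> 'b::euclidean_space"
  assumes V: "V \<in> borel_measurable M" "\<And>x. x \<in> space M \<Longrightarrow> norm (V x) \<le> C"
    and g: "\<And>n. integrable M (g n)" "integrable M h"
    and lim: "(\<lambda>n. LINT x|M. norm (g n x - h x)) \<longlonglongrightarrow> 0"
  shows "integrable M (\<lambda>x. V x \<bullet> h x)"
    and "(\<lambda>n. LINT x|M. V x \<bullet> g n x) \<longlonglongrightarrow> (LINT x|M. V x \<bullet> h x)"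
proof -
  have int: "integrable M (\<lambda>x. V x \<bullet> k x)" if "integrable M k" for k :: "'a \<Rightarrow> 'b"
  proof (rule Bochner_Integration.integrable_bound)
    show "integrable M (\<lambda>x. C * norm (k x))"
      using that by auto
    show "(\<lambda>x. V x \<bullet> k x) \<in> borel_measurable M"
      using V(1) that by (intro borel_measurable_inner) auto
    show "AE x in M. norm (V x \<bullet> k x) \<le> norm (C * norm (k x))"
    proof (rule AE_I2)
      fix x assume "x \<in> space M"
      have "norm (V x \<bullet> k x) \<le> norm (V x) * norm (k x)"
        by (simp add: Cauchy_Schwarz_ineq2)
      also have "\<dots> \<le> C * norm (k x)"
        using V(2)[OF \<open>x \<in> space M\<close>] by (intro mult_right_mono) auto
      finally show "norm (V x \<bullet> k x) \<le> norm (C * norm (k x))" by simp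
    qed
  qed
  show "integrable M (\<lambda>x. V x \<bullet> h x)"
    by (rule int[OF g(2)])
  have "(\<lambda>n. (LINT x|M. V x \<bullet> g n x) - (LINT x|M. V x \<bullet> h x)) \<longlonglongrightarrow> 0"
  proof (rule Lim_null_comparison)
    show "\<forall>\<^sub>F n in sequentially. norm ((LINT x|M. V x \<bullet> g n x) - (LINT x|M. V x \<bullet> h x)) \<le> C * (LINT x|M. norm (g n x - h x))"
    proof (intro always_eventually allI)
      fix n
      have d: "integrable M (\<lambda>x. g n x - h x)"
        using g by auto
      have "(LINT x|M. V x \<bullet> g n x) - (LINT x|M. V x \<bullet> h x) = (LINT x|M. V x \<bullet> (g n x - h x))"
        using int g by (simp add: inner_diff_right)
      also have "norm \<dots> \<le> (LINT x|M. norm (V x \<bullet> (g n x - h x)))"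
        by (rule integral_norm_bound)
      also have "\<dots> \<le> (LINT x|M. C * norm (g n x - h x))"
      proof (rule integral_mono)
        show "norm (V x \<bullet> (g n x - h x)) \<le> C * norm (g n x - h x)" if "x \<in> space M" for x
          using V(2)[OF that] Cauchy_Schwarz_ineq2[of "V x" "g n x - h x"]
          by (simp, meson mult_right_mono norm_ge_zero order_trans)
      qed (use int[OF d] d in auto)
      finally show "norm ((LINT x|M. V x \<bullet> g n x) - (LINT x|M. V x \<bullet> h x)) \<le> C * (LINT x|M. norm (g n x - h x))"
        by simp
    qed
    show "(\<lambda>n. C * (LINT x|M. norm (g n x - h x))) \<longlonglongrightarrow> 0"
      using tendsto_mult_left[OF lim, of C] by simp
  qed
  then show "(\<lambda>n. LINT x|M. V x \<bullet> g n x) \<longlonglongrightarrow> (LINT x|M. V x \<bullet> h x)"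
    by (simp add: LIM_zero_iff)
qed

text \<open>Density: since \<open>V\<close> and \<open>h\<close> are bounded, L^1 convergence of the
  approximating test functions and of their gradients carries the identity over to \<open>w\<close>.
  The limit gradient and \<open>weak_grad\<close> agree almost everywhere.\<close>

lemma W01p_weak_identity:
  fixes V :: "'a::euclidean_space \<Rightarrow> 'a" and h :: "'a \<Rightarrow> real"
  assumes p: "p > 1" and \<Omega>: "open \<Omega>" "\<Omega> \<in> lmeasurable" and w: "w \<in> W01p p \<Omega>"
    and V: "V \<in> borel_measurable (lebesgue_on \<Omega>)" "\<And>x. x \<in> \<Omega> \<Longrightarrow> norm (V x) \<le> C"
    and h: "h \<in> borel_measurable (lebesgue_on \<Omega>)" "\<And>x. x \<in> \<Omega> \<Longrightarrow> \<bar>h x\<bar> \<le> C"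
    and id: "\<And>\<phi>. \<phi> \<in> test_fun \<Omega> \<Longrightarrow> (LINT x|lebesgue_on \<Omega>. V x \<bullet> grad \<phi> x) = (LINT x|lebesgue_on \<Omega>. h x * \<phi> x)"
  shows "integrable (lebesgue_on \<Omega>) (\<lambda>x. h x * w x)"
    and "(LINT x|lebesgue_on \<Omega>. V x \<bullet> weak_grad \<Omega> w x) = (LINT x|lebesgue_on \<Omega>. h x * w x)"
proof -
  interpret finite_measure "lebesgue_on \<Omega>"
    using \<Omega>(2) by (rule finite_measure_lebesgue_on)
  obtain H \<phi> where H: "w \<in> Lp p \<Omega>" "H \<in> Lp p \<Omega>" "is_weak_grad \<Omega> w H" "\<And>n::nat. \<phi> n \<in> test_fun \<Omega>"
    "(\<lambda>n. LINT x|lebesgue_on \<Omega>. norm (\<phi> n x - w x)) \<longlonglongrightarrow> 0"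
    "(\<lambda>n. LINT x|lebesgue_on \<Omega>. norm (grad (\<phi> n) x - H x)) \<longlonglongrightarrow> 0"
    by (rule W01p_approx[OF p \<Omega> w], rule that)
  have p0: "p > 0" and p1: "1 \<le> p" using p by simp_all
  have hC: "x \<in> space (lebesgue_on \<Omega>) \<Longrightarrow> norm (h x) \<le> C"
    and VC: "x \<in> space (lebesgue_on \<Omega>) \<Longrightarrow> norm (V x) \<le> C" for x
    using h(2) V(2) by simp_all
  note \<phi>Lp = test_fun_Lp[OF \<Omega> H(4) p0]
  note h' = integral_mult_tendsto[OF h(1) hC Lp_imp_integrable[OF \<Omega>(2) p1 \<phi>Lp(1)] Lp_imp_integrable[OF \<Omega>(2) p1 H(1)] H(5)]
  show "integrable (lebesgue_on \<Omega>) (\<lambda>x. h x * w x)"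
    using h'(1) by (simp only: inner_real_def)
  note V' = integral_mult_tendsto[OF V(1) VC Lp_imp_integrable[OF \<Omega>(2) p1 \<phi>Lp(2)] Lp_imp_integrable[OF \<Omega>(2) p1 H(2)] H(6)]
  have "(LINT x|lebesgue_on \<Omega>. V x \<bullet> H x) = (LINT x|lebesgue_on \<Omega>. h x * w x)"
  proof (rule LIMSEQ_unique)
    have eq: "(LINT x|lebesgue_on \<Omega>. V x \<bullet> grad (\<phi> n) x) = (LINT x|lebesgue_on \<Omega>. h x * \<phi> n x)" for n
      by (rule id[OF H(4)])
    show "(\<lambda>n. LINT x|lebesgue_on \<Omega>. h x * \<phi> n x) \<longlonglongrightarrow> (LINT x|lebesgue_on \<Omega>. V x \<bullet> H x)"
      using V'(2) unfolding eq .
    show "(\<lambda>n. LINT x|lebesgue_on \<Omega>. h x * \<phi> n x) \<longlonglongrightarrow> (LINT x|lebesgue_on \<Omega>. h x * w x)"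
      using h'(2) unfolding inner_real_def .
  qed
  moreover have "(LINT x|lebesgue_on \<Omega>. V x \<bullet> weak_grad \<Omega> w x) = (LINT x|lebesgue_on \<Omega>. V x \<bullet> H x)"
  proof (rule Bochner_Integration.integral_cong_AE)
    have AE: "AE x in lebesgue_on \<Omega>. weak_grad \<Omega> w x = H x"
      by (rule weak_grad_AE_eq[OF \<Omega>(1) H(3)])
    then show "AE x in lebesgue_on \<Omega>. V x \<bullet> weak_grad \<Omega> w x = V x \<bullet> H x"
      by eventually_elim simp
    have meas: "H \<in> borel_measurable (lebesgue_on \<Omega>)"
      using H(2) by (simp add: Lp_def)
    then have "weak_grad \<Omega> w \<in> borel_measurable (lebesgue_on \<Omega>)"
      by (rule measurable_lebesgue_on_AE_cong[rotated]) (use AE \<Omega>(1) in \<open>auto simp: eq_commute\<close>)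
    then show "(\<lambda>x. V x \<bullet> weak_grad \<Omega> w x) \<in> borel_measurable (lebesgue_on \<Omega>)"
      "(\<lambda>x. V x \<bullet> H x) \<in> borel_measurable (lebesgue_on \<Omega>)"
      using V(1) meas by (auto intro: borel_measurable_inner)
  qed
  ultimately show "(LINT x|lebesgue_on \<Omega>. V x \<bullet> weak_grad \<Omega> w x) = (LINT x|lebesgue_on \<Omega>. h x * w x)"
    by simp
qed

lemma (in finite_measure) integral_powr_tendsto_0:
  fixes g :: "nat \<Rightarrow> 'a \<Rightarrow> 'b::euclidean_space"
  assumes "p > 0" "\<And>n. g n \<in> borel_measurable M" "h \<in> borel_measurable M"
    and g: "\<And>n x. x \<in> space M \<Longrightarrow> norm (g n x) \<le> C" "\<And>x. x \<in> space M \<Longrightarrow> norm (h x) \<le> C"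
    and lim: "\<And>x. x \<in> space M \<Longrightarrow> (\<lambda>n. g n x) \<longlonglongrightarrow> h x"
  shows "(\<lambda>n. LINT x|M. norm (g n x - h x) powr p) \<longlonglongrightarrow> 0"
proof -
  have "(\<lambda>n. LINT x|M. norm (g n x - h x) powr p) \<longlonglongrightarrow> (LINT x|M. 0)"
  proof (rule integral_dominated_convergence[where w = "\<lambda>_. (2 * C) powr p"])
    show "AE x in M. norm (norm (g n x - h x) powr p) \<le> (2 * C) powr p" for n
    proof (rule AE_I2)
      fix x assume "x \<in> space M"
      then have "norm (g n x - h x) \<le> 2 * C"
        using g(1)[of x n] g(2)[of x] norm_triangle_ineq4[of "g n x" "h x"] by simp
      then show "norm (norm (g n x - h x) powr p) \<le> (2 * C) powr p"
        using assms(1) by (auto intro!: powr_mono2)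
    qed
    show "AE x in M. (\<lambda>n. norm (g n x - h x) powr p) \<longlonglongrightarrow> 0"
    proof (rule AE_I2)
      fix x assume "x \<in> space M"
      then have "(\<lambda>n. norm (g n x - h x)) \<longlonglongrightarrow> 0"
        using lim[of x] by (simp add: LIM_zero tendsto_norm_zero)
      then have "(\<lambda>n. norm (g n x - h x) powr p) \<longlonglongrightarrow> 0 powr p"
        using assms(1) by (intro tendsto_powr2) auto
      then show "(\<lambda>n. norm (g n x - h x) powr p) \<longlonglongrightarrow> 0" using assms(1) by simp
    qed
  qed (use assms in auto)
  then show ?thesis by simp
qed

text \<open>A criterion for explicit functions. On a set of finite measure, dominated convergence
  passes the definition of the weak gradient to the limit and also gives convergence in the Sobolev
  norm.\<close>

lemma W01p_bounded_limit:
  fixes u :: "'a::euclidean_space \<Rightarrow> real"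
  assumes p: "p > 1" and \<Omega>: "open \<Omega>" "\<Omega> \<in> lmeasurable"
    and \<phi>: "\<And>n::nat. \<phi> n \<in> test_fun \<Omega>"
    "\<And>n x. x \<in> \<Omega> \<Longrightarrow> \<bar>\<phi> n x\<bar> \<le> C" "\<And>n x. x \<in> \<Omega> \<Longrightarrow> norm (grad (\<phi> n) x) \<le> C"
    and lim: "\<And>x. x \<in> \<Omega> \<Longrightarrow> (\<lambda>n. \<phi> n x) \<longlonglongrightarrow> u x" "\<And>x. x \<in> \<Omega> \<Longrightarrow> (\<lambda>n. grad (\<phi> n) x) \<longlonglongrightarrow> G x"
  shows "u \<in> W01p p \<Omega>" "is_weak_grad \<Omega> u G" "G \<in> Lp p \<Omega>"
proof -
  interpret finite_measure "lebesgue_on \<Omega>"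
    using \<Omega>(2) by (rule finite_measure_lebesgue_on)
  have m: "\<phi> n \<in> borel_measurable (lebesgue_on \<Omega>)" "grad (\<phi> n) \<in> borel_measurable (lebesgue_on \<Omega>)" for n
    using test_funD(3)[OF \<phi>(1)] continuous_on_grad[OF \<phi>(1)] \<Omega>(1) by (auto intro: measurable_cont)
  have "u \<in> borel_measurable (lebesgue_on \<Omega>)"
    by (rule borel_measurable_LIMSEQ_metric[where f = \<phi>, OF m(1)]) (simp add: lim)
  moreover have "G \<in> borel_measurable (lebesgue_on \<Omega>)"
    by (rule borel_measurable_LIMSEQ_metric[where f = "\<lambda>n. grad (\<phi> n)", OF m(2)]) (simp add: lim)
  ultimately have mu: "u \<in> borel_measurable (lebesgue_on \<Omega>)" "G \<in> borel_measurable (lebesgue_on \<Omega>)"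
    by blast+
  have bu: "\<bar>u x\<bar> \<le> C" "norm (G x) \<le> C" if "x \<in> \<Omega>" for x
    using LIMSEQ_le_const2[OF tendsto_rabs[OF lim(1)[OF that]]] LIMSEQ_le_const2[OF tendsto_norm[OF lim(2)[OF that]]]
      \<phi>(2,3)[OF that] by auto
  have p0: "p > 0" using p by simp
  show GLp: "G \<in> Lp p \<Omega>"
    using bounded_imp_Lp[OF \<Omega>(2) mu(2) bu(2) p0] by simp
  have uLp: "u \<in> Lp p \<Omega>"
    using bounded_imp_Lp[OF \<Omega>(2) mu(1) _ p0, of C] bu(1) by simp
  show wg: "is_weak_grad \<Omega> u G"
    unfolding is_weak_grad_def
  proof (intro conjI ballI)
    have "integrable (lebesgue_on \<Omega>) u" "integrable (lebesgue_on \<Omega>) G"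
      using Lp_imp_integrable[OF \<Omega>(2) _ uLp] Lp_imp_integrable[OF \<Omega>(2) _ GLp] p by auto
    then show "loc_integrable \<Omega> u" "loc_integrable \<Omega> G"
      using integrable_imp_loc_integrable[OF fmeasurableD[OF \<Omega>(2)]] by blast+
    fix \<eta> i assume \<eta>: "\<eta> \<in> test_fun \<Omega>" and i: "i \<in> (Basis :: 'a set)"
    obtain B where B: "\<And>x. \<bar>\<eta> x\<bar> \<le> B" "\<And>x. norm (grad \<eta> x) \<le> B"
      using test_fun_bounded[OF \<eta>] by blast
    have Bi: "\<bar>partial i \<eta> x\<bar> \<le> B" for x
      using Basis_le_norm[OF i, of "grad \<eta> x"] B(2)[of x] i by simp
    have m\<eta>: "\<eta> \<in> borel_measurable (lebesgue_on \<Omega>)" "partial i \<eta> \<in> borel_measurable (lebesgue_on \<Omega>)"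
      using test_funD[OF \<eta>] i \<Omega>(1) by (auto intro: measurable_cont)
    have "(\<lambda>n. LINT x|lebesgue_on \<Omega>. \<phi> n x * partial i \<eta> x) \<longlonglongrightarrow> (LINT x|lebesgue_on \<Omega>. u x * partial i \<eta> x)"
    proof (rule integral_dominated_convergence[where w = "\<lambda>_. C * B"])
      show "AE x in lebesgue_on \<Omega>. norm (\<phi> n x * partial i \<eta> x) \<le> C * B" for n
        using \<phi>(2) Bi by (auto intro!: AE_I2 mult_mono' simp: abs_mult)
      show "AE x in lebesgue_on \<Omega>. (\<lambda>n. \<phi> n x * partial i \<eta> x) \<longlonglongrightarrow> u x * partial i \<eta> x"
        using lim(1) by (auto intro!: AE_I2 tendsto_intros)
    qed (use m mu m\<eta> in auto)
    moreover have "(\<lambda>n. LINT x|lebesgue_on \<Omega>. (grad (\<phi> n) x \<bullet> i) * \<eta> x) \<longlonglongrightarrow> (LINT x|lebesgue_on \<Omega>. (G x \<bullet> i) * \<eta> x)"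
    proof (rule integral_dominated_convergence[where w = "\<lambda>_. C * B"])
      show "AE x in lebesgue_on \<Omega>. norm ((grad (\<phi> n) x \<bullet> i) * \<eta> x) \<le> C * B" for n
      proof (rule AE_I2)
        fix x assume "x \<in> space (lebesgue_on \<Omega>)"
        then have "\<bar>grad (\<phi> n) x \<bullet> i\<bar> \<le> C"
          using \<phi>(3)[of x n] Basis_le_norm[OF i, of "grad (\<phi> n) x"] by simp
        then show "norm ((grad (\<phi> n) x \<bullet> i) * \<eta> x) \<le> C * B"
          using B(1)[of x] by (auto intro!: mult_mono' simp: abs_mult)
      qed
      show "AE x in lebesgue_on \<Omega>. (\<lambda>n. (grad (\<phi> n) x \<bullet> i) * \<eta> x) \<longlonglongrightarrow> (G x \<bullet> i) * \<eta> x"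
        using lim(2) by (auto intro!: AE_I2 tendsto_intros)
    qed (use m mu m\<eta> in \<open>auto intro!: borel_measurable_times borel_measurable_inner\<close>)
    moreover have "(LINT x|lebesgue_on \<Omega>. \<phi> n x * partial i \<eta> x) = - (LINT x|lebesgue_on \<Omega>. (grad (\<phi> n) x \<bullet> i) * \<eta> x)" for n
      using is_weak_grad_test_fun[OF \<Omega>(1) \<phi>(1)[of n]] \<eta> i by (simp add: is_weak_grad_def)
    ultimately have "(\<lambda>n. - (LINT x|lebesgue_on \<Omega>. (grad (\<phi> n) x \<bullet> i) * \<eta> x)) \<longlonglongrightarrow> (LINT x|lebesgue_on \<Omega>. u x * partial i \<eta> x)"
      "(\<lambda>n. - (LINT x|lebesgue_on \<Omega>. (grad (\<phi> n) x \<bullet> i) * \<eta> x)) \<longlonglongrightarrow> - (LINT x|lebesgue_on \<Omega>. (G x \<bullet> i) * \<eta> x)"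
      by (auto intro: tendsto_minus)
    then show "(LINT x|lebesgue_on \<Omega>. u x * partial i \<eta> x) = - (LINT x|lebesgue_on \<Omega>. (G x \<bullet> i) * \<eta> x)"
      by (rule LIMSEQ_unique)
  qed
  have Lp1: "(\<lambda>n. LINT x|lebesgue_on \<Omega>. norm (\<phi> n x - u x) powr p) \<longlonglongrightarrow> 0"
    by (rule integral_powr_tendsto_0[OF p0 m(1) mu(1), where C = C]) (use \<phi>(2) bu lim in auto)
  have Lp2: "(\<lambda>n. LINT x|lebesgue_on \<Omega>. norm (grad (\<phi> n) x - G x) powr p) \<longlonglongrightarrow> 0"
    by (rule integral_powr_tendsto_0[where g = "\<lambda>n. grad (\<phi> n)", OF p0 m(2) mu(2), where C = C])
      (use \<phi>(3) bu lim in auto)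
  have "W1p_norm p \<Omega> (\<lambda>x. \<phi> n x - u x) = ((LINT x|lebesgue_on \<Omega>. norm (\<phi> n x - u x) powr p) +
      (LINT x|lebesgue_on \<Omega>. norm (grad (\<phi> n) x - G x) powr p)) powr (1 / p)" for n
    using p \<Omega>(1) wg m mu \<phi>(1) by (intro W1p_norm_eq is_weak_grad_diff is_weak_grad_test_fun) auto
  moreover have "(\<lambda>n. ((LINT x|lebesgue_on \<Omega>. norm (\<phi> n x - u x) powr p) +
      (LINT x|lebesgue_on \<Omega>. norm (grad (\<phi> n) x - G x) powr p)) powr (1 / p)) \<longlonglongrightarrow> (0 + 0) powr (1 / p)"
    using p by (intro tendsto_powr2 tendsto_add Lp1 Lp2 tendsto_const always_eventually allI add_nonneg_nonneg
        Bochner_Integration.integral_nonneg) auto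
  ultimately have "(\<lambda>n. W1p_norm p \<Omega> (\<lambda>x. \<phi> n x - u x)) \<longlonglongrightarrow> 0"
    using p by simp
  then show "u \<in> W01p p \<Omega>"
    unfolding W01p_def W1p_def using uLp GLp wg \<phi>(1) by blast
qed

section \<open>Approximation by test functions on an interval\<close>

lemma Ck_real_polynomial_function:
  fixes P :: "real \<Rightarrow> real"
  assumes "real_polynomial_function P"
  shows "Ck k P"
  using assms
proof (induction rule: real_polynomial_function.induct)
  case (linear f)
  have "f x = f 1 * x" for x
    using linear_scale[OF bounded_linear.linear[OF linear], of x 1] by simp
  then have "f = (\<lambda>x. f 1 * x)"
    by (rule ext)
  then show ?case
    using Ck_linear[of k "f 1" 0] by simp
qed (auto intro: Ck_add Ck_mult)

text \<open>\<open>h'\<close> is approximated by polynomials cut off near the endpoints; subtracting a small multiple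
  of a fixed bump restores mean zero, so that the primitives have compact support.\<close>

lemma smooth_approximation:
  fixes h h' :: "real \<Rightarrow> real"
  assumes ab: "\<alpha> < \<beta>"
    and h: "\<And>s. s \<in> {\<alpha>..\<beta>} \<Longrightarrow> (h has_real_derivative h' s) (at s within {\<alpha>..\<beta>})"
      "continuous_on {\<alpha>..\<beta>} h'" "h \<alpha> = 0" "h \<beta> = 0"
  obtains \<psi> C where "\<And>n::nat. \<psi> n \<in> test_fun {\<alpha><..<\<beta>}" "\<And>n s. \<bar>\<psi> n s\<bar> \<le> C"
    "\<And>n s. \<bar>partial 1 (\<psi> n) s\<bar> \<le> C"
    "\<And>s. s \<in> {\<alpha><..<\<beta>} \<Longrightarrow> (\<lambda>n. \<psi> n s) \<longlonglongrightarrow> h s"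
    "\<And>s. s \<in> {\<alpha><..<\<beta>} \<Longrightarrow> (\<lambda>n. partial 1 (\<psi> n) s) \<longlonglongrightarrow> h' s"
proof -
  have "\<exists>P. real_polynomial_function P \<and> (\<forall>s\<in>{\<alpha>..\<beta>}. \<bar>h' s - P s\<bar> < 1 / real (Suc n))" for n
    using Stone_Weierstrass_real_polynomial_function[of "{\<alpha>..\<beta>}" h' "1 / real (Suc n)"] h(2)
    by (metis compact_Icc of_nat_0_less_iff zero_less_Suc zero_less_divide_1_iff)
  then obtain P where P: "\<And>n. real_polynomial_function (P n)"
    "\<And>n s. s \<in> {\<alpha>..\<beta>} \<Longrightarrow> \<bar>h' s - P n s\<bar> < 1 / real (Suc n)"
    by metis
  \<comment> \<open>The shift by 1 makes the cut-off vanish within distance 1/n of either endpoint,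
    which later yields compact support.\<close>
  define \<zeta> where "\<zeta> n s = flat 0 (real n * (s - \<alpha>) - 1) * flat 0 (real n * (\<beta> - s) - 1)" for n s
  have Ck\<zeta>: "Ck k (\<zeta> n)" for k n
  proof -
    have eq: "real n * (s - \<alpha>) - 1 = real n * s + (- (real n * \<alpha>) - 1)"
      "real n * (\<beta> - s) - 1 = (- real n) * s + (real n * \<beta> - 1)" for s
      by (simp_all add: algebra_simps)
    show ?thesis
      unfolding \<zeta>_def[abs_def] eq by (intro Ck_mult[OF Ck_compose[OF Ck_flat Ck_linear] Ck_compose[OF Ck_flat Ck_linear]])
  qed
  have \<zeta>: "0 \<le> \<zeta> n s" "\<zeta> n s \<le> 1" for n s
    by (simp_all add: \<zeta>_def flat_0_bounds mult_le_one)
  have \<zeta>out: "\<zeta> n s = 0" if "s \<le> \<alpha> + 1 / real n \<or> s \<ge> \<beta> - 1 / real n \<or> n = 0" for n s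
    using that by (cases "n = 0") (auto simp: \<zeta>_def flat_0 field_simps)
  have \<zeta>lim: "(\<lambda>n. \<zeta> n s) \<longlonglongrightarrow> 1" if "s \<in> {\<alpha><..<\<beta>}" for s
    unfolding \<zeta>_def using tendsto_mult[OF flat_0_scaled_tendsto[of "s - \<alpha>" 1] flat_0_scaled_tendsto[of "\<beta> - s" 1]] that
    by simp
  have cont\<zeta>: "continuous_on S (\<zeta> n)" for S n
    using Ck\<zeta>[of 0 n] by (auto intro: continuous_on_subset)
  \<comment> \<open>One fixed cut-off, positive at the midpoint and so of non-zero integral, serves
    as the bump that corrects the mean.\<close>
  obtain N :: nat where N: "real N > 4 / (\<beta> - \<alpha>)"
    using reals_Archimedean2 by blast
  define m where "m = (\<alpha> + \<beta>) / 2"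
  have "\<zeta> N m > 0"
  proof -
    have "real N * ((\<beta> - \<alpha>) / 2) > 1"
      using N ab by (simp add: field_simps)
    moreover have mm: "m - \<alpha> = (\<beta> - \<alpha>) / 2" "\<beta> - m = (\<beta> - \<alpha>) / 2"
      by (simp_all add: m_def field_simps)
    ultimately have "real N * (m - \<alpha>) > 1" "real N * (\<beta> - m) > 1"
      by (simp_all only: mm)
    then show ?thesis
      by (simp add: \<zeta>_def flat_0)
  qed
  define k where "k = integral {\<alpha>..\<beta>} (\<zeta> N)"
  have "k \<noteq> 0"
    unfolding k_def using integral_eq_0_iff[OF cont\<zeta> ab \<zeta>(1)] \<open>\<zeta> N m > 0\<close> ab
    by (force simp: m_def)
  obtain B where B: "B > 0" "\<And>s. s \<in> {\<alpha>..\<beta>} \<Longrightarrow> \<bar>h' s\<bar> \<le> B"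
  proof -
    have "bounded (h' ` {\<alpha>..\<beta>})"
      using h(2) by (intro compact_imp_bounded compact_continuous_image) auto
    then show ?thesis using that by (auto simp: bounded_pos)
  qed
  define e where "e n s = P n s * \<zeta> n s" for n s
  have Cke: "Ck j (e n)" for j n
    unfolding e_def[abs_def] by (intro Ck_mult Ck\<zeta> Ck_real_polynomial_function P)
  have conte: "continuous_on S (e n)" for S n
    using Cke[of 0 n] by (auto intro: continuous_on_subset)
  have eb: "\<bar>e n s\<bar> \<le> B + 1" for n s
  proof (cases "s \<in> {\<alpha>..\<beta>}")
    case True
    have "1 / real (Suc n) \<le> 1" by simp
    then have "\<bar>P n s\<bar> \<le> B + 1"
      using P(2)[OF True, of n] B(2)[OF True] by linarith
    then show ?thesis
      unfolding e_def abs_mult using \<zeta>[of n s] mult_mono[of "\<bar>P n s\<bar>" "B + 1" "\<bar>\<zeta> n s\<bar>" 1] B(1) by auto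
  next
    case False
    then have "s \<le> \<alpha> + 1 / real n \<or> s \<ge> \<beta> - 1 / real n"
    proof -
      have "0 \<le> 1 / real n" by simp
      moreover have "s < \<alpha> \<or> \<beta> < s" using False by auto
      ultimately show ?thesis by linarith
    qed
    then have "\<zeta> n s = 0"
      using \<zeta>out[of s n] by blast
    then show ?thesis
      using B(1) by (simp add: e_def)
  qed
  have elim: "(\<lambda>n. e n s) \<longlonglongrightarrow> h' s" if s: "s \<in> {\<alpha><..<\<beta>}" for s
  proof -
    have "(\<lambda>n. h' s - P n s) \<longlonglongrightarrow> 0"
    proof (rule Lim_null_comparison)
      show "\<forall>\<^sub>F n in sequentially. norm (h' s - P n s) \<le> 1 / real (Suc n)"
        using P(2)[of s] s by (auto intro!: always_eventually less_imp_le)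
      show "(\<lambda>n. 1 / real (Suc n)) \<longlonglongrightarrow> 0"
        using LIMSEQ_inverse_real_of_nat by (simp add: inverse_eq_divide)
    qed
    from tendsto_diff[OF tendsto_const[of "h' s"] this] have "(\<lambda>n. P n s) \<longlonglongrightarrow> h' s"
      by simp
    from tendsto_mult[OF this \<zeta>lim[OF s]] show ?thesis
      by (simp add: e_def)
  qed
  have inte: "(\<lambda>n. integral {\<alpha>..s} (e n)) \<longlonglongrightarrow> h s" if s: "s \<in> {\<alpha>..\<beta>}" for s
  proof -
    have "(h' has_integral (h s - h \<alpha>)) {\<alpha>..s}"
      using h(1) s by (intro fundamental_theorem_of_calculus)
        (auto simp: has_real_derivative_iff_has_vector_derivative[symmetric] intro!: DERIV_subset[OF h(1)])
    then have "integral {\<alpha>..s} h' = h s"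
      using h(3) by (simp add: integral_unique)
    \<comment> \<open>The cut-offs vanish at the endpoints, so the pointwise limit there is 0
      instead of \<open>h'\<close>; two points do not affect the integral.\<close>
    moreover have "integral {\<alpha>..s} (\<lambda>s. if s \<in> {\<alpha><..<\<beta>} then h' s else 0) = integral {\<alpha>..s} h'"
      by (rule integral_spike[of "{\<alpha>, \<beta>}"]) (use s in auto)
    moreover have "(\<lambda>n. integral {\<alpha>..s} (e n)) \<longlonglongrightarrow> integral {\<alpha>..s} (\<lambda>s. if s \<in> {\<alpha><..<\<beta>} then h' s else 0)"
    proof (rule dominated_convergence(2)[where h = "\<lambda>_. B + 1"])
      show "(\<lambda>n. e n x) \<longlonglongrightarrow> (if x \<in> {\<alpha><..<\<beta>} then h' x else 0)" if "x \<in> {\<alpha>..s}" for x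
      proof (cases "x \<in> {\<alpha><..<\<beta>}")
        case False
        then have "x = \<alpha> \<or> x = \<beta>" using s that by auto
        then have "e n x = 0" for n
          using \<zeta>out[of x n] by (auto simp: e_def)
        then show ?thesis using False by auto
      qed (use elim in simp)
    qed (use eb conte in \<open>auto intro!: integrable_continuous_real\<close>)
    ultimately show ?thesis by simp
  qed
  define c where "c n = integral {\<alpha>..\<beta>} (e n)" for n
  have c0: "c \<longlonglongrightarrow> 0"
    using inte[of \<beta>] ab h(4) by (simp add: c_def[abs_def])
  \<comment> \<open>The coefficient makes the integral over the whole interval zero, and it tends to
    0 because the integrals \<open>c n\<close> converge to \<open>h \<beta>\<close>, which is
    0.\<close>
  define g where "g n s = e n s - c n / k * \<zeta> N s" for n s
  have Ckg: "Ck j (g n)" for j n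
    unfolding g_def[abs_def] by (intro Ck_diff Ck_mult Ck\<zeta> Cke Ck_const)
  have contg: "continuous_on S (g n)" for S n
    using Ckg[of 0 n] by (auto intro: continuous_on_subset)
  have glim: "(\<lambda>n. g n s) \<longlonglongrightarrow> h' s" if "s \<in> {\<alpha><..<\<beta>}" for s
    using tendsto_diff[OF elim[OF that] tendsto_mult_right[OF tendsto_divide[OF c0 tendsto_const[of k]], of "\<zeta> N s"]] \<open>k \<noteq> 0\<close>
    by (simp add: g_def)
  have "Bseq c"
    using c0 by (intro convergent_imp_Bseq convergentI)
  then obtain Bc where Bc: "Bc > 0" "\<And>n. \<bar>c n\<bar> \<le> Bc"
    by (auto simp: Bseq_def)
  define D where "D = B + 1 + Bc / \<bar>k\<bar>"
  have gb: "\<bar>g n s\<bar> \<le> D" for n s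
  proof -
    have "\<bar>c n / k\<bar> * \<bar>\<zeta> N s\<bar> \<le> Bc / \<bar>k\<bar> * 1"
      using Bc \<zeta>[of N s] by (intro mult_mono) (auto simp: divide_right_mono)
    then show ?thesis
      using eb[of n s] abs_triangle_ineq4[of "e n s" "c n / k * \<zeta> N s"] unfolding g_def D_def abs_mult by linarith
  qed
  have D0: "D > 0" using gb[of 0 0] B(1) Bc(1) by (simp add: D_def add_pos_nonneg)
  define \<psi> where "\<psi> n s = primitive (g n) s - primitive (g n) \<alpha>" for n s
  have \<psi>': "(\<psi> n has_real_derivative g n s) (at s)" for n s
    unfolding \<psi>_def using has_real_derivative_primitive[OF contg[of UNIV n], of s]
    by (auto intro!: derivative_eq_intros)
  have \<psi>part: "partial 1 (\<psi> n) s = g n s" for n s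
    by (rule partial_1_eq_DERIV[OF \<psi>'])
  have \<psi>\<alpha>: "\<psi> n \<alpha> = 0" for n by (simp add: \<psi>_def)
  have \<psi>int: "\<psi> n s = integral {\<alpha>..s} (e n) - c n / k * integral {\<alpha>..s} (\<zeta> N)" if "s \<ge> \<alpha>" for n s
  proof -
    have "(g n has_integral (\<psi> n s - \<psi> n \<alpha>)) {\<alpha>..s}"
      using \<psi>' that by (intro fundamental_theorem_of_calculus)
        (auto simp: has_real_derivative_iff_has_vector_derivative[symmetric] intro: has_field_derivative_at_within)
    then have "\<psi> n s = integral {\<alpha>..s} (g n)"
      by (simp add: integral_unique \<psi>\<alpha>)
    also have "\<dots> = integral {\<alpha>..s} (e n) - integral {\<alpha>..s} (\<lambda>s. c n / k * \<zeta> N s)"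
      unfolding g_def by (intro Henstock_Kurzweil_Integration.integral_diff integrable_continuous_real
          continuous_on_mult continuous_on_const conte cont\<zeta>)
    finally show ?thesis by simp
  qed
  have \<psi>\<beta>: "\<psi> n \<beta> = 0" for n
    using \<psi>int[of \<beta> n] ab \<open>k \<noteq> 0\<close> by (simp add: c_def k_def)
  have \<psi>lim: "(\<lambda>n. \<psi> n s) \<longlonglongrightarrow> h s" if s: "s \<in> {\<alpha><..<\<beta>}" for s
    using tendsto_diff[OF inte[of s] tendsto_mult_right[OF tendsto_divide[OF c0 tendsto_const[of k]], of "integral {\<alpha>..s} (\<zeta> N)"]]
      s \<open>k \<noteq> 0\<close> by (simp add: \<psi>int)
  have N0: "N > 0"
    using N ab by (cases N) auto
  \<comment> \<open>Near either endpoint \<open>g n\<close> vanishes, so its primitive is constant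
    there and equal to its endpoint value 0. The index 0 is treated separately because
    \<open>1 / real 0\<close> is 0; in that case \<open>\<zeta> 0\<close> vanishes
    everywhere.\<close>
  have \<psi>zero: "\<psi> n s = 0" if "s \<le> \<alpha> + \<delta> \<or> s \<ge> \<beta> - \<delta>" "\<delta> = (if n = 0 then 1 / N else min (1 / n) (1 / N))" for n s \<delta>
  proof -
    have \<delta>: "\<delta> > 0" using that(2) N0 by auto
    have g0: "g n s = 0" if "s \<le> \<alpha> + \<delta> \<or> s \<ge> \<beta> - \<delta>" for s
    proof -
      have "n = 0 \<or> \<delta> \<le> 1 / real n" "\<delta> \<le> 1 / real N"
        using \<open>\<delta> = _\<close> N0 by (auto split: if_splits)
      then have "s \<le> \<alpha> + 1 / real n \<or> s \<ge> \<beta> - 1 / real n \<or> n = 0"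
        "s \<le> \<alpha> + 1 / real N \<or> s \<ge> \<beta> - 1 / real N \<or> N = 0"
        using that by linarith+
      then have "\<zeta> n s = 0" "\<zeta> N s = 0"
        by (simp_all only: \<zeta>out)
      then show ?thesis by (simp add: g_def e_def)
    qed
    have const: "\<psi> n s = \<psi> n s'" if "convex S" "s \<in> S" "s' \<in> S" "\<And>x. x \<in> S \<Longrightarrow> x \<le> \<alpha> + \<delta> \<or> x \<ge> \<beta> - \<delta>" for S s s'
    proof -
      have "(\<psi> n has_real_derivative 0) (at x within S)" if "x \<in> S" for x
        using \<psi>'[of n x] g0[of x] \<open>\<And>x. x \<in> S \<Longrightarrow> _\<close>[OF that] by (auto intro: has_field_derivative_at_within)
      then show ?thesis
        using has_field_derivative_zero_constant[OF that(1), of "\<psi> n"] that(2,3) by metis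
    qed
    from that(1) show ?thesis
    proof
      assume "s \<le> \<alpha> + \<delta>"
      then show ?thesis
        using const[of "{..\<alpha> + \<delta>}" s \<alpha>] \<delta> \<psi>\<alpha> by simp
    next
      assume "s \<ge> \<beta> - \<delta>"
      then show ?thesis
        using const[of "{\<beta> - \<delta>..}" s \<beta>] \<delta> \<psi>\<beta> by simp
    qed
  qed
  have \<psi>out: "\<psi> n s = 0" if "s \<notin> {\<alpha>..\<beta>}" for n s
  proof (rule \<psi>zero[OF _ refl])
    have "(if n = 0 then 1 / real N else min (1 / real n) (1 / real N)) \<ge> 0" by simp
    then show "s \<le> \<alpha> + (if n = 0 then 1 / real N else min (1 / real n) (1 / real N)) \<or>
      s \<ge> \<beta> - (if n = 0 then 1 / real N else min (1 / real n) (1 / real N))"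
      using that by (smt (verit) atLeastAtMost_iff)
  qed
  show ?thesis
  proof (rule that[of \<psi> "max D (D * (\<beta> - \<alpha>))"])
    show "\<psi> n \<in> test_fun {\<alpha><..<\<beta>}" for n
    proof (rule test_funI)
      define \<delta> where "\<delta> = (if n = 0 then 1 / real N else min (1 / real n) (1 / real N))"
      have "\<delta> > 0" using N0 by (simp add: \<delta>_def)
      then show "{\<alpha> + \<delta>..\<beta> - \<delta>} \<subseteq> {\<alpha><..<\<beta>}" by auto
      show "\<psi> n s = 0" if "s \<notin> {\<alpha> + \<delta>..\<beta> - \<delta>}" for s
        using \<psi>zero[of s \<delta> n] that \<delta>_def by auto
      show "Ck j (\<psi> n)" for j
        using Ck_Suc_realI[OF \<psi>' Ckg] Ck_SucD by blast
    qed simp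
    show "\<bar>partial 1 (\<psi> n) s\<bar> \<le> max D (D * (\<beta> - \<alpha>))" for n s
      using gb[of n s] by (simp add: \<psi>part)
    show "\<bar>\<psi> n s\<bar> \<le> max D (D * (\<beta> - \<alpha>))" for n s
    proof (cases "s \<in> {\<alpha>..\<beta>}")
      case True
      have "\<bar>\<psi> n s - \<psi> n \<alpha>\<bar> \<le> D * \<bar>s - \<alpha>\<bar>"
        using field_differentiable_bound[of UNIV "\<psi> n" "g n" D s \<alpha>] \<psi>' gb by simp
      also have "\<dots> \<le> D * (\<beta> - \<alpha>)"
        using True D0 by (intro mult_left_mono) auto
      finally show ?thesis by (simp add: \<psi>\<alpha>)
    next
      case False
      then show ?thesis using \<psi>out D0 by simp
    qed
  qed (use \<psi>lim glim \<psi>part in simp_all)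
qed

text \<open>Polar coordinates for radial functions: the density is the area of the sphere of radius
  \<open>r\<close>. Both measures are finite and are compared on rays, by the volumes of balls on
  one side and the fundamental theorem of calculus on the other.\<close>

lemma distr_norm_ball:
  assumes b: "b > 0"
  shows "distr (restrict_space lborel (ball (0::'a::euclidean_space) b)) borel norm =
    density lborel (\<lambda>r. ennreal (indicator {0..b} r * (unit_ball_vol DIM('a) * (real DIM('a) * r ^ (DIM('a) - 1)))))"
    (is "?M = density lborel (\<lambda>r. ennreal (?d r))")
proof (rule measure_eqI_lessThan)
  define N where "N = DIM('a)"
  define \<omega> where "\<omega> = unit_ball_vol (real N)"
  have N: "N > 0" and \<omega>: "\<omega> \<ge> 0"
    by (simp_all add: N_def \<omega>_def)
  have M: "emeasure ?M {x<..} = ennreal (\<omega> * b ^ N - \<omega> * (min b (max 0 x)) ^ N)" for x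
  proof -
    define y where "y = min b (max 0 x)"
    have "emeasure ?M {x<..} = emeasure (restrict_space lborel (ball (0::'a) b)) (norm -` {x<..} \<inter> ball 0 b)"
      by (subst emeasure_distr) (auto simp: space_restrict_space intro!: measurable_restrict_space1)
    also have "\<dots> = emeasure lborel (norm -` {x<..} \<inter> ball (0::'a) b)"
      by (rule emeasure_restrict_space) auto
    also have "\<dots> = ennreal (\<omega> * b ^ N - \<omega> * y ^ N)"
    proof -
      consider "x < 0" | "0 \<le> x" "x < b" | "b \<le> x" by linarith
      then show ?thesis
      proof cases
        case 1
        then have "norm -` {x<..} \<inter> ball (0::'a) b = ball 0 b"
          by (auto intro: less_le_trans[OF _ norm_ge_zero])
        then show ?thesis
          using 1 b N by (simp add: emeasure_ball y_def N_def \<omega>_def)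
      next
        case 2
        then have "norm -` {x<..} \<inter> ball (0::'a) b = ball 0 b - cball 0 x"
          by auto
        moreover have "emeasure lborel (ball (0::'a) b - cball 0 x) =
            emeasure lborel (ball (0::'a) b) - emeasure lborel (cball (0::'a) x)"
          by (rule emeasure_Diff) (use 2 in \<open>auto simp: emeasure_cball\<close>)
        ultimately show ?thesis
          using 2 b \<omega> by (simp add: emeasure_ball emeasure_cball y_def N_def \<omega>_def ennreal_minus)
      next
        case 3
        then have "norm -` {x<..} \<inter> ball (0::'a) b = {}"
          by auto
        then show ?thesis
          using 3 b by (simp add: y_def)
      qed
    qed
    finally show ?thesis by (simp add: y_def)
  qed
  show "emeasure ?M {x<..} = emeasure (density lborel (\<lambda>r. ennreal (?d r))) {x<..}" for x
  proof -
    define y where "y = min b (max 0 x)"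
    have y: "0 \<le> y" "y \<le> b"
      using b by (auto simp: y_def)
    have "emeasure (density lborel (\<lambda>r. ennreal (?d r))) {x<..} = (\<integral>\<^sup>+r. ennreal (?d r) * indicator {x<..} r \<partial>lborel)"
      by (rule emeasure_density) auto
    also have "\<dots> = (\<integral>\<^sup>+r. ennreal (\<omega> * (real N * r ^ (N - 1))) * indicator {y..b} r \<partial>lborel)"
    proof (rule nn_integral_cong_AE)
      have "AE r in lborel. r \<noteq> y" "AE r in lborel. r \<noteq> b" "AE r in lborel. r \<noteq> 0"
        by (rule AE_lborel_singleton)+
      then show "AE r in lborel. ennreal (?d r) * indicator {x<..} r = ennreal (\<omega> * (real N * r ^ (N - 1))) * indicator {y..b} r"
        by eventually_elim (auto simp: indicator_def y_def N_def \<omega>_def)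
    qed
    also have "\<dots> = ennreal (\<omega> * b ^ N - \<omega> * y ^ N)"
    proof (rule nn_integral_FTC_Icc)
      show "((\<lambda>r. \<omega> * r ^ N) has_real_derivative \<omega> * (real N * r ^ (N - 1))) (at r)" for r
        by (auto intro!: derivative_eq_intros)
    qed (use y \<omega> in auto)
    finally show ?thesis
      unfolding M y_def ..
  qed
  show "emeasure ?M {x<..} < \<infinity>" for x
    by (simp add: M)
qed auto

text \<open>In the shell the area factor is smallest at the inner radius. A lower bound of this kind
  is what transfers largeness of the one-dimensional profile to the annulus.\<close>

lemma radial_integral_lower:
  fixes g :: "real \<Rightarrow> real"
  assumes ab: "0 < a" "a < b" and g: "g \<in> borel_measurable borel" "\<And>r. 0 \<le> g r" "\<And>r. g r \<le> C"
    "\<And>r. r \<notin> {a<..<b} \<Longrightarrow> g r = 0"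
  shows "(LINT x|lebesgue_on {x::'a::euclidean_space. a < norm x \<and> norm x < b}. g (norm x)) \<ge>
    unit_ball_vol DIM('a) * (real DIM('a) * a ^ (DIM('a) - 1)) * integral\<^sup>L lborel g"
proof -
  let ?\<Omega> = "{x::'a. a < norm x \<and> norm x < b}" and ?B = "ball (0::'a) b"
  define d where "d r = unit_ball_vol (real DIM('a)) * (real DIM('a) * r ^ (DIM('a) - 1))" for r :: real
  have "open ?\<Omega>"
    by (intro open_Collect_conj open_Collect_less continuous_intros)
  then have meas: "?\<Omega> \<in> sets lebesgue" by auto
  have [measurable]: "norm \<in> borel_measurable (restrict_space lborel ?B)"
    by (intro measurable_restrict_space1) auto
  note [measurable] = g(1)
  have "(LINT x|lebesgue_on ?\<Omega>. g (norm x)) = (LINT x|lebesgue. (if x \<in> ?\<Omega> then g (norm x) else 0))"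
    by (rule Lebesgue_Measure.integral_restrict_UNIV[OF meas, symmetric])
  also have "(\<lambda>x. if x \<in> ?\<Omega> then g (norm x) else 0) = (\<lambda>x::'a. indicator ?B x *\<^sub>R g (norm x))"
    using g(4) by (fastforce simp: indicator_def)
  also have "integral\<^sup>L lebesgue \<dots> = integral\<^sup>L lborel \<dots>"
    by (intro integral_completion borel_measurable_scaleR borel_measurable_indicator
        measurable_compose[OF _ g(1)]) auto
  also have "\<dots> = (LINT x|restrict_space lborel ?B. g (norm x))"
    by (rule integral_restrict_space[symmetric]) auto
  also have "\<dots> = integral\<^sup>L (distr (restrict_space lborel ?B) borel norm) g"
    by (rule integral_distr[symmetric]) measurable
  also have "\<dots> = (LINT r|lborel. (indicator {0..b} r * d r) *\<^sub>R g r)"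
    unfolding distr_norm_ball[OF less_trans[OF ab]] d_def
    by (rule integral_density) (auto intro!: AE_I2 simp: indicator_def)
  also have "\<dots> = (LINT r|lborel. d r * g r)"
  proof (rule Bochner_Integration.integral_cong[OF refl])
    show "(indicator {0..b} r * d r) *\<^sub>R g r = d r * g r" for r
      using ab g(4)[of r] by (cases "r \<in> {a<..<b}") auto
  qed
  finally have eq: "(LINT x|lebesgue_on ?\<Omega>. g (norm x)) = (LINT r|lborel. d r * g r)" .
  have bnd: "integrable lborel (\<lambda>r. indicator {a..b} r *\<^sub>R K)" for K :: real
    by (intro borel_integrable_compact continuous_on_const) auto
  have d_le: "d r \<le> d b" "d a \<le> d r" "0 \<le> d r" if "r \<in> {a<..<b}" for r
    using that ab by (auto simp: d_def intro!: mult_left_mono power_mono)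
  have C: "0 \<le> C" using g(2,3) order_trans by blast
  have "(LINT r|lborel. d a * g r) \<le> (LINT r|lborel. d r * g r)"
  proof (rule integral_mono)
    show "integrable lborel (\<lambda>r. d a * g r)"
      by (rule Bochner_Integration.integrable_bound[OF bnd[of "\<bar>d a\<bar> * C"]])
        (use g C in \<open>auto intro!: AE_I2 mult_left_mono simp: indicator_def abs_mult\<close>)
    show "integrable lborel (\<lambda>r. d r * g r)"
    proof (rule Bochner_Integration.integrable_bound[OF bnd[of "d b * C"]])
      show "AE r in lborel. norm (d r * g r) \<le> norm (indicator {a..b} r *\<^sub>R (d b * C))"
      proof (rule AE_I2)
        fix r
        show "norm (d r * g r) \<le> norm (indicator {a..b} r *\<^sub>R (d b * C))"
          using d_le[of r] g(2,3,4)[of r] C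
          by (cases "r \<in> {a<..<b}") (auto simp: abs_mult intro!: mult_mono)
      qed
      show "(\<lambda>r. d r * g r) \<in> borel_measurable lborel"
        unfolding d_def by measurable
    qed
    show "d a * g r \<le> d r * g r" for r
      using d_le(2)[of r] g(2,4)[of r] by (cases "r \<in> {a<..<b}") (auto intro: mult_right_mono)
  qed
  then show ?thesis
    unfolding eq d_def by simp
qed

section \<open>Weak solutions\<close>

text \<open>If one function fails to be measurable, so does the other, and both integrals take the
  default value 0.\<close>

lemma integral_cong_AE_lebesgue_on:
  fixes f g :: "'a::euclidean_space \<Rightarrow> 'b::euclidean_space"
  assumes "\<Omega> \<in> sets lebesgue" "AE x in lebesgue_on \<Omega>. f x = g x"
  shows "integral\<^sup>L (lebesgue_on \<Omega>) f = integral\<^sup>L (lebesgue_on \<Omega>) g"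
proof (cases "f \<in> borel_measurable (lebesgue_on \<Omega>)")
  case True
  then have "g \<in> borel_measurable (lebesgue_on \<Omega>)"
    using measurable_lebesgue_on_AE_cong assms by blast
  with True assms(2) show ?thesis
    by (intro Bochner_Integration.integral_cong_AE)
next
  case False
  have "AE x in lebesgue_on \<Omega>. g x = f x"
    using assms(2) by eventually_elim simp
  then have "g \<notin> borel_measurable (lebesgue_on \<Omega>)"
    using measurable_lebesgue_on_AE_cong[OF assms(1), of g f] False by blast
  with False have "\<not> integrable (lebesgue_on \<Omega>) f" "\<not> integrable (lebesgue_on \<Omega>) g"
    by (auto dest: borel_measurable_integrable)
  then show ?thesis
    by (simp add: not_integrable_integral_eq)
qed

lemma W01p_norm_eq:
  assumes "open \<Omega>" "is_weak_grad \<Omega> u G" "G \<in> Lp p \<Omega>"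
  shows "W01p_norm p \<Omega> u = (LINT x|lebesgue_on \<Omega>. norm (G x) powr p) powr (1 / p)"
  unfolding W01p_norm_def Lp_norm_def
  using weak_grad_norm_integral[OF assms(1,2)] assms(3) by (simp add: Lp_def)

lemma W01p_norm_nonneg: "0 \<le> W01p_norm p \<Omega> u"
  by (simp add: W01p_norm_def Lp_norm_def)

text \<open>The comparison of L^1 with p-th powers for \<open>e = 1\<close>. The crude form suffices
  because large L^1 norms of the gradient still force large Sobolev norms.\<close>

lemma W01p_norm_lower:
  assumes \<Omega>: "open \<Omega>" "\<Omega> \<in> lmeasurable" and p: "p \<ge> 1" and G: "is_weak_grad \<Omega> u G" "G \<in> Lp p \<Omega>"
  shows "(LINT x|lebesgue_on \<Omega>. norm (G x)) \<le> measure lebesgue \<Omega> + W01p_norm p \<Omega> u powr p"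
proof -
  interpret finite_measure "lebesgue_on \<Omega>"
    using \<Omega>(2) by (rule finite_measure_lebesgue_on)
  have "0 \<le> (LINT x|lebesgue_on \<Omega>. norm (G x) powr p)"
    by (rule Bochner_Integration.integral_nonneg) simp
  then have "W01p_norm p \<Omega> u powr p = (LINT x|lebesgue_on \<Omega>. norm (G x) powr p)"
    using p by (simp add: W01p_norm_eq[OF \<Omega>(1) G] powr_powr)
  moreover have "measure (lebesgue_on \<Omega>) (space (lebesgue_on \<Omega>)) = measure lebesgue \<Omega>"
    using \<Omega>(2) by (simp add: measure_restrict_space fmeasurableD)
  ultimately show ?thesis
    using integral_norm_le_powr[of p G 1] p G(2) by (simp add: Lp_def)
qed

text \<open>\<open>V\<close> is the nonlinear flux of \<open>u\<close>. Integrating its components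
  by parts against test functions gives the weak equation, and density extends it to all admissible
  \<open>w\<close>. It serves the interval and the annulus alike.\<close>

lemma weak_solution_if_divergence:
  fixes G V :: "'a::euclidean_space \<Rightarrow> 'a"
  assumes p: "p > 1" and \<Omega>: "open \<Omega>" "\<Omega> \<in> lmeasurable"
    and G: "is_weak_grad \<Omega> u G"
    and V: "continuous_on \<Omega> V" "\<And>x. x \<in> \<Omega> \<Longrightarrow> norm (V x) \<le> C"
      "\<And>x. x \<in> \<Omega> \<Longrightarrow> norm (G x) powr (p - 2) *\<^sub>R G x = V x"
    and dV: "\<And>x i. x \<in> \<Omega> \<Longrightarrow> i \<in> Basis \<Longrightarrow> (\<lambda>x. V x \<bullet> i) differentiable at x"
      "\<And>i. i \<in> Basis \<Longrightarrow> continuous_on \<Omega> (partial i (\<lambda>x. V x \<bullet> i))"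
      "\<And>x. x \<in> \<Omega> \<Longrightarrow> (\<Sum>i\<in>Basis. partial i (\<lambda>x. V x \<bullet> i) x) = - h x"
    and h: "continuous_on \<Omega> h" "\<And>x. x \<in> \<Omega> \<Longrightarrow> \<bar>h x\<bar> \<le> C"
    and w: "w \<in> W01p p \<Omega>"
  shows "integrable (lebesgue_on \<Omega>) (\<lambda>x. h x * w x)"
    "(LINT x|lebesgue_on \<Omega>. norm (weak_grad \<Omega> u x) powr (p - 2) * (weak_grad \<Omega> u x \<bullet> weak_grad \<Omega> w x))
      = (LINT x|lebesgue_on \<Omega>. h x * w x)"
proof -
  have id: "(LINT x|lebesgue_on \<Omega>. V x \<bullet> grad \<phi> x) = (LINT x|lebesgue_on \<Omega>. h x * \<phi> x)"
    if \<phi>: "\<phi> \<in> test_fun \<Omega>" for \<phi>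
  proof -
    have loc1: "loc_integrable \<Omega> (\<lambda>x. V x \<bullet> i)" for i
      by (intro loc_integrable_cont continuous_intros V)
    have loc2: "loc_integrable \<Omega> (partial i (\<lambda>x. V x \<bullet> i))" if "i \<in> Basis" for i
      by (intro loc_integrable_cont dV that)
    have "(LINT x|lebesgue_on \<Omega>. V x \<bullet> grad \<phi> x) = (LINT x|lebesgue_on \<Omega>. (\<Sum>i\<in>Basis. (V x \<bullet> i) * partial i \<phi> x))"
      by (intro Bochner_Integration.integral_cong refl) (simp add: grad_def inner_sum_right mult.commute)
    also have "\<dots> = (\<Sum>i\<in>Basis. LINT x|lebesgue_on \<Omega>. (V x \<bullet> i) * partial i \<phi> x)"
      by (intro Bochner_Integration.integral_sum integrable_test_fun(2)[OF \<Omega>(1) \<phi> loc1])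
    also have "\<dots> = (\<Sum>i\<in>Basis. - (LINT x|lebesgue_on \<Omega>. partial i (\<lambda>x. V x \<bullet> i) x * \<phi> x))"
      by (intro sum.cong refl integration_by_parts \<Omega>(1) \<phi> dV)
    also have "\<dots> = - (LINT x|lebesgue_on \<Omega>. (\<Sum>i\<in>Basis. partial i (\<lambda>x. V x \<bullet> i) x * \<phi> x))"
      unfolding sum_negf
      by (subst Bochner_Integration.integral_sum) (auto intro!: integrable_test_fun(1)[OF \<Omega>(1) \<phi> loc2])
    also have "(LINT x|lebesgue_on \<Omega>. (\<Sum>i\<in>Basis. partial i (\<lambda>x. V x \<bullet> i) x * \<phi> x)) = (LINT x|lebesgue_on \<Omega>. - (h x * \<phi> x))"
      by (intro Bochner_Integration.integral_cong refl) (simp add: sum_distrib_right[symmetric] dV(3))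
    finally show ?thesis by simp
  qed
  note * = W01p_weak_identity[OF p \<Omega> w measurable_cont[OF \<Omega>(1) V(1)] V(2) measurable_cont[OF \<Omega>(1) h(1)] h(2) id]
  show "integrable (lebesgue_on \<Omega>) (\<lambda>x. h x * w x)"
    using *(1) by simp
  have sets: "\<Omega> \<in> sets lebesgue"
    using \<Omega>(2) by (rule fmeasurableD)
  have "AE x in lebesgue_on \<Omega>. weak_grad \<Omega> u x = G x"
    by (rule weak_grad_AE_eq[OF \<Omega>(1) G])
  moreover have "AE x in lebesgue_on \<Omega>. x \<in> \<Omega>"
    by (rule AE_I2) simp
  ultimately have "AE x in lebesgue_on \<Omega>. norm (weak_grad \<Omega> u x) powr (p - 2) * (weak_grad \<Omega> u x \<bullet> weak_grad \<Omega> w x)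
      = V x \<bullet> weak_grad \<Omega> w x"
    by eventually_elim (simp add: V(3)[symmetric])
  then have "(LINT x|lebesgue_on \<Omega>. norm (weak_grad \<Omega> u x) powr (p - 2) * (weak_grad \<Omega> u x \<bullet> weak_grad \<Omega> w x))
      = (LINT x|lebesgue_on \<Omega>. V x \<bullet> weak_grad \<Omega> w x)"
    by (rule integral_cong_AE_lebesgue_on[OF sets])
  then show "(LINT x|lebesgue_on \<Omega>. norm (weak_grad \<Omega> u x) powr (p - 2) * (weak_grad \<Omega> u x \<bullet> weak_grad \<Omega> w x))
      = (LINT x|lebesgue_on \<Omega>. h x * w x)"
    using *(2) by simp
qed

lemma bvp_solutionD:
  assumes "bvp_solution p q f v P"
  shows "v 0 = 0" "v 1 = 0" "\<And>t. t \<in> {0..1} \<Longrightarrow> 0 \<le> v t"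
    "\<And>t. t \<in> {0..1} \<Longrightarrow> (v has_real_derivative spow (1 / (p - 1)) (P t)) (at t within {0..1})"
    "\<And>t. t \<in> {0..1} \<Longrightarrow> (P has_real_derivative - (q t * f (v t))) (at t within {0..1})"
    "continuous_on {0..1} v" "continuous_on {0..1} P"
  using assms unfolding bvp_solution_def continuous_on_eq_continuous_within
  by (auto dest: DERIV_continuous)

text \<open>In dimension one the flux \<open>P\<close> is itself the C^1 field whose divergence is
  prescribed. For the bound, \<open>v\<close> is at most the integral of |v'|, and the summand 1 is
  the length of the interval.\<close>

lemma bvp_solution_weak:
  assumes p: "p > 1" and f: "continuous_on UNIV f" and q: "continuous_on {0..1} q"
    and sol: "bvp_solution p q f v P"
  shows "ode_weak_solution p q f v"
    and "t \<in> {0..1} \<Longrightarrow> v t \<le> 1 + W01p_norm p {0<..<1} v powr p"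
proof -
  let ?I = "{0<..<1::real}"
  note v = bvp_solutionD[OF sol]
  define G where "G t = spow (1 / (p - 1)) (P t)" for t
  have r: "1 / (p - 1) > 0" using p by simp
  have contG: "continuous_on {0..1} G"
    unfolding G_def by (intro continuous_on_spow[OF r] v)
  have \<Omega>: "open ?I" "?I \<in> lmeasurable"
    by (auto intro: bounded_set_imp_lmeasurable)
  have at: "at t within {0..1} = at t" if "t \<in> ?I" for t
    using that by (intro at_within_Icc_at) auto
  obtain \<psi> C where \<psi>: "\<And>n::nat. \<psi> n \<in> test_fun ?I" "\<And>n s. \<bar>\<psi> n s\<bar> \<le> C"
    "\<And>n s. \<bar>partial 1 (\<psi> n) s\<bar> \<le> C"
    "\<And>s. s \<in> ?I \<Longrightarrow> (\<lambda>n. \<psi> n s) \<longlonglongrightarrow> v s"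
    "\<And>s. s \<in> ?I \<Longrightarrow> (\<lambda>n. partial 1 (\<psi> n) s) \<longlonglongrightarrow> G s"
  proof (rule smooth_approximation[of 0 1 v G])
    show "(v has_real_derivative G s) (at s within {0..1})" if "s \<in> {0..1}" for s
      using v(4)[OF that] by (simp add: G_def)
  qed (rule zero_less_one contG v(1) v(2) that; assumption?)+
  have W: "v \<in> W01p p ?I" "is_weak_grad ?I v G" "G \<in> Lp p ?I"
    using W01p_bounded_limit[where \<phi> = \<psi> and u = v and G = G, OF p \<Omega> \<psi>(1) \<psi>(2)] \<psi>(3-5) by (simp_all add: grad_def)
  have contqf: "continuous_on {0..1} (\<lambda>t. q t * f (v t))"
    by (intro continuous_intros q v continuous_on_compose2[OF f]) auto
  obtain C1 where C1: "\<And>t. t \<in> {0..1} \<Longrightarrow> \<bar>q t * f (v t)\<bar> \<le> C1"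
    using bounded_image_01[OF contqf] by blast
  obtain C2 where C2: "\<And>t. t \<in> {0..1} \<Longrightarrow> \<bar>P t\<bar> \<le> C2"
    using bounded_image_01[OF v(7)] by blast
  have P': "(P has_real_derivative - (q t * f (v t))) (at t)" if "t \<in> ?I" for t
    using v(5)[of t] at[OF that] that by auto
  have part: "partial 1 P t = - (q t * f (v t))" if "t \<in> ?I" for t
    by (rule partial_1_eq_DERIV[OF P'[OF that]])
  show "ode_weak_solution p q f v"
    unfolding ode_weak_solution_def Let_def
  proof (intro conjI ballI W)
    fix w assume w: "w \<in> W01p p ?I"
    have "(LINT x|lebesgue_on ?I. norm (weak_grad ?I v x) powr (p - 2) * (weak_grad ?I v x \<bullet> weak_grad ?I w x))
      = (LINT x|lebesgue_on ?I. (q x * f (v x)) * w x)"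
    proof (rule weak_solution_if_divergence(2)[OF p \<Omega> W(2), where V = P and C = "max C1 C2"])
      show "continuous_on ?I P" "continuous_on ?I (\<lambda>x. q x * f (v x))"
        by (rule continuous_on_subset[OF v(7)] continuous_on_subset[OF contqf], force)+
      show "norm (G x) powr (p - 2) *\<^sub>R G x = P x" for x
        using p by (simp add: abs_powr_mult_eq_spow G_def spow_spow)
      show "(\<lambda>x. P x \<bullet> i) differentiable at x" if "x \<in> ?I" "i \<in> Basis" for x i
        using P'[OF that(1)] that(2) by (auto simp: real_differentiable_def)
      show "continuous_on ?I (partial i (\<lambda>x. P x \<bullet> i))" if "i \<in> Basis" for i
      proof -
        have "continuous_on ?I (\<lambda>t. - (q t * f (v t)))"
          by (rule continuous_on_minus[OF continuous_on_subset[OF contqf]]) auto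
        then have "continuous_on ?I (partial 1 P)"
          by (rule continuous_on_eq) (simp add: part)
        with that show ?thesis by simp
      qed
      show "(\<Sum>i\<in>Basis. partial i (\<lambda>x. P x \<bullet> i) x) = - (q x * f (v x))" if "x \<in> ?I" for x
        using part[OF that] by simp
      show "norm (P x) \<le> max C1 C2" "\<bar>q x * f (v x)\<bar> \<le> max C1 C2" if "x \<in> ?I" for x
        using C1[of x] C2[of x] that by auto
    qed (rule w)
    then show "(LINT t|lebesgue_on ?I. \<bar>weak_grad ?I v t\<bar> powr (p - 2) * weak_grad ?I v t * weak_grad ?I w t)
        - (LINT t|lebesgue_on ?I. q t * f (v t) * w t) = 0"
      by (simp add: mult.assoc)
  qed
  assume t: "t \<in> {0..1}"
  have intG: "(\<lambda>s. \<bar>G s\<bar>) integrable_on {a..b}" "G integrable_on {a..b}" if "0 \<le> a" "b \<le> 1" for a b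
    by (intro integrable_continuous_real continuous_on_rabs continuous_on_subset[OF contG]; use that in auto)+
  have "(G has_integral (v t - v 0)) {0..t}"
    using t v(4) by (intro fundamental_theorem_of_calculus)
      (auto simp: has_real_derivative_iff_has_vector_derivative[symmetric] G_def intro!: DERIV_subset[OF v(4)])
  then have "v t = integral {0..t} G"
    by (simp add: integral_unique v(1))
  also have "\<dots> \<le> integral {0..t} (\<lambda>s. \<bar>G s\<bar>)"
    using t by (intro integral_le intG) auto
  also have "\<dots> \<le> integral {0..1} (\<lambda>s. \<bar>G s\<bar>)"
    using t by (intro integral_subset_le intG) auto
  also have "\<dots> = integral ?I (\<lambda>s. \<bar>G s\<bar>)"
    by (simp add: integral_open_interval_real)
  also have "\<dots> = (LINT s|lebesgue_on ?I. norm (G s))"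
    using Lp_imp_integrable[OF \<Omega>(2) _ W(3)] p \<Omega>
    by (subst lebesgue_integral_eq_integral) (auto intro: fmeasurableD)
  also have "\<dots> \<le> measure lebesgue ?I + W01p_norm p ?I v powr p"
    using p by (intro W01p_norm_lower \<Omega> W) auto
  finally show "v t \<le> 1 + W01p_norm p ?I v powr p"
    by simp
qed

section \<open>Radial solutions in the annulus\<close>

lemma has_real_derivative_imp_norm_compose:
  fixes x :: "'a::euclidean_space"
  assumes "(k has_real_derivative k') (at (norm x))" "x \<noteq> 0"
  shows "((\<lambda>x. k (norm x)) has_derivative (\<lambda>h. k' * (h \<bullet> x / norm x))) (at x)"
proof -
  have "(norm has_derivative (\<lambda>h. h \<bullet> sgn x)) (at x)"
    using assms(2) by (rule has_derivative_norm)
  from has_derivative_compose[OF this assms(1)[unfolded has_field_derivative_def]]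
  show ?thesis
    by (simp add: sgn_div_norm divide_inverse mult.commute)
qed

text \<open>Summing the partial derivatives over the basis gives the divergence r k'(r) + N k(r) of
  the field k(|x|) x, where N is the dimension.\<close>

lemma radial_field_partial:
  fixes x :: "'a::euclidean_space"
  assumes "(k has_real_derivative k') (at (norm x))" "x \<noteq> 0"
  shows "(\<lambda>x. (k (norm x) *\<^sub>R x) \<bullet> i) differentiable at x"
    "i \<in> Basis \<Longrightarrow> partial i (\<lambda>x. (k (norm x) *\<^sub>R x) \<bullet> i) x = k' * (x \<bullet> i)\<^sup>2 / norm x + k (norm x)"
proof -
  have D: "((\<lambda>x. (k (norm x) *\<^sub>R x) \<bullet> i) has_derivative
      (\<lambda>h. k (norm x) * (h \<bullet> i) + k' * (h \<bullet> x / norm x) * (x \<bullet> i))) (at x)"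
    by (auto intro!: derivative_eq_intros has_real_derivative_imp_norm_compose[OF assms])
  then show "(\<lambda>x. (k (norm x) *\<^sub>R x) \<bullet> i) differentiable at x"
    by (auto simp: differentiable_def)
  show "partial i (\<lambda>x. (k (norm x) *\<^sub>R x) \<bullet> i) x = k' * (x \<bullet> i)\<^sup>2 / norm x + k (norm x)" if "i \<in> Basis"
    using partial_eqI[OF D, of i] that by (simp add: power2_eq_square inner_commute)
qed

text \<open>\<open>\<tau>\<close> maps the radius to the one-dimensional variable; the two equations for its derivative are
  what turns the radial \<open>p\<close>-Laplacian into the one-dimensional operator with weight \<open>q\<close>.\<close>

locale radial_change =
  fixes p \<kappa> a b :: real and q \<tau> \<tau>' :: "real \<Rightarrow> real" and dim :: "'a::euclidean_space itself"
  assumes p: "p > 1" and ab: "0 < a" "a < b"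
    and \<tau>: "\<And>r. r > 0 \<Longrightarrow> (\<tau> has_real_derivative \<tau>' r) (at r)" "\<And>r. r > 0 \<Longrightarrow> \<tau>' r > 0"
      "continuous_on {0<..} \<tau>'" "\<tau> a = 0" "\<tau> b = 1"
    and \<tau>'\<kappa>: "\<And>r. r > 0 \<Longrightarrow> \<tau>' r powr (p - 1) = \<kappa> / r ^ (DIM('a) - 1)"
    and \<tau>'q: "\<And>r. r \<in> {a..b} \<Longrightarrow> q (\<tau> r) * \<tau>' r powr p = 1"
begin

definition ann :: "'a set" where "ann = {x. a < norm x \<and> norm x < b}"

lemma open_ann: "open ann"
  unfolding ann_def by (intro open_Collect_conj open_Collect_less continuous_intros)

lemma ann_lmeasurable: "ann \<in> lmeasurable"
proof (rule bounded_set_imp_lmeasurable)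
  show "bounded ann"
    by (rule bounded_subset[OF bounded_cball[of 0 b]]) (auto simp: ann_def)
qed (use open_ann in auto)

lemma \<tau>_strict_mono: "0 < r \<Longrightarrow> r < s \<Longrightarrow> \<tau> r < \<tau> s"
proof (rule DERIV_pos_imp_increasing[where f = \<tau>])
  show "\<exists>y. (\<tau> has_real_derivative y) (at x) \<and> 0 < y" if "0 < r" "r \<le> x" for x
    using \<tau>(1,2)[of x] that by (intro exI[of _ "\<tau>' x"]) auto
qed

lemma \<tau>_01: "r \<in> {a..b} \<Longrightarrow> \<tau> r \<in> {0..1}"
  using \<tau>_strict_mono[of a r] \<tau>_strict_mono[of r b] \<tau>(4,5) ab by (cases "r = a"; cases "r = b"; force)

lemma \<tau>_01_strict: "a < r \<Longrightarrow> r < b \<Longrightarrow> 0 < \<tau> r \<and> \<tau> r < 1"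
  using \<tau>_strict_mono[of a r] \<tau>_strict_mono[of r b] \<tau>(4,5) ab by auto

lemma continuous_on_\<tau>: "continuous_on {a..b} \<tau>"
  using ab by (intro continuous_at_imp_continuous_on) (auto intro!: DERIV_isCont[OF \<tau>(1)])

lemma continuous_on_\<tau>': "continuous_on {a..b} \<tau>'"
  by (rule continuous_on_subset[OF \<tau>(3)]) (use ab in auto)

lemma \<tau>_surj:
  assumes "t \<in> {0..1}"
  obtains r where "r \<in> {a..b}" "\<tau> r = t"
  using IVT'[of \<tau> a t b] assms \<tau>(4,5) ab continuous_on_\<tau> by auto

context
  fixes f v P :: "real \<Rightarrow> real"
  assumes f: "continuous_on UNIV f" and q: "continuous_on {0..1} q"
    and sol: "bvp_solution p q f v P"
begin

lemmas v = bvp_solutionD[OF sol]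

abbreviation "slope r \<equiv> spow (1 / (p - 1)) (P (\<tau> r)) * \<tau>' r"

lemma v_\<tau>_deriv:
  assumes "r \<in> {a..b}"
  shows "((\<lambda>r. v (\<tau> r)) has_real_derivative slope r) (at r within {a..b})"
proof -
  have "(\<tau> has_real_derivative \<tau>' r) (at r within {a..b})"
    using \<tau>(1)[of r] assms ab by (auto intro: has_field_derivative_at_within)
  moreover have "(v has_real_derivative spow (1 / (p - 1)) (P (\<tau> r))) (at (\<tau> r) within \<tau> ` {a..b})"
    by (rule DERIV_subset[OF v(4)]) (use \<tau>_01 assms in auto)
  ultimately show ?thesis
    using DERIV_image_chain[of v _ \<tau> r "{a..b}"] by (simp add: o_def)
qed

lemma continuous_on_slope: "continuous_on {a..b} (\<lambda>r. slope r)"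
proof -
  have "continuous_on {a..b} (\<lambda>r. P (\<tau> r))"
    by (rule continuous_on_compose2[OF v(7) continuous_on_\<tau>]) (use \<tau>_01 in auto)
  then show ?thesis
    using p by (intro continuous_on_mult continuous_on_spow continuous_on_\<tau>') auto
qed

definition u :: "'a \<Rightarrow> real" where "u x = v (\<tau> (norm x))"

definition G :: "'a \<Rightarrow> 'a" where "G x = (slope (norm x) / norm x) *\<^sub>R x"

lemma norm_G: "x \<in> ann \<Longrightarrow> norm (G x) = \<bar>slope (norm x)\<bar>"
  using ab by (auto simp: G_def ann_def)

text \<open>The profile is approximated as a function of the squared radius:
  \<open>x \<bullet> x\<close> is a polynomial, so composing it with smooth functions stays smooth
  on the whole space. On [a^2, b^2] the square root is differentiable, and the chain rule produces
  \<open>G\<close>.\<close>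

lemma u_W01p: "u \<in> W01p p ann" "is_weak_grad ann u G" "G \<in> Lp p ann"
proof -
  define h where "h s = v (\<tau> (sqrt s))" for s
  define h' where "h' s = slope (sqrt s) * (inverse (sqrt s) / 2)" for s
  have sq: "sqrt s \<in> {a..b}" "s > 0" if "s \<in> {a\<^sup>2..b\<^sup>2}" for s
  proof -
    have "0 < a\<^sup>2" "a\<^sup>2 \<le> s" using ab that by simp_all
    then show "s > 0" by (rule less_le_trans)
    have "sqrt (a\<^sup>2) \<le> sqrt s" "sqrt s \<le> sqrt (b\<^sup>2)"
      by (rule real_sqrt_le_mono; use that in simp)+
    then show "sqrt s \<in> {a..b}" using ab by simp
  qed
  have im: "sqrt ` {a\<^sup>2..b\<^sup>2} \<subseteq> {a..b}" using sq by auto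
  have ab2: "a\<^sup>2 < b\<^sup>2"
    using ab by (intro power_strict_mono) auto
  have dh: "(h has_real_derivative h' s) (at s within {a\<^sup>2..b\<^sup>2})" if s: "s \<in> {a\<^sup>2..b\<^sup>2}" for s
  proof -
    have "(sqrt has_real_derivative inverse (sqrt s) / 2) (at s within {a\<^sup>2..b\<^sup>2})"
      using DERIV_real_sqrt[OF sq(2)[OF s]] by (rule has_field_derivative_at_within)
    moreover have "((\<lambda>r. v (\<tau> r)) has_real_derivative slope (sqrt s)) (at (sqrt s) within sqrt ` {a\<^sup>2..b\<^sup>2})"
      by (rule DERIV_subset[OF v_\<tau>_deriv[OF sq(1)[OF s]] im])
    ultimately have "((\<lambda>r. v (\<tau> r)) \<circ> sqrt has_real_derivative slope (sqrt s) * (inverse (sqrt s) / 2))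
        (at s within {a\<^sup>2..b\<^sup>2})"
      by (rule DERIV_image_chain[rotated])
    then show ?thesis
      by (simp only: o_def h_def[abs_def] h'_def)
  qed
  have conth': "continuous_on {a\<^sup>2..b\<^sup>2} h'"
  proof -
    have "continuous_on {a\<^sup>2..b\<^sup>2} (\<lambda>s. slope (sqrt s))"
      by (rule continuous_on_compose2[OF continuous_on_slope _ im]) (intro continuous_intros)
    moreover have "continuous_on {a\<^sup>2..b\<^sup>2} (\<lambda>s. inverse (sqrt s) / 2)"
      using sq(2) by (intro continuous_intros) force+
    ultimately show ?thesis
      unfolding h'_def by (rule continuous_on_mult)
  qed
  have h0: "h (a\<^sup>2) = 0" "h (b\<^sup>2) = 0"
    using ab v(1,2) \<tau>(4,5) by (simp_all add: h_def)
  obtain \<psi> C where \<psi>: "\<And>n::nat. \<psi> n \<in> test_fun {a\<^sup>2<..<b\<^sup>2}" "\<And>n s. \<bar>\<psi> n s\<bar> \<le> C"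
    "\<And>n s. \<bar>partial 1 (\<psi> n) s\<bar> \<le> C"
    "\<And>s. s \<in> {a\<^sup>2<..<b\<^sup>2} \<Longrightarrow> (\<lambda>n. \<psi> n s) \<longlonglongrightarrow> h s"
    "\<And>s. s \<in> {a\<^sup>2<..<b\<^sup>2} \<Longrightarrow> (\<lambda>n. partial 1 (\<psi> n) s) \<longlonglongrightarrow> h' s"
    by (rule smooth_approximation[where h = h and h' = h', OF ab2 dh conth' h0], assumption, rule that)
  define \<phi> where "\<phi> n x = \<psi> n (x \<bullet> x)" for n and x :: 'a
  have Ck_sq: "Ck k (\<lambda>x::'a. x \<bullet> x)" for k
    unfolding euclidean_inner[of x x for x] by (intro Ck_sum Ck_mult Ck_inner finite_Basis)
  have grad\<phi>: "grad (\<phi> n) x = (2 * partial 1 (\<psi> n) (x \<bullet> x)) *\<^sub>R x" for n x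
  proof (rule euclidean_eqI)
    fix i :: 'a assume i: "i \<in> Basis"
    have d: "((\<lambda>x::'a. x \<bullet> x) has_derivative (\<lambda>h. 2 * (h \<bullet> x))) (at x)"
      by (auto intro!: derivative_eq_intros simp: inner_commute)
    have "partial i (\<phi> n) x = partial 1 (\<psi> n) (x \<bullet> x) * partial i (\<lambda>x. x \<bullet> x) x"
      unfolding \<phi>_def[abs_def] using test_funD(2)[OF \<psi>(1)] d
      by (intro partial_compose) (auto simp: differentiable_def)
    then show "grad (\<phi> n) x \<bullet> i = (2 * partial 1 (\<psi> n) (x \<bullet> x)) *\<^sub>R x \<bullet> i"
      using i by (simp add: partial_eqI[OF d]) (simp add: inner_commute)
  qed
  have sqann: "x \<bullet> x \<in> {a\<^sup>2<..<b\<^sup>2}" if "x \<in> ann" for x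
    using that ab unfolding dot_square_norm by (auto simp: ann_def intro: power_strict_mono)
  have \<phi>test: "\<phi> n \<in> test_fun ann" for n
  proof -
    obtain S where S: "compact S" "S \<subseteq> {a\<^sup>2<..<b\<^sup>2}" "\<And>x. x \<notin> S \<Longrightarrow> \<psi> n x = 0"
      by (rule test_fun_support[OF \<psi>(1)[of n]], rule that)
    show ?thesis
    proof (rule test_funI)
      show "Ck k (\<phi> n)" for k
        unfolding \<phi>_def[abs_def] by (rule Ck_compose[OF test_funD(1)[OF \<psi>(1)] Ck_sq])
      let ?S = "(\<lambda>x::'a. x \<bullet> x) -` S"
      show sub: "?S \<subseteq> ann"
      proof
        fix x :: 'a assume "x \<in> ?S"
        then have "a\<^sup>2 < (norm x)\<^sup>2" "(norm x)\<^sup>2 < b\<^sup>2"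
          using S(2) by (auto simp: dot_square_norm)
        then show "x \<in> ann"
          using ab by (auto simp: ann_def dest: power2_less_imp_less)
      qed
      have "closed ?S"
        using compact_imp_closed[OF S(1)] by (intro closed_vimage) (auto intro!: continuous_intros)
      moreover have "bounded ?S"
        using sub by (rule bounded_subset[OF bounded_subset[OF bounded_cball[of 0 b]], rotated]) (auto simp: ann_def)
      ultimately show "compact ?S"
        by (simp add: compact_eq_bounded_closed)
      show "\<phi> n x = 0" if "x \<notin> ?S" for x
        using S(3) that by (simp add: \<phi>_def)
    qed
  qed
  have C: "0 \<le> C" using \<psi>(2)[of 0 0] by linarith
  define C' where "C' = max C (2 * C * b)"
  have b1: "\<bar>\<phi> n x\<bar> \<le> C'" for n x
    using \<psi>(2)[of n "x \<bullet> x"] by (simp add: \<phi>_def C'_def)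
  have b2: "norm (grad (\<phi> n) x) \<le> C'" if "x \<in> ann" for n x
  proof -
    have "norm (grad (\<phi> n) x) = 2 * \<bar>partial 1 (\<psi> n) (x \<bullet> x)\<bar> * norm x"
      by (simp add: grad\<phi> abs_mult)
    also have "\<dots> \<le> 2 * C * b"
      using that \<psi>(3)[of n "x \<bullet> x"] C by (intro mult_mono) (auto simp: ann_def)
    finally show ?thesis by (simp add: C'_def)
  qed
  have l1: "(\<lambda>n. \<phi> n x) \<longlonglongrightarrow> u x" if "x \<in> ann" for x
    using \<psi>(4)[OF sqann[OF that]] unfolding \<phi>_def h_def u_def norm_eq_sqrt_inner .
  have l2: "(\<lambda>n. grad (\<phi> n) x) \<longlonglongrightarrow> G x" if "x \<in> ann" for x
  proof -
    have "(\<lambda>n. grad (\<phi> n) x) \<longlonglongrightarrow> (2 * h' (x \<bullet> x)) *\<^sub>R x"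
      unfolding grad\<phi> by (intro tendsto_intros \<psi>(5)[OF sqann[OF that]])
    also have "2 * h' (x \<bullet> x) = slope (norm x) / norm x"
      unfolding h'_def norm_eq_sqrt_inner[symmetric] by (simp add: inverse_eq_divide)
    finally show ?thesis by (simp add: G_def)
  qed
  show "u \<in> W01p p ann" "is_weak_grad ann u G" "G \<in> Lp p ann"
    using W01p_bounded_limit[where \<phi> = \<phi> and C = C' and u = u and G = G, OF p open_ann ann_lmeasurable \<phi>test b1 b2 l1 l2]
    by simp_all
qed

lemma u_nonneg: "x \<in> ann \<Longrightarrow> 0 \<le> u x"
  using v(3) \<tau>_01[of "norm x"] by (auto simp: u_def ann_def)

text \<open>The flux of \<open>u\<close> is the radial field k(|x|) x with k(r) =
  \<open>\<kappa> * P (\<tau> r) / r ^ N\<close>. Its divergence r k' + N k equals - f(u) because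
  the derivative of r^(-N) cancels the second summand.\<close>

lemma u_weak_solution:
  assumes w: "w \<in> W01p p ann"
  shows "integrable (lebesgue_on ann) (\<lambda>x. f (u x) * w x)"
    "(LINT x|lebesgue_on ann. norm (weak_grad ann u x) powr (p - 2) * (weak_grad ann u x \<bullet> weak_grad ann w x))
      = (LINT x|lebesgue_on ann. f (u x) * w x)"
proof -
  define N where "N = DIM('a)"
  have N: "N > 0" by (simp add: N_def)
  define k where "k r = \<kappa> * P (\<tau> r) / r ^ N" for r
  define k' where "k' r = - (f (v (\<tau> r)) / r) - real N * k r / r" for r
  have k_slope: "\<bar>slope r\<bar> powr (p - 2) * slope r / r = k r" if r: "r > 0" for r
  proof -
    have \<tau>': "\<tau>' r > 0" using \<tau>(2)[OF r] .
    have "\<bar>slope r\<bar> powr (p - 2) * slope r = spow (p - 1) (slope r)"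
      by (rule abs_powr_mult_eq_spow)
    also have "\<dots> = spow (p - 1) (spow (1 / (p - 1)) (P (\<tau> r))) * \<tau>' r powr (p - 1)"
      using \<tau>' by (simp add: spow_def[of "p - 1"] abs_mult powr_mult sgn_mult)
    also have "\<dots> = P (\<tau> r) * (\<kappa> / r ^ (N - 1))"
      using p \<tau>'\<kappa>[OF r] by (simp add: spow_spow N_def)
    finally show ?thesis
      using N r by (cases N) (simp_all add: k_def mult_ac)
  qed
  \<comment> \<open>Dividing the two defining relations of the change of variables: the weight
    \<open>q\<close> is exactly what is absorbed by the surface factor.\<close>
  have \<kappa>\<tau>': "\<kappa> * q (\<tau> r) * \<tau>' r = r ^ (N - 1)" if r: "r \<in> {a..b}" for r
  proof -
    have r0: "r > 0" using r ab by auto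
    have "\<tau>' r powr p = \<tau>' r powr (p - 1) * \<tau>' r"
      using powr_add[of "\<tau>' r" "p - 1" 1] \<tau>(2)[OF r0] by simp
    then have eq: "q (\<tau> r) * (\<kappa> / r ^ (N - 1) * \<tau>' r) = 1"
      using \<tau>'q[OF r] by (simp only: \<tau>'\<kappa>[OF r0] N_def)
    have "\<kappa> * q (\<tau> r) * \<tau>' r = r ^ (N - 1) * (q (\<tau> r) * (\<kappa> / r ^ (N - 1) * \<tau>' r))"
      using r0 by simp
    then show ?thesis
      by (simp only: eq mult_1_right)
  qed
  have dk: "(k has_real_derivative k' r) (at r)" if r: "a < r" "r < b" for r
  proof -
    have r0: "r > 0" using r ab by simp
    have "(P has_real_derivative - (q (\<tau> r) * f (v (\<tau> r)))) (at (\<tau> r))"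
      using v(5)[of "\<tau> r"] \<tau>_01_strict[OF r] at_within_Icc_at[of 0 "\<tau> r" 1] by auto
    from DERIV_chain2[OF this \<tau>(1)[OF r0]]
    have "((\<lambda>r. P (\<tau> r)) has_real_derivative - (q (\<tau> r) * f (v (\<tau> r))) * \<tau>' r) (at r)" .
    then have "(k has_real_derivative (\<kappa> * (- (q (\<tau> r) * f (v (\<tau> r))) * \<tau>' r) * r ^ N
        - \<kappa> * P (\<tau> r) * (real N * r ^ (N - 1))) / (r ^ N * r ^ N)) (at r)"
      unfolding k_def[abs_def] using r0 by (auto intro!: derivative_eq_intros)
    moreover have "(\<kappa> * (- (q (\<tau> r) * f (v (\<tau> r))) * \<tau>' r) * r ^ N
        - \<kappa> * P (\<tau> r) * (real N * r ^ (N - 1))) / (r ^ N * r ^ N) = k' r"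
    proof -
      have "\<kappa> * (- (q (\<tau> r) * f (v (\<tau> r))) * \<tau>' r) = - (\<kappa> * q (\<tau> r) * \<tau>' r) * f (v (\<tau> r))"
        by (simp add: algebra_simps)
      also have "\<dots> = - (r ^ (N - 1) * f (v (\<tau> r)))"
        using \<kappa>\<tau>'[of r] r by simp
      finally show ?thesis
        using N r0 by (cases N) (simp_all add: k'_def k_def field_simps)
    qed
    ultimately show ?thesis by simp
  qed
  have cont_v\<tau>: "continuous_on {a..b} (\<lambda>r. f (v (\<tau> r)))"
    by (rule continuous_on_compose2[OF f continuous_on_compose2[OF v(6) continuous_on_\<tau>]]) (use \<tau>_01 in auto)
  have contk: "continuous_on {a..b} k"
    unfolding k_def using ab
    by (intro continuous_on_divide continuous_on_mult continuous_on_const continuous_on_power continuous_on_id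
        continuous_on_compose2[OF v(7) continuous_on_\<tau>]) (use \<tau>_01 in auto)
  have contk': "continuous_on {a..b} k'"
    unfolding k'_def using ab
    by (intro continuous_on_diff continuous_on_minus continuous_on_divide continuous_on_mult continuous_on_const
        continuous_on_id contk cont_v\<tau>) auto
  have norm_ann: "norm ` ann \<subseteq> {a..b}"
    by (auto simp: ann_def)
  have comp: "continuous_on ann (\<lambda>x. g (norm x))" if "continuous_on {a..b} g" for g :: "real \<Rightarrow> real"
    by (rule continuous_on_compose2[OF that _ norm_ann]) (intro continuous_intros)
  have bnd: "\<exists>B. \<forall>r\<in>{a..b}. \<bar>g r\<bar> \<le> B" if "continuous_on {a..b} g" for g :: "real \<Rightarrow> real"
  proof -
    have "bounded (g ` {a..b})"
      using that by (intro compact_imp_bounded compact_continuous_image) auto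
    then show ?thesis by (auto simp: bounded_iff)
  qed
  obtain B1 where B1: "\<forall>r\<in>{a..b}. \<bar>f (v (\<tau> r))\<bar> \<le> B1"
    using bnd[OF cont_v\<tau>] by blast
  obtain B2 where B2: "\<forall>r\<in>{a..b}. \<bar>k r * r\<bar> \<le> B2"
    using bnd[OF continuous_on_mult[OF contk continuous_on_id]] by blast
  define V where "V x = k (norm x) *\<^sub>R x" for x :: 'a
  have ne: "x \<noteq> 0" "norm x > 0" if "x \<in> ann" for x
    using that ab by (auto simp: ann_def)
  have part: "(\<lambda>x. V x \<bullet> i) differentiable at x"
    "i \<in> Basis \<Longrightarrow> partial i (\<lambda>x. V x \<bullet> i) x = k' (norm x) * (x \<bullet> i)\<^sup>2 / norm x + k (norm x)"
    if "x \<in> ann" for x i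
    unfolding V_def using radial_field_partial[OF dk ne(1)[OF that]] that by (auto simp: ann_def)
  have contV: "continuous_on ann V"
    unfolding V_def by (intro continuous_intros comp contk)
  have nV: "norm (V x) \<le> max B1 B2" if "x \<in> ann" for x
  proof -
    have "\<bar>k (norm x) * norm x\<bar> \<le> B2"
      using B2 that by (auto simp: ann_def)
    then show ?thesis by (simp add: V_def abs_mult)
  qed
  have GV: "norm (G x) powr (p - 2) *\<^sub>R G x = V x" if "x \<in> ann" for x
    using k_slope[OF ne(2)[OF that]] by (simp add: norm_G[OF that] V_def) (simp add: G_def)
  have contp: "continuous_on ann (partial i (\<lambda>x. V x \<bullet> i))" if "i \<in> Basis" for i
  proof -
    have "continuous_on ann (\<lambda>x. k' (norm x) * (x \<bullet> i)\<^sup>2 / norm x + k (norm x))"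
      using ne(1) by (intro continuous_intros comp contk contk') auto
    then show ?thesis
      by (rule continuous_on_eq) (use part(2) that in auto)
  qed
  have div: "(\<Sum>i\<in>Basis. partial i (\<lambda>x. V x \<bullet> i) x) = - f (u x)" if x: "x \<in> ann" for x
  proof -
    have "(\<Sum>i\<in>Basis. partial i (\<lambda>x. V x \<bullet> i) x) = (\<Sum>i\<in>Basis. k' (norm x) / norm x * ((x \<bullet> i) * (x \<bullet> i)) + k (norm x))"
      by (rule sum.cong) (auto simp: part(2)[OF x] power2_eq_square)
    also have "\<dots> = k' (norm x) / norm x * (x \<bullet> x) + real N * k (norm x)"
      unfolding sum.distrib sum_distrib_left[symmetric] euclidean_inner[of x x, symmetric]
      by (simp add: N_def)
    also have "\<dots> = k' (norm x) * norm x + real N * k (norm x)"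
      using ne(2)[OF x] by (simp add: dot_square_norm power2_eq_square)
    also have "\<dots> = - f (u x)"
      using ne(2)[OF x] by (simp add: k'_def u_def field_simps)
    finally show ?thesis .
  qed
  have contfu: "continuous_on ann (\<lambda>x. f (u x))"
    unfolding u_def by (rule comp[OF cont_v\<tau>])
  have bfu: "\<bar>f (u x)\<bar> \<le> max B1 B2" if "x \<in> ann" for x
    using bspec[OF B1, of "norm x"] that by (simp add: u_def ann_def)
  note * = weak_solution_if_divergence[OF p open_ann ann_lmeasurable u_W01p(2) contV nV GV part(1) contp div contfu bfu w]
  show "integrable (lebesgue_on ann) (\<lambda>x. f (u x) * w x)"
    "(LINT x|lebesgue_on ann. norm (weak_grad ann u x) powr (p - 2) * (weak_grad ann u x \<bullet> weak_grad ann w x))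
      = (LINT x|lebesgue_on ann. f (u x) * w x)"
    using * by auto
qed

text \<open>The value of \<open>v\<close> is at most the integral of the radial slope over [a, b].
  Weighted by the area factor at the inner radius, this integral is dominated by the L^1 norm of the
  gradient in the annulus.\<close>

lemma u_norm_lower:
  assumes "t \<in> {0..1}"
  shows "unit_ball_vol DIM('a) * (real DIM('a) * a ^ (DIM('a) - 1)) * v t \<le> measure lebesgue ann + W01p_norm p ann u powr p"
proof -
  define c where "c = unit_ball_vol (real DIM('a)) * (real DIM('a) * a ^ (DIM('a) - 1))"
  obtain r0 where r0: "r0 \<in> {a..b}" "\<tau> r0 = t"
    using \<tau>_surj[OF assms] by blast
  \<comment> \<open>The open interval makes \<open>g\<close> vanish at the two end radii, as the
    comparison with the shell integral requires.\<close>
  define g where "g r = indicator {a<..<b} r * \<bar>slope r\<bar>" for r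
  have conts: "continuous_on {a..b} (\<lambda>r. \<bar>slope r\<bar>)"
    by (intro continuous_on_rabs continuous_on_slope)
  have int: "(\<lambda>r. slope r) integrable_on {c..d}" "(\<lambda>r. \<bar>slope r\<bar>) integrable_on {c..d}" if "a \<le> c" "d \<le> b" for c d
    by (intro integrable_continuous_real continuous_on_subset[OF continuous_on_slope] continuous_on_subset[OF conts]; use that in auto)+
  have "bounded ((\<lambda>r. \<bar>slope r\<bar>) ` {a..b})"
    by (intro compact_imp_bounded compact_continuous_image conts) auto
  then have "\<exists>C. \<forall>r\<in>{a..b}. \<bar>slope r\<bar> \<le> C"
    by (simp add: bounded_iff)
  then obtain C where C: "\<And>r. r \<in> {a..b} \<Longrightarrow> \<bar>slope r\<bar> \<le> C"
    by blast
  have C0: "0 \<le> C" using C[of a] ab by force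
  have meas: "g \<in> borel_measurable borel"
  proof -
    have "(\<lambda>r. indicator {a<..<b} r *\<^sub>R \<bar>slope r\<bar>) \<in> borel_measurable borel"
      by (rule borel_measurable_continuous_on_indicator) (auto intro: continuous_on_subset[OF conts])
    then show ?thesis by (simp add: g_def[abs_def])
  qed
  have intg: "integral\<^sup>L lborel g = integral {a..b} (\<lambda>r. \<bar>slope r\<bar>)"
  proof -
    have "integrable lborel (\<lambda>r. indicator {a..b} r *\<^sub>R \<bar>slope r\<bar>)"
      by (intro borel_integrable_compact conts) auto
    then have "set_integrable lborel {a..b} (\<lambda>r. \<bar>slope r\<bar>)"
      by (simp add: set_integrable_def)
    from set_borel_integral_eq_integral(2)[OF this]
    have "integral {a..b} (\<lambda>r. \<bar>slope r\<bar>) = (LINT r|lborel. indicator {a..b} r * \<bar>slope r\<bar>)"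
      by (simp add: set_lebesgue_integral_def)
    also have "\<dots> = integral\<^sup>L lborel g"
    proof (rule Bochner_Integration.integral_cong_AE)
      have "AE r in lborel. r \<noteq> a" "AE r in lborel. r \<noteq> b"
        by (rule AE_lborel_singleton)+
      then show "AE r in lborel. indicator {a..b} r * \<bar>slope r\<bar> = g r"
        by eventually_elim (auto simp: g_def indicator_def)
    qed (use meas \<open>integrable lborel _\<close> in auto)
    finally show ?thesis ..
  qed
  have "((\<lambda>r. slope r) has_integral (v (\<tau> r0) - v (\<tau> a))) {a..r0}"
    using r0(1) by (intro fundamental_theorem_of_calculus)
      (auto simp: has_real_derivative_iff_has_vector_derivative[symmetric] intro!: DERIV_subset[OF v_\<tau>_deriv])
  then have "v t = integral {a..r0} (\<lambda>r. slope r)"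
    using r0 v(1) \<tau>(4) by (simp add: integral_unique)
  also have "\<dots> \<le> integral {a..r0} (\<lambda>r. \<bar>slope r\<bar>)"
    using r0 by (intro integral_le int) auto
  also have "\<dots> \<le> integral {a..b} (\<lambda>r. \<bar>slope r\<bar>)"
    using r0 by (intro integral_subset_le int) auto
  finally have le: "v t \<le> integral\<^sup>L lborel g"
    by (simp add: intg)
  have "c * v t \<le> c * integral\<^sup>L lborel g"
    using le ab by (intro mult_left_mono) (auto simp: c_def)
  also have "\<dots> \<le> (LINT x|lebesgue_on {x::'a. a < norm x \<and> norm x < b}. g (norm x))"
    unfolding c_def
    by (rule radial_integral_lower[OF ab meas, where C = C]) (use C C0 in \<open>auto simp: g_def indicator_def\<close>)
  also have "\<dots> = (LINT x|lebesgue_on ann. norm (G x))"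
    unfolding ann_def[symmetric]
    by (rule Bochner_Integration.integral_cong) (auto simp: norm_G g_def ann_def)
  also have "\<dots> \<le> measure lebesgue ann + W01p_norm p ann u powr p"
    using p by (intro W01p_norm_lower open_ann ann_lmeasurable u_W01p) auto
  finally show ?thesis by (simp add: c_def)
qed

end

end

section \<open>Radial change of variables\<close>

text \<open>The variable is B - A r^(-s) with s = (N - p) / (p - 1). The relation for
  \<open>\<kappa>\<close> rests on (s + 1)(p - 1) = N - 1, the one for the weight on s e = (s + 1)
  p, where e is the exponent of B - t, and on the powers of A adding up to e.\<close>

lemma radial_change_subcritical:
  assumes p: "1 < p" "p < real CARD('n::finite)" and ab: "0 < a" "a < b"
  shows "\<exists>\<kappa> \<tau> \<tau>'. radial_change TYPE(real ^ 'n) p \<kappa> a b (q_annulus CARD('n) p a b) \<tau> \<tau>'"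
    "continuous_on {0..1} (q_annulus CARD('n) p a b)"
proof -
  define N where "N = real CARD('n)"
  define s where "s = (N - p) / (p - 1)"
  have Np: "p < N" using p by (simp add: N_def)
  have s: "s > 0" using p Np by (simp add: s_def)
  have sp: "(s + 1) * (p - 1) = N - 1"
    using p by (simp add: s_def field_simps)
  have lt: "a powr s < b powr s"
    using ab s by (intro powr_less_mono2) auto
  define A where "A = (a * b) powr s / (b powr s - a powr s)"
  define B where "B = b powr s / (b powr s - a powr s)"
  have A: "A > 0" using ab lt by (simp add: A_def)
  have B: "B > 1" using ab lt by (simp add: B_def field_simps)
  define e where "e = p * (N - 1) / (N - p)"
  have q_eq: "q_annulus CARD('n) p a b t = (1 / s) powr p * A powr ((p - 1) * p / (N - p)) / (B - t) powr e" for t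
    using Np by (simp add: q_annulus_def Let_def A_def B_def s_def e_def N_def)
  show "continuous_on {0..1} (q_annulus CARD('n) p a b)"
    unfolding q_eq[abs_def] using B
    by (intro continuous_on_divide continuous_on_const continuous_on_powr continuous_on_diff continuous_on_id) auto
  define \<tau> where "\<tau> r = B - A * r powr (- s)" for r
  define \<tau>' where "\<tau>' r = A * s * r powr (- (s + 1))" for r
  have "radial_change TYPE(real ^ 'n) p ((A * s) powr (p - 1)) a b (q_annulus CARD('n) p a b) \<tau> \<tau>'"
  proof
    show "(\<tau> has_real_derivative \<tau>' r) (at r)" if "r > 0" for r
      unfolding \<tau>_def \<tau>'_def using that
      by (auto intro!: derivative_eq_intros simp: algebra_simps powr_diff powr_minus_divide)
    show "\<tau>' r > 0" if "r > 0" for r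
      using that A s by (simp add: \<tau>'_def)
    show "continuous_on {0<..} \<tau>'"
      unfolding \<tau>'_def by (intro continuous_intros) auto
    show "\<tau> a = 0"
      using ab lt by (simp add: \<tau>_def A_def B_def powr_mult powr_minus field_simps)
    show "\<tau> b = 1"
    proof -
      have "(a * b) powr s * b powr (- s) = a powr s"
        using ab by (simp add: powr_mult powr_minus)
      then have "\<tau> b = (b powr s - a powr s) / (b powr s - a powr s)"
        by (simp only: \<tau>_def A_def B_def diff_divide_distrib times_divide_eq_left)
      with lt show ?thesis by simp
    qed
    show "\<tau>' r powr (p - 1) = (A * s) powr (p - 1) / r ^ (DIM(real ^ 'n) - 1)" if r: "r > 0" for r
    proof -
      have "\<tau>' r powr (p - 1) = (A * s) powr (p - 1) * r powr (- ((s + 1) * (p - 1)))"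
        using A s by (simp add: \<tau>'_def powr_mult powr_powr del: minus_add_distrib)
      also have "r powr (- ((s + 1) * (p - 1))) = 1 / r powr (real (CARD('n) - 1))"
      proof -
        have "N - 1 = real (CARD('n) - 1)"
          by (simp add: N_def of_nat_diff Suc_leI)
        then show ?thesis
          unfolding sp powr_minus_divide by (simp only:)
      qed
      also have "\<dots> = 1 / r ^ (CARD('n) - 1)"
        by (simp only: powr_realpow[OF r])
      finally show ?thesis by simp
    qed
    show "q_annulus CARD('n) p a b (\<tau> r) * \<tau>' r powr p = 1" if "r \<in> {a..b}" for r
    proof -
      have r: "r > 0" using that ab by auto
      have se: "s * e = (s + 1) * p"
      proof -
        have "s * e = p * (N - 1) / (p - 1)"
          using p Np by (simp add: s_def e_def)
        also have "\<dots> = (s + 1) * p"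
          using p by (simp add: sp[symmetric])
        finally show ?thesis .
      qed
      have exp0: "(p - 1) * p / (N - p) + p = e"
        using Np by (simp add: e_def field_simps)
      define X where "X = r powr (- (s * e))"
      have X: "X > 0" using r by (simp add: X_def)
      have 1: "(B - \<tau> r) powr e = A powr e * X"
        using A by (simp add: \<tau>_def powr_mult powr_powr X_def)
      have 2: "\<tau>' r powr p = A powr p * s powr p * X"
        using A s unfolding X_def se by (simp add: \<tau>'_def powr_mult powr_powr del: minus_add_distrib)
      have "q_annulus CARD('n) p a b (\<tau> r) * \<tau>' r powr p =
          ((1 / s) powr p * s powr p) * (A powr ((p - 1) * p / (N - p)) * A powr p) / A powr e"
        unfolding q_eq 1 2 using X A by simp
      also have "(1 / s) powr p * s powr p = 1"
        using s by (simp add: powr_divide)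
      also have "A powr ((p - 1) * p / (N - p)) * A powr p = A powr e"
        by (simp only: powr_add[symmetric] exp0)
      finally show ?thesis
        using A r by simp
    qed
  qed (use p ab in auto)
  then show "\<exists>\<kappa> \<tau> \<tau>'. radial_change TYPE(real ^ 'n) p \<kappa> a b (q_annulus CARD('n) p a b) \<tau> \<tau>'"
    by blast
qed

text \<open>For p = N the power is replaced by the logarithm, normalised to run from 0 to 1; the
  weight at \<open>\<tau> r\<close> is then (r M)^p with M = ln (b / a).\<close>

lemma radial_change_critical:
  assumes p: "1 < p" "p = real CARD('n::finite)" and ab: "0 < a" "a < b"
  shows "\<exists>\<kappa> \<tau> \<tau>'. radial_change TYPE(real ^ 'n) p \<kappa> a b (q_annulus CARD('n) p a b) \<tau> \<tau>'"
    "continuous_on {0..1} (q_annulus CARD('n) p a b)"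
proof -
  define M where "M = ln (b / a)"
  have M: "M > 0" using ab by (simp add: M_def)
  have q_eq: "q_annulus CARD('n) p a b t = (a * (b / a) powr t * M) powr p" for t
    using p by (simp add: q_annulus_def M_def)
  show "continuous_on {0..1} (q_annulus CARD('n) p a b)"
    unfolding q_eq[abs_def] using ab M
    by (intro continuous_on_powr continuous_on_const continuous_on_mult continuous_on_id) auto
  define \<tau> where "\<tau> r = ln (r / a) / M" for r
  define \<tau>' where "\<tau>' r = 1 / (r * M)" for r
  have "radial_change TYPE(real ^ 'n) p (1 / M powr (p - 1)) a b (q_annulus CARD('n) p a b) \<tau> \<tau>'"
  proof
    show "(\<tau> has_real_derivative \<tau>' r) (at r)" if "r > 0" for r
      unfolding \<tau>_def \<tau>'_def using that ab M
      by (auto intro!: derivative_eq_intros)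
    show "\<tau>' r > 0" if "r > 0" for r
      using that M by (simp add: \<tau>'_def)
    show "continuous_on {0<..} \<tau>'"
      unfolding \<tau>'_def using M by (intro continuous_intros) auto
    show "\<tau> a = 0"
      using ab by (simp add: \<tau>_def)
    show "\<tau> b = 1"
      using M by (simp add: \<tau>_def M_def)
    show "\<tau>' r powr (p - 1) = 1 / M powr (p - 1) / r ^ (DIM(real ^ 'n) - 1)" if r: "r > 0" for r
    proof -
      have "p - 1 = real (CARD('n) - 1)"
        by (simp add: p(2) of_nat_diff Suc_leI)
      then have "r powr (p - 1) = r ^ (CARD('n) - 1)"
        using powr_realpow[OF r, of "CARD('n) - 1"] by (simp only:)
      then show ?thesis
        using r M by (simp add: \<tau>'_def powr_divide powr_mult mult.commute)
    qed
    show "q_annulus CARD('n) p a b (\<tau> r) * \<tau>' r powr p = 1" if "r \<in> {a..b}" for r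
    proof -
      have r: "r > 0" using that ab by auto
      have "(b / a) powr (\<tau> r) = exp (ln (r / a))"
        using ab M by (simp add: powr_def \<tau>_def M_def)
      also have "\<dots> = r / a"
        using r ab by simp
      finally show ?thesis
        using r M ab by (simp add: q_eq \<tau>'_def powr_divide)
    qed
  qed (use p ab in auto)
  then show "\<exists>\<kappa> \<tau> \<tau>'. radial_change TYPE(real ^ 'n) p \<kappa> a b (q_annulus CARD('n) p a b) \<tau> \<tau>'"
    by blast
qed

lemma bvp_solution_annulus:
  fixes f v P :: "real \<Rightarrow> real"
  assumes p: "1 < p" "p \<le> real CARD('n::finite)" and ab: "0 < a" "a < b" and f: "continuous_on UNIV f"
    and sol: "bvp_solution p (q_annulus CARD('n) p a b) f v P" and t: "t \<in> {0..1}"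
  obtains u :: "real ^ 'n \<Rightarrow> real" where "plap_weak_solution p (annulus a b) f u"
    "AE x in lebesgue_on (annulus a b). u x \<ge> 0"
    "unit_ball_vol CARD('n) * (real CARD('n) * a ^ (CARD('n) - 1)) * v t \<le>
      measure lebesgue (annulus a b :: (real ^ 'n) set) + W01p_norm p (annulus a b) u powr p"
proof -
  have ex: "\<exists>\<kappa> \<tau> \<tau>'. radial_change TYPE(real ^ 'n) p \<kappa> a b (q_annulus CARD('n) p a b) \<tau> \<tau>'"
    and q: "continuous_on {0..1} (q_annulus CARD('n) p a b)"
    using radial_change_subcritical[where 'n = 'n, of p a b] radial_change_critical[where 'n = 'n, of p a b] p ab
    by (cases "p < real CARD('n)"; simp)+
  then obtain \<kappa> \<tau> \<tau>' where "radial_change TYPE(real ^ 'n) p \<kappa> a b (q_annulus CARD('n) p a b) \<tau> \<tau>'"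
    by blast
  then interpret radial_change p \<kappa> a b "q_annulus CARD('n) p a b" \<tau> \<tau>' "TYPE(real ^ 'n)" .
  have ann: "ann = (annulus a b :: (real ^ 'n) set)"
    by (simp add: ann_def annulus_def)
  show ?thesis
  proof (rule that[of "u v"])
    show "plap_weak_solution p (annulus a b) f (u v)"
      unfolding plap_weak_solution_def Let_def ann[symmetric]
      using u_W01p(1)[OF f q sol] u_weak_solution[OF f q sol] by blast
    show "AE x in lebesgue_on (annulus a b). u v x \<ge> 0"
      unfolding ann[symmetric] using u_nonneg[OF f q sol] by (intro AE_I2) simp
    show "unit_ball_vol CARD('n) * (real CARD('n) * a ^ (CARD('n) - 1)) * v t \<le>
      measure lebesgue (annulus a b :: (real ^ 'n) set) + W01p_norm p (annulus a b) (u v) powr p"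
      using u_norm_lower[OF f q sol t] unfolding ann by simp
  qed
qed

section \<open>The threshold and the growth of the norms\<close>

lemma SUP_infdist_01: "(SUP t::real\<in>{0<..<1}. infdist t {0, 1}) = 1 / 2"
proof -
  have eq: "infdist t {0, 1} = min \<bar>t\<bar> \<bar>t - 1\<bar>" for t :: real
    by (simp add: infdist_def dist_real_def inf_min cInf_insert)
  show ?thesis
  proof (rule cSup_eq_maximum)
    show "1 / 2 \<in> (\<lambda>t::real. infdist t {0, 1}) ` {0<..<1}"
      by (rule image_eqI[of _ _ "1 / 2"]) (simp_all add: eq)
  qed (auto simp: eq min_def)
qed

text \<open>The number \<open>c\<close> is chosen strictly between the threshold and the limit
  superior. Lying below the latter, it is exceeded at arbitrarily large arguments; lying above the
  former, it leaves room for a \<open>\<mu>\<close> in the infimum defining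
  \<open>sigma\<close>.\<close>

lemma limsup_condition:
  fixes f :: "real \<Rightarrow> real"
  assumes p: "1 < p" and q0: "q0 > 0"
    and lim: "ereal (sigma p q0 / (p * (SUP t::real\<in>{0<..<1}. infdist t {0, 1}) powr p))
           < Limsup at_top (\<lambda>\<xi>. ereal (primitive f \<xi> / \<xi> powr p))"
  obtains c l where "0 < l" "l < 1 / 2" "\<And>y. \<exists>\<xi>\<ge>y. primitive f \<xi> > c * \<xi> powr p"
    "2 * l * ((1 / l) powr p / p) < (1 - 2 * l) * (q0 * c)"
proof -
  obtain c where c: "ereal (sigma p q0 / (p * (1 / 2) powr p)) < ereal c"
    "ereal c < Limsup at_top (\<lambda>\<xi>. ereal (primitive f \<xi> / \<xi> powr p))"
    using ereal_dense2[OF lim] unfolding SUP_infdist_01 by blast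
  have pos: "p * (1 / 2) powr p > 0"
    using p by simp
  have "sigma p q0 < c * (p * (1 / 2) powr p)"
    using c(1) pos by (simp add: pos_divide_less_eq)
  then have "\<exists>x\<in>(\<lambda>\<mu>. 1 / (q0 * \<mu> * (1 - \<mu>) powr (p - 1))) ` {0<..<1}. x < c * (p * (1 / 2) powr p)"
    unfolding sigma_def by (intro cInf_lessD) auto
  then obtain \<mu> where \<mu>: "\<mu> \<in> {0<..<1}" "1 / (q0 * \<mu> * (1 - \<mu>) powr (p - 1)) < c * (p * (1 / 2) powr p)"
    by blast
  \<comment> \<open>The plateau of the trapezoid gets length \<open>\<mu>\<close>, and the two ramps
    share the rest equally.\<close>
  define l where "l = (1 - \<mu>) / 2"
  have l: "0 < l" "l < 1 / 2" "1 - 2 * l = \<mu>" "1 - \<mu> = 2 * l"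
    using \<mu>(1) by (auto simp: l_def field_simps)
  have "\<exists>\<xi>\<ge>y. primitive f \<xi> > c * \<xi> powr p" for y
  proof (rule ccontr)
    assume no: "\<not> ?thesis"
    have "\<forall>\<^sub>F \<xi> in at_top. ereal (primitive f \<xi> / \<xi> powr p) \<le> ereal c"
      using eventually_ge_at_top[of "max y 1"]
    proof eventually_elim
      case (elim \<xi>)
      then have "\<not> primitive f \<xi> > c * \<xi> powr p" "\<xi> powr p > 0"
        using no by auto
      then show ?case
        by (simp add: pos_divide_le_eq)
    qed
    then have "Limsup at_top (\<lambda>\<xi>. ereal (primitive f \<xi> / \<xi> powr p)) \<le> ereal c"
      by (rule Limsup_bounded)
    with c(2) show False by simp
  qed
  moreover have "2 * l * ((1 / l) powr p / p) < (1 - 2 * l) * (q0 * c)"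
  proof -
    have "1 < c * (p * (1 / 2) powr p) * (q0 * \<mu> * (2 * l) powr (p - 1))"
      using \<mu> q0 l by (simp add: pos_divide_less_eq)
    also have "(2 * l) powr (p - 1) = (2 * l) powr p / (2 * l)"
      using l by (simp add: powr_diff)
    \<comment> \<open>The factor produced by halving cancels the p-th power of the maximal distance
      1/2 in the threshold.\<close>
    also have "(2 * l) powr p = l powr p / (1 / 2) powr p"
      using l by (simp add: powr_mult powr_divide)
    finally have "2 * l < c * p * q0 * \<mu> * l powr p"
      using l by (simp add: field_simps)
    moreover have "2 * l * ((1 / l) powr p / p) = 2 * l / (l powr p * p)"
      using l by (simp add: powr_divide)
    moreover have "l powr p * p > 0"
      using l p by simp
    ultimately show ?thesis
      unfolding l(3) by (simp add: pos_divide_less_eq mult_ac)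
  qed
  ultimately show ?thesis
    using that l(1,2) by blast
qed

lemma not_bdd_above_if_growth:
  fixes x :: "nat \<Rightarrow> real"
  assumes "p \<ge> 0" "c > 0" "\<And>k. 0 \<le> x k" "\<And>k. c * real k \<le> m + x k powr p"
  shows "\<not> bdd_above (range x)"
proof
  assume "bdd_above (range x)"
  then obtain B where "\<And>k. x k \<le> B"
    by (auto simp: bdd_above_def)
  then have "x k powr p \<le> B powr p" for k
    using assms(1,3) by (intro powr_mono2) auto
  then have "c * real k \<le> m + B powr p" for k
    using assms(4)[of k] by (smt (verit))
  then have "real k \<le> (m + B powr p) / c" for k
    using assms(2) by (simp add: pos_le_divide_eq mult.commute)
  then show False
    using reals_Archimedean2[of "(m + B powr p) / c"] by (meson not_less)
qed

theorem theorem1p1: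
  fixes p q0 :: real
    and f :: "real \<Rightarrow> real"
    and ak bk :: "nat \<Rightarrow> real"
  assumes "1 < p" and "p \<le> real CARD('n::finite)"
    and "continuous_on UNIV f" and "f 0 = 0"
    and "(INF \<xi>\<in>{0..}. ereal (primitive f \<xi>)) \<ge> 0"
    and "q0 > 0"
    and "\<And>k. 0 < ak k" and "\<And>k. ak k < bk k"
    and "filterlim bk at_top sequentially"
    and "filterlim (\<lambda>k. bk k / ak k) at_top sequentially"
    and "\<And>k. (SUP x\<in>{ak k..bk k}. f x) \<le> 0"
    and "ereal (sigma p q0 / (p * (SUP t::real\<in>{0<..<1}. infdist t {0, 1}) powr p))
           < Limsup at_top (\<lambda>\<xi>. ereal (primitive f \<xi> / \<xi> powr p))"
    and "Limsup at_top (\<lambda>\<xi>. ereal (primitive f \<xi> / \<xi> powr p)) < \<infinity>"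
  shows
    "(\<forall>q :: real \<Rightarrow> real.
        continuous_on {0..1} q \<and> (\<forall>t\<in>{0..1}. q t \<ge> q0) \<longrightarrow>
        (\<exists>v :: nat \<Rightarrow> real \<Rightarrow> real.
           (\<forall>k. ode_weak_solution p q f (v k) \<and>
                (AE t in lebesgue_on {0<..<1}. v k t \<ge> 0)) \<and>
           \<not> bdd_above (range (\<lambda>k. W01p_norm p {0<..<1} (v k)))))
     \<and>
     (\<forall>a b :: real.
        0 < a \<and> a < b \<and> (\<forall>t\<in>{0..1}. q_annulus CARD('n) p a b t \<ge> q0) \<longrightarrow>
        (\<exists>u :: nat \<Rightarrow> real ^ 'n \<Rightarrow> real.
           (\<forall>k. plap_weak_solution p (annulus a b) f (u k) \<and>
                (AE x in lebesgue_on (annulus a b). u k x \<ge> 0)) \<and>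
           \<not> bdd_above (range (\<lambda>k. W01p_norm p (annulus a b) (u k)))))"
proof -
  have F: "primitive f \<xi> \<ge> 0" if "\<xi> \<ge> 0" for \<xi>
    using order_trans[OF assms(5) INF_lower[of \<xi>]] that by simp
  have b: "\<exists>b\<ge>y. f b \<le> 0" for y
  proof -
    have "\<forall>\<^sub>F k in sequentially. bk k \<ge> y"
      using assms(9) by (simp add: filterlim_at_top)
    then obtain k where k: "bk k \<ge> y"
      by (auto simp: eventually_sequentially)
    \<comment> \<open>For reals a supremum is an upper bound only of sets bounded above; compactness
      supplies this and yields \<open>f (bk k) \<le> 0\<close>.\<close>
    have "bounded (f ` {ak k..bk k})"
      by (intro compact_imp_bounded compact_continuous_image continuous_on_subset[OF assms(3)]) auto
    then have "f (bk k) \<le> (SUP x\<in>{ak k..bk k}. f x)"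
      using assms(8)[of k] by (intro cSUP_upper bounded_imp_bdd_above) auto
    with assms(11)[of k] k show ?thesis by force
  qed
  obtain c l where cl: "0 < l" "l < 1 / 2" "\<And>y. \<exists>\<xi>\<ge>y. primitive f \<xi> > c * \<xi> powr p"
    "2 * l * ((1 / l) powr p / p) < (1 - 2 * l) * (q0 * c)"
    by (rule limsup_condition[OF assms(1,6,12)], rule that)
  have sol: "\<exists>v P t. bvp_solution p q f v P \<and> t \<in> {0..1} \<and> v t > R"
    if "continuous_on {0..1} q" "\<And>t. t \<in> {0..1} \<Longrightarrow> q0 \<le> q t" for q R
    by (rule large_solutions[OF assms(1,3,4) F b that assms(6) cl, where R = R]) blast+
  show ?thesis
  proof (intro conjI allI impI)
    fix q :: "real \<Rightarrow> real"
    assume q: "continuous_on {0..1} q \<and> (\<forall>t\<in>{0..1}. q t \<ge> q0)"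
    \<comment> \<open>For each \<open>k\<close> a solution exceeding \<open>k\<close> somewhere is
      taken, so the p-th powers of the norms grow at least linearly in \<open>k\<close>.\<close>
    have "\<exists>v. ode_weak_solution p q f v \<and> (AE t in lebesgue_on {0<..<1}. v t \<ge> 0) \<and>
        real k \<le> 1 + W01p_norm p {0<..<1} v powr p" for k
    proof -
      obtain v P t where v: "bvp_solution p q f v P" "t \<in> {0..1}" "v t > real k"
        using sol[of q "real k"] q by blast
      have "AE t in lebesgue_on {0<..<1}. v t \<ge> 0"
        using bvp_solutionD(3)[OF v(1)] by (intro AE_I2) simp
      moreover have "ode_weak_solution p q f v" "v t \<le> 1 + W01p_norm p {0<..<1} v powr p"
        using bvp_solution_weak[OF assms(1,3) _ v(1)] q v(2) by auto
      ultimately show ?thesis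
        using v(3) by (intro exI[of _ v]) auto
    qed
    then obtain v where v: "\<And>k. ode_weak_solution p q f (v k)"
      "\<And>k. AE t in lebesgue_on {0<..<1}. v k t \<ge> 0"
      "\<And>k. real k \<le> 1 + W01p_norm p {0<..<1} (v k) powr p"
      by metis
    then show "\<exists>v :: nat \<Rightarrow> real \<Rightarrow> real. (\<forall>k. ode_weak_solution p q f (v k) \<and>
                (AE t in lebesgue_on {0<..<1}. v k t \<ge> 0)) \<and>
           \<not> bdd_above (range (\<lambda>k. W01p_norm p {0<..<1} (v k)))"
      using assms(1) not_bdd_above_if_growth[of p 1 "\<lambda>k. W01p_norm p {0<..<1} (v k)" 1, OF _ _ W01p_norm_nonneg]
      by (intro exI[of _ v]) auto
  next
    fix a b :: real
    assume ab: "0 < a \<and> a < b \<and> (\<forall>t\<in>{0..1}. q_annulus CARD('n) p a b t \<ge> q0)"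
    let ?q = "q_annulus CARD('n) p a b"
    have contq: "continuous_on {0..1} ?q"
      using radial_change_subcritical(2)[where 'n = 'n, of p a b] radial_change_critical(2)[where 'n = 'n, of p a b]
        assms(1,2) ab by (cases "p < real CARD('n)") auto
    define C where "C = unit_ball_vol (real CARD('n)) * (real CARD('n) * a ^ (CARD('n) - 1))"
    have C: "C > 0"
      using ab by (simp add: C_def)
    define m where "m = measure lebesgue (annulus a b :: (real ^ 'n) set)"
    have "\<exists>u :: real ^ 'n \<Rightarrow> real. plap_weak_solution p (annulus a b) f u \<and>
        (AE x in lebesgue_on (annulus a b). u x \<ge> 0) \<and> C * real k \<le> m + W01p_norm p (annulus a b) u powr p" for k
    proof -
      obtain v P t where v: "bvp_solution p ?q f v P" "t \<in> {0..1}" "v t > real k"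
        using sol[of ?q "real k"] contq ab by blast
      obtain u :: "real ^ 'n \<Rightarrow> real" where u: "plap_weak_solution p (annulus a b) f u"
        "AE x in lebesgue_on (annulus a b). u x \<ge> 0" "C * v t \<le> m + W01p_norm p (annulus a b) u powr p"
        unfolding C_def m_def
        by (rule bvp_solution_annulus[OF assms(1,2) _ _ assms(3) v(1,2)], use ab in blast, use ab in blast, rule that,
            assumption, assumption, simp only: C_def m_def)
      have "C * real k \<le> C * v t"
        using C v(3) by simp
      with u show ?thesis by (intro exI[of _ u]) auto
    qed
    then obtain u :: "nat \<Rightarrow> real ^ 'n \<Rightarrow> real" where u: "\<And>k. plap_weak_solution p (annulus a b) f (u k)"
      "\<And>k. AE x in lebesgue_on (annulus a b). u k x \<ge> 0"
      "\<And>k. C * real k \<le> m + W01p_norm p (annulus a b) (u k) powr p"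
      by metis
    then show "\<exists>u :: nat \<Rightarrow> real ^ 'n \<Rightarrow> real.
           (\<forall>k. plap_weak_solution p (annulus a b) f (u k) \<and>
                (AE x in lebesgue_on (annulus a b). u k x \<ge> 0)) \<and>
           \<not> bdd_above (range (\<lambda>k. W01p_norm p (annulus a b) (u k)))"
      using assms(1) C not_bdd_above_if_growth[of p C "\<lambda>k. W01p_norm p (annulus a b) (u k)" m, OF _ _ W01p_norm_nonneg]
      by (intro exI[of _ u]) auto
  qed
qed

end
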